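(* Let $H$ be a separable real Hilbert space. For every $\mathtt M_1,\mathtt M_2\in\mathcal P_2(\mathcal P_2(H))$ we have $$\mathsf W_2^2(\mathtt M_1,\mathtt M_2)=\min\Big\{\int\Big(\int|x_1-x_2|^2\,d\gamma(x_1,x_2)\Big)\,d\boldsymbol{\mathtt P}(\gamma):\ \boldsymbol{\mathtt P}\in\mathrm R\Gamma(\mathtt M_1,\mathtt M_2)\Big\}.$$ Moreover, $\boldsymbol{\mathtt P}\in\mathrm R\Gamma(\mathtt M_1,\mathtt M_2)$ is optimal for this minimum problem if and only if $\boldsymbol{\mathtt P}$ is concentrated on the set of optimal couplings $\mathcal P_{2,o}(H\times H)$ and $\Pi:=(\pi^1_\sharp,\pi^2_\sharp)_\sharp\boldsymbol{\mathtt P}$ belongs to $\Gamma_o(\mathtt M_1,\mathtt M_2)$.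
   Context: For a complete separable metric space $(X,d)$, $\mathcal P_2(X)$ is the space of Borel probability measures with finite quadratic moment, endowed with the 2-Wasserstein metric induced by $d$. On $\mathcal P_2(H)$ this metric is $w_2$. On $\mathcal P_2(\mathcal P_2(H))$ (built on $(\mathcal P_2(H),w_2)$) the metric is $\mathsf W_2$: $\mathsf W_2^2(\mathtt M_1,\mathtt M_2)=\min\{\int w_2^2(\mu_1,\mu_2)\,d\Pi(\mu_1,\mu_2):\Pi\in\Gamma(\mathtt M_1,\mathtt M_2)\}$, where $\Gamma$ denotes couplings (on $\mathcal P_2(H)\times\mathcal P_2(H)$), and $\Gamma_o(\mathtt M_1,\mathtt M_2)$ is the set of minimizers. $\mathcal P_{2,o}(H\times H)$ is the set of $\gamma\in\mathcal P_2(H\times H)$ that are optimal couplings (for $w_2$) between their own marginals. $\pi^1,\pi^2:H\times H\to H$ are the projections, $\pi^i_\sharp:\mathcal P_2(H\times H)\to\mathcal P_2(H)$ the push-forward maps, and $\mathrm R\Gamma(\mathtt M_1,\mathtt M_2):=\{\boldsymbol{\mathtt P}\in\mathcal P_2(\mathcal P_2(H\times H)):(\pi^i_\sharp)_\sharp\boldsymbol{\mathtt P}=\mathtt M_i,\ i=1,2\}$ (random couplings). *)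

theory Defs
  imports "HOL-Probability.Probability"
begin

text \<open>
  Metric spaces are given by a carrier \<open>X\<close> and a distance \<open>d\<close>, so that the same construction
  applies to a Hilbert space and to the Wasserstein space over it. The open sets are spelled out
  because the facts about \<open>Metric_space.mtopology X d\<close> are available only after \<open>d\<close> has been
  shown to be a metric on \<open>X\<close>; then both agree, see \<open>metric_borel_eq_mtopology\<close>.
\<close>

definition metric_borel :: "'a set \<Rightarrow> ('a \<Rightarrow> 'a \<Rightarrow> real) \<Rightarrow> 'a measure" where
  "metric_borel X d = sigma X {U. U \<subseteq> X \<and> (\<forall>x\<in>U. \<exists>r>0. \<forall>y\<in>X. d x y < r \<longrightarrow> y \<in> U)}"

lemma metric_borel_eq_mtopology:
  assumes "Metric_space X d"
  shows "metric_borel X d = sigma X {U. openin (Metric_space.mtopology X d) U}"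
proof -
  interpret Metric_space X d by fact
  have *: "(\<forall>y\<in>X. d x y < r \<longrightarrow> y \<in> U) \<longleftrightarrow> mball x r \<subseteq> U" if "U \<subseteq> X" "x \<in> U" for U x r
    using that by (auto simp: mball_def)
  have "(U \<subseteq> X \<and> (\<forall>x\<in>U. \<exists>r>0. \<forall>y\<in>X. d x y < r \<longrightarrow> y \<in> U)) \<longleftrightarrow> openin mtopology U" for U
    using *[of U] by (simp add: openin_mtopology Ball_def cong: conj_cong imp_cong)
  then show ?thesis
    unfolding metric_borel_def by (simp only:)
qed

lemma metric_borel_UNIV_dist: "metric_borel UNIV dist = (borel :: 'a::metric_space measure)"
  unfolding metric_borel_def borel_def open_dist by (simp only: dist_commute subset_UNIV simp_thms Ball_def UNIV_I)

definition P2 :: "'a set \<Rightarrow> ('a \<Rightarrow> 'a \<Rightarrow> real) \<Rightarrow> 'a measure set" where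
  "P2 X d = {\<mu>. prob_space \<mu> \<and> sets \<mu> = sets (metric_borel X d) \<and>
                (\<exists>x\<^sub>0\<in>X. (\<integral>\<^sup>+x. ennreal ((d x\<^sub>0 x)\<^sup>2) \<partial>\<mu>) < \<infinity>)}"

text \<open>
  Couplings live on the product \<open>\<sigma>\<close>-algebra. On the separable spaces considered here it coincides
  with the Borel \<open>\<sigma>\<close>-algebra of the product topology.
\<close>

definition couplings :: "'a measure \<Rightarrow> 'b measure \<Rightarrow> ('a \<times> 'b) measure set" where
  "couplings \<mu> \<nu> = {\<theta>. prob_space \<theta> \<and> sets \<theta> = sets (\<mu> \<Otimes>\<^sub>M \<nu>) \<and>
                       distr \<theta> \<mu> fst = \<mu> \<and> distr \<theta> \<nu> snd = \<nu>}"

definition quad_cost :: "('a \<Rightarrow> 'a \<Rightarrow> real) \<Rightarrow> ('a \<times> 'a) measure \<Rightarrow> ennreal" where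
  "quad_cost d \<theta> = (\<integral>\<^sup>+(x, y). ennreal ((d x y)\<^sup>2) \<partial>\<theta>)"

definition wasserstein2 :: "('a \<Rightarrow> 'a \<Rightarrow> real) \<Rightarrow> 'a measure \<Rightarrow> 'a measure \<Rightarrow> real" where
  "wasserstein2 d \<mu> \<nu> = sqrt (enn2real (INF \<theta>\<in>couplings \<mu> \<nu>. quad_cost d \<theta>))"

definition opt_couplings :: "('a \<Rightarrow> 'a \<Rightarrow> real) \<Rightarrow> 'a measure \<Rightarrow> 'a measure \<Rightarrow> ('a \<times> 'a) measure set" where
  "opt_couplings d \<mu> \<nu> = {\<theta>. is_arg_min (quad_cost d) (\<lambda>\<theta>'. \<theta>' \<in> couplings \<mu> \<nu>) \<theta>}"

text \<open>
  In the following, the type \<open>'a\<close> is either the Hilbert space \<open>H\<close> or \<open>H \<times> H\<close>; on the product type,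
  \<open>dist\<close> is the distance of the Hilbert space \<open>H \<times> H\<close>.
\<close>

abbreviation prob2 :: "'a::metric_space measure set" where
  "prob2 \<equiv> P2 UNIV dist"

abbreviation w2 :: "'a::metric_space measure \<Rightarrow> 'a measure \<Rightarrow> real" where
  "w2 \<equiv> wasserstein2 dist"

abbreviation prob2_borel :: "'a::metric_space measure measure" where
  "prob2_borel \<equiv> metric_borel prob2 w2"

abbreviation prob2_prob2 :: "'a::metric_space measure measure set" where
  "prob2_prob2 \<equiv> P2 prob2 w2"

abbreviation W2 :: "'a::metric_space measure measure \<Rightarrow> 'a measure measure \<Rightarrow> real" where
  "W2 \<equiv> wasserstein2 w2"

abbreviation marg1 :: "('a::metric_space \<times> 'a) measure \<Rightarrow> 'a measure" where
  "marg1 \<gamma> \<equiv> distr \<gamma> borel fst"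

abbreviation marg2 :: "('a::metric_space \<times> 'a) measure \<Rightarrow> 'a measure" where
  "marg2 \<gamma> \<equiv> distr \<gamma> borel snd"

definition opt_prob2 :: "('a::metric_space \<times> 'a) measure set" where
  "opt_prob2 = {\<gamma> \<in> prob2. \<gamma> \<in> opt_couplings dist (marg1 \<gamma>) (marg2 \<gamma>)}"

definition random_couplings ::
  "'a::metric_space measure measure \<Rightarrow> 'a measure measure \<Rightarrow> ('a \<times> 'a) measure measure set" where
  "random_couplings M\<^sub>1 M\<^sub>2 =
     {P \<in> prob2_prob2. distr P prob2_borel marg1 = M\<^sub>1 \<and> distr P prob2_borel marg2 = M\<^sub>2}"

definition random_cost :: "('a::real_normed_vector \<times> 'a) measure measure \<Rightarrow> ennreal" where
  "random_cost P = (\<integral>\<^sup>+\<gamma>. (\<integral>\<^sup>+(x\<^sub>1, x\<^sub>2). ennreal ((norm (x\<^sub>1 - x\<^sub>2))\<^sup>2) \<partial>\<gamma>) \<partial>P)"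

end

theory Submission imports Defs begin

text \<open>
  A random coupling \<open>P\<close> induces a coupling of \<open>M\<^sub>1\<close> and \<open>M\<^sub>2\<close> by \<open>\<gamma> \<mapsto> (marg1 \<gamma>, marg2 \<gamma>)\<close>, and the inner cost of \<open>\<gamma>\<close>
  is at least \<open>w2\<^sup>2\<close> of its marginals. Hence the random cost is at least the cost of the induced coupling,
  which is at least \<open>W2\<^sup>2\<close>; equality holds iff almost every \<open>\<gamma>\<close> is optimal and the induced coupling is.
  Conversely, the image of an optimal coupling under a measurable selection \<open>(\<mu>, \<nu>) \<mapsto> \<gamma>\<close> of optimal plans
  attains \<open>W2\<^sup>2\<close>.

  Both the optimal coupling and the selection come from one compactness principle. A Polish space is a
  measurable retract of the Cantor space, and so is the space of probability measures over it; couplings with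
  fixed marginals whose values converge on all rectangles of cylinders therefore converge to a coupling, and the
  cost is lower semicontinuous along such sequences. Convergent subsequences can be chosen measurably in
  \<open>(\<mu>, \<nu>)\<close>, and near-optimal plans can be chosen measurably from an explicit countable family of plans that
  are piecewise constant with respect to the product measure on a partition into small cells.
\<close>

section \<open>Coding by bits\<close>

text \<open>Existence of optimal couplings is needed on two levels, over \<open>H\<close> with cost
  \<open>dist\<close> and over the Wasserstein space with cost \<open>w2\<close>; neither space need
  be locally compact. On the Cantor space every sequence of laws has a limit point, so with codes
  the only danger is that a limit charges sequences that are not codes, and the fixed marginals
  exclude it. The codes are merely measurable, so semicontinuity of the cost cannot be read off from
  a topology; instead, cells of small diameter are written into the code as extra bits, which makes
  step functions of the distance visible to the limit. The other obstacle is that the infimum runs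
  over uncountably many couplings while the selection must be measurable in the marginals. Hence
  near-optimal plans are sought that are explicit formulas in \<mu> and \<nu> with countably many
  parameters. The same formulas, applied to two measures that share a list of weights, cut the
  Wasserstein space into countably many small measurable cells; this identifies its Borel sets with
  those generated by evaluation of measures on sets.\<close>

abbreviation bits :: "(nat \<Rightarrow> bool) measure" where
  "bits \<equiv> PiM UNIV (\<lambda>_. count_space UNIV)"

text \<open>Only positive conditions on bits are imposed, so that these sets are closed under
  intersection and form a pi-system; bits that are false enter through complements.\<close>

definition cyl :: "nat set \<Rightarrow> (nat \<Rightarrow> bool) set" where
  "cyl I = {b. \<forall>i\<in>I. b i}"

lemma space_bits [simp]: "space bits = UNIV"
  by (simp add: space_PiM PiE_UNIV_domain)

lemma measurable_bit [measurable]: "Measurable.pred bits (\<lambda>b. b i)"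
  by (rule measurable_component_singleton) simp

lemma cyl_in_sets [measurable]: "cyl I \<in> sets bits"
proof -
  have "{b \<in> space bits. \<forall>i\<in>I. b i} \<in> sets bits"
    by measurable
  then show ?thesis by (simp add: cyl_def)
qed

lemma cyl_Int: "cyl I \<inter> cyl J = cyl (I \<union> J)"
  by (auto simp: cyl_def)

lemma cyl_eq_vimage: "(\<lambda>b. b i) -` A \<in> {{}, UNIV, cyl {i}, UNIV - cyl {i}}"
proof -
  have "A \<in> Pow UNIV" by simp
  then have "A = {} \<or> A = UNIV \<or> A = {True} \<or> A = {False}"
    unfolding UNIV_bool Pow_insert Pow_empty by auto
  then show ?thesis by (auto simp: cyl_def)
qed

lemma sets_bits_cyl: "sets bits = sigma_sets UNIV (cyl ` {I. finite I})"
proof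
  let ?G = "cyl ` {I. finite I}"
  have "(\<lambda>x. x) \<in> sigma UNIV ?G \<rightarrow>\<^sub>M bits"
  proof (rule measurable_PiM_single')
    fix i :: nat
    show "(\<lambda>x. x i) \<in> sigma UNIV ?G \<rightarrow>\<^sub>M count_space UNIV"
    proof (rule measurableI)
      fix A :: "bool set"
      have 1: "cyl {i} \<in> sigma_sets UNIV ?G"
        by (intro sigma_sets.Basic) auto
      then have 2: "UNIV - cyl {i} \<in> sigma_sets UNIV ?G"
        by (rule sigma_sets.Compl)
      show "(\<lambda>x. x i) -` A \<inter> space (sigma UNIV ?G) \<in> sets (sigma UNIV ?G)"
        using cyl_eq_vimage[of i A] 1 2 sigma_sets_top[of UNIV ?G] by (auto intro: sigma_sets.Empty)
    qed auto
  qed (auto simp: space_PiM)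
  then have "(\<lambda>x. x) -` X \<inter> space (sigma UNIV ?G) \<in> sets (sigma UNIV ?G)" if "X \<in> sets bits" for X
    using that by (rule measurable_sets)
  then show "sets bits \<subseteq> sigma_sets UNIV ?G"
    by auto
  show "sigma_sets UNIV ?G \<subseteq> sets bits"
    using sets.sigma_sets_subset[of ?G bits] by (metis cyl_in_sets image_subsetI space_bits)
qed

lemma Int_stable_cyl: "Int_stable (cyl ` {I. finite I})"
  by (auto simp: Int_stable_def cyl_Int)

lemma measurable_bitsI: "(\<And>i. Measurable.pred M (\<lambda>x. f x i)) \<Longrightarrow> f \<in> M \<rightarrow>\<^sub>M bits"
  by (intro measurable_PiM_single') (auto simp: space_PiM)

text \<open>On the Cantor set the ternary digits are restrictions of continuous functions of the real line.\<close>

definition digit :: "real \<Rightarrow> real" where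
  "digit t = max 0 (min 1 (3 * t - 1))"

text \<open>On the Cantor set this is the left shift of the ternary expansion: multiplication by 3
  brings the first digit, 0 or 2, in front of the point, and subtracting twice \<open>digit\<close>
  removes it. As a formula it is defined and continuous on the whole line, as weak convergence of
  real distributions requires.\<close>

fun shift :: "nat \<Rightarrow> real \<Rightarrow> real" where
  "shift 0 z = z"
| "shift (Suc i) z = 3 * shift i z - 2 * digit (shift i z)"

definition cantor :: "(nat \<Rightarrow> bool) \<Rightarrow> real" where
  "cantor b = (\<Sum>i. 2 * of_bool (b i) * (1/3) ^ Suc i)"

lemma summable_cantor: "summable (\<lambda>i. 2 * of_bool (b i) * (1/3::real) ^ Suc i)"
  by (rule summable_comparison_test[of _ "\<lambda>i. 2 * (1/3::real) ^ Suc i"])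
     (auto intro!: exI[of _ 0] summable_mult summable_geometric simp: summable_Suc_iff)

lemma cantor_bounds: "0 \<le> cantor b" "cantor b \<le> 1"
proof -
  show "0 \<le> cantor b" unfolding cantor_def by (intro suminf_nonneg summable_cantor) auto
  have s: "(\<lambda>i. 2 * (1/3::real) ^ Suc i) sums 1"
    using sums_mult[OF geometric_sums[of "1/3::real"], of "2/3"] by simp
  have "cantor b \<le> (\<Sum>i. 2 * (1/3::real) ^ Suc i)"
    unfolding cantor_def by (rule suminf_le[OF _ summable_cantor sums_summable[OF s]]) simp
  then show "cantor b \<le> 1"
    using sums_unique[OF s] by simp
qed

lemma cantor_split: "cantor b = 2 / 3 * of_bool (b 0) + cantor (\<lambda>j. b (Suc j)) / 3"
proof -
  have "cantor b = 2 * of_bool (b 0) * (1/3) + (\<Sum>i. 2 * of_bool (b (Suc i)) * (1/3) ^ Suc (Suc i))"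
    unfolding cantor_def using suminf_split_head[OF summable_cantor[of b]] by simp
  also have "(\<Sum>i. 2 * of_bool (b (Suc i)) * (1/3::real) ^ Suc (Suc i)) = (\<Sum>i. (2 * of_bool (b (Suc i)) * (1/3) ^ Suc i) * (1/3))"
    by (intro suminf_cong) simp
  also have "\<dots> = cantor (\<lambda>j. b (Suc j)) * (1/3)"
    unfolding cantor_def by (intro suminf_mult2[symmetric] summable_cantor)
  finally show ?thesis by simp
qed

lemma digit_cantor: "digit (cantor b) = of_bool (b 0)"
  using cantor_bounds[of "\<lambda>j. b (Suc j)"] by (auto simp: cantor_split[of b] digit_def)

lemma shift_cantor: "shift i (cantor b) = cantor (\<lambda>j. b (i + j))"
proof (induction i)
  case (Suc i)
  then show ?case
    using cantor_split[of "\<lambda>j. b (i + j)"] digit_cantor[of "\<lambda>j. b (i + j)"] by simp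
qed simp

lemma digit_shift_cantor: "digit (shift i (cantor b)) = of_bool (b i)"
  by (simp add: shift_cantor digit_cantor)

lemma continuous_digit_shift: "continuous_on UNIV (\<lambda>z. digit (shift i z))"
proof -
  have d: "continuous_on UNIV digit" unfolding digit_def by (intro continuous_intros)
  have "continuous_on UNIV (shift i)"
  proof (induction i)
    case (Suc i)
    then have "continuous_on UNIV (\<lambda>z. digit (shift i z))"
      by (intro continuous_on_compose2[OF d]) auto
    with Suc show ?case by (auto intro!: continuous_intros)
  qed (simp add: continuous_on_id)
  then show ?thesis by (intro continuous_on_compose2[OF d]) auto
qed

lemma digit_bounds: "0 \<le> digit t" "digit t \<le> 1"
  by (auto simp: digit_def)

lemma digit_mult_bound: "\<bar>digit t * (1 - digit t)\<bar> \<le> 1"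
proof -
  have "\<bar>digit t\<bar> * \<bar>1 - digit t\<bar> \<le> 1"
    using digit_bounds[of t] by (intro mult_le_one) auto
  then show ?thesis by (simp add: abs_mult)
qed

lemma borel_measurable_cantor [measurable]: "cantor \<in> borel_measurable bits"
  unfolding cantor_def by measurable

text \<open>Compactness of the Cantor space enters through Helly's selection theorem.\<close>

lemma bits_limit:
  fixes \<rho> :: "nat \<Rightarrow> (nat \<Rightarrow> bool) measure"
  assumes \<rho>: "\<And>n. prob_space (\<rho> n)" "\<And>n. sets (\<rho> n) = sets bits"
    and p: "\<And>I. finite I \<Longrightarrow> (\<lambda>n. measure (\<rho> n) (cyl I)) \<longlonglongrightarrow> p I"
  obtains \<rho>' where "prob_space \<rho>'" "sets \<rho>' = sets bits" "\<And>I. finite I \<Longrightarrow> measure \<rho>' (cyl I) = p I"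
proof -
  note [measurable_cong] = \<rho>(2)
  define \<sigma> where "\<sigma> n = distr (\<rho> n) borel cantor" for n
  let ?d = "\<lambda>i z. digit (shift i z)"
  have [measurable]: "?d i \<in> borel_measurable borel" for i
    by (rule borel_measurable_continuous_onI[OF continuous_digit_shift])
  have space_\<rho>: "space (\<rho> n) = UNIV" for n
    using sets_eq_imp_space_eq[OF \<rho>(2)] by simp
  have rd: "real_distribution (\<sigma> n)" for n
    unfolding \<sigma>_def by (intro prob_space.real_distribution_distr \<rho>) measurable
  \<comment> \<open>Tightness is tested on half-open intervals, so the left end must lie below 0,
    the image of the constantly false sequence.\<close>
  have vim: "cantor -` {-1<..1} = UNIV"
  proof -
    have "-1 < cantor b" for b using cantor_bounds(1)[of b] by linarith
    then show ?thesis using cantor_bounds(2) by auto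
  qed
  have meas1: "measure (\<sigma> n) {-1<..1} = 1" for n
  proof -
    have "measure (\<sigma> n) {-1<..1} = measure (\<rho> n) (space (\<rho> n))"
      unfolding \<sigma>_def by (subst measure_distr) (simp_all add: vim space_\<rho>)
    then show ?thesis using prob_space.prob_space[OF \<rho>(1)] by simp
  qed
  have "tight \<sigma>"
    unfolding tight_def
  proof (intro conjI allI impI rd)
    fix \<epsilon> :: real assume "0 < \<epsilon>"
    then have "(-1::real) < 1 \<and> (\<forall>n. 1 - \<epsilon> < measure (\<sigma> n) {-1<..1})" by (simp add: meas1)
    then show "\<exists>a b. a < b \<and> (\<forall>n. 1 - \<epsilon> < measure (\<sigma> n) {a<..b})" by blast
  qed
  from tight_imp_convergent_subsubsequence[OF this strict_mono_id]
  obtain r S where r: "strict_mono (r :: nat \<Rightarrow> nat)" and S: "real_distribution S" and wc: "weak_conv_m (\<sigma> \<circ> r) S"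
    by auto
  interpret S: real_distribution S by fact
  have conv: "(\<lambda>n. integral\<^sup>L (\<sigma> (r n)) f) \<longlonglongrightarrow> integral\<^sup>L S f"
    if "continuous_on UNIV f" "\<And>x. norm (f x) \<le> 1" for f :: "real \<Rightarrow> real"
  proof -
    have "isCont f x" for x
      using that(1) by (simp add: continuous_on_eq_continuous_at)
    from weak_conv_imp_integral_bdd_continuous_conv[OF _ S wc this that(2)] rd show ?thesis by simp
  qed
  have int_\<sigma>: "integral\<^sup>L (\<sigma> n) f = integral\<^sup>L (\<rho> n) (\<lambda>b. f (cantor b))"
    if "f \<in> borel_measurable borel" for f :: "real \<Rightarrow> real" and n
    unfolding \<sigma>_def using that by (simp add: integral_distr)
  have prodI: "(\<Prod>i\<in>I. of_bool (b i)) = (indicator (cyl I) b :: real)" if "finite I" for I and b :: "nat \<Rightarrow> bool"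
    using that by (auto simp: cyl_def indicator_def prod_zero_iff)
  \<comment> \<open>The function \<open>?d i z * (1 - ?d i z)\<close> is continuous, nonnegative and
    zero on the Cantor set. Its integral therefore stays 0 in the limit, so the limit law gives no
    mass to points with a fractional digit.\<close>
  have dd: "integral\<^sup>L S (\<lambda>z. ?d i z * (1 - ?d i z)) = 0" for i
  proof -
    have "(\<lambda>n. integral\<^sup>L (\<sigma> (r n)) (\<lambda>z. ?d i z * (1 - ?d i z))) \<longlonglongrightarrow> integral\<^sup>L S (\<lambda>z. ?d i z * (1 - ?d i z))"
      using digit_mult_bound
      by (intro conv continuous_on_mult continuous_on_diff continuous_on_const continuous_digit_shift) auto
    moreover have "integral\<^sup>L (\<sigma> n) (\<lambda>z. ?d i z * (1 - ?d i z)) = 0" for n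
    proof -
      have *: "(\<lambda>b. ?d i (cantor b) * (1 - ?d i (cantor b))) = (\<lambda>b. 0)"
        by (auto simp: digit_shift_cantor)
      show ?thesis by (subst int_\<sigma>) (measurable, simp add: *)
    qed
    ultimately show ?thesis by (simp add: LIMSEQ_const_iff)
  qed
  have "AE z in S. ?d i z * (1 - ?d i z) = 0" for i
  proof (subst integral_nonneg_eq_0_iff_AE[symmetric])
    show "integrable S (\<lambda>z. ?d i z * (1 - ?d i z))"
      using digit_mult_bound by (intro S.integrable_const_bound[where B=1]) auto
  qed (use dd digit_bounds in auto)
  then have "AE z in S. ?d i z = of_bool (?d i z > 1/2)" for i
    by (rule AE_mp) (auto intro!: AE_I2)
  then have AE: "AE z in S. \<forall>i. ?d i z = of_bool (?d i z > 1/2)"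
    by (subst AE_all_countable) blast
  \<comment> \<open>The threshold 1/2 turns digits into bits at every real number; almost surely it
    only reads off digits that are already 0 or 1.\<close>
  define \<rho>' where "\<rho>' = distr S bits (\<lambda>z i. ?d i z > 1/2)"
  have dec [measurable]: "(\<lambda>z i. ?d i z > 1/2) \<in> borel \<rightarrow>\<^sub>M bits"
    by (rule measurable_bitsI) measurable
  have dec': "(\<lambda>z i. ?d i z > 1/2) \<in> S \<rightarrow>\<^sub>M bits"
    by measurable
  show ?thesis
  proof
    show "prob_space \<rho>'" unfolding \<rho>'_def by (intro S.prob_space_distr) measurable
    show "sets \<rho>' = sets bits" by (simp add: \<rho>'_def)
    fix I :: "nat set" assume I: "finite I"
    have "measure \<rho>' (cyl I) = integral\<^sup>L \<rho>' (indicator (cyl I))"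
      by (simp add: \<rho>'_def)
    also have "\<dots> = integral\<^sup>L S (\<lambda>z. \<Prod>i\<in>I. of_bool (?d i z > 1/2))"
      unfolding \<rho>'_def by (subst integral_distr[OF dec']) (simp_all add: prodI[OF I])
    also have "\<dots> = integral\<^sup>L S (\<lambda>z. \<Prod>i\<in>I. ?d i z)"
    proof (rule integral_cong_AE)
      show "AE z in S. (\<Prod>i\<in>I. of_bool (?d i z > 1/2)) = (\<Prod>i\<in>I. ?d i z)"
        using AE by eventually_elim (intro prod.cong, auto)
    qed measurable
    finally have m: "measure \<rho>' (cyl I) = integral\<^sup>L S (\<lambda>z. \<Prod>i\<in>I. ?d i z)" .
    \<comment> \<open>On codes the indicator of a cylinder is a finite product of digits, which is a
      continuous function on the line, so weak convergence applies to it.\<close>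
    have "(\<lambda>n. integral\<^sup>L (\<sigma> (r n)) (\<lambda>z. \<Prod>i\<in>I. ?d i z)) \<longlonglongrightarrow> integral\<^sup>L S (\<lambda>z. \<Prod>i\<in>I. ?d i z)"
      using digit_bounds
      by (intro conv continuous_on_prod continuous_digit_shift) (auto simp: abs_prod intro!: prod_le_1)
    moreover have "integral\<^sup>L (\<sigma> n) (\<lambda>z. \<Prod>i\<in>I. ?d i z) = measure (\<rho> n) (cyl I)" for n
      by (subst int_\<sigma>) (measurable, simp add: digit_shift_cantor prodI[OF I] space_\<rho>)
    ultimately have "(\<lambda>n. measure (\<rho> (r n)) (cyl I)) \<longlonglongrightarrow> measure \<rho>' (cyl I)"
      by (simp add: m)
    moreover have "(\<lambda>n. measure (\<rho> (r n)) (cyl I)) \<longlonglongrightarrow> p I"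
      using LIMSEQ_subseq_LIMSEQ[OF p[OF I] r] by (simp add: o_def)
    ultimately show "measure \<rho>' (cyl I) = p I" by (rule LIMSEQ_unique)
  qed
qed

lemma bits_measure_eqI:
  assumes "prob_space \<rho>" "sets \<rho> = sets bits" "prob_space \<rho>'" "sets \<rho>' = sets bits"
    and eq: "\<And>I. finite I \<Longrightarrow> measure \<rho> (cyl I) = measure \<rho>' (cyl I)"
  shows "\<rho> = \<rho>'"
proof (rule measure_eqI_generator_eq[OF Int_stable_cyl])
  interpret a: prob_space \<rho> by fact
  interpret b: prob_space \<rho>' by fact
  show "cyl ` {I. finite I} \<subseteq> Pow UNIV" by auto
  show "sets \<rho> = sigma_sets UNIV (cyl ` {I. finite I})" "sets \<rho>' = sigma_sets UNIV (cyl ` {I. finite I})"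
    using assms sets_bits_cyl by auto
  show "emeasure \<rho> X = emeasure \<rho>' X" if "X \<in> cyl ` {I. finite I}" for X
    using that eq by (auto simp: a.emeasure_eq_measure b.emeasure_eq_measure)
  have c: "UNIV = cyl {}" by (auto simp: cyl_def)
  show "range (\<lambda>_::nat. UNIV) \<subseteq> cyl ` {I. finite I}" by (auto simp: c)
  show "(\<Union>i::nat. UNIV) = UNIV" by auto
  show "emeasure \<rho> UNIV \<noteq> \<infinity>" for i :: nat by simp
qed

section \<open>Measurable retracts of the Cantor space\<close>

text \<open>No continuity is asked, so the notion passes to countable refinements, products,
  measurable subsets and spaces of probability measures. The decoding \<open>g\<close> is defined on
  all sequences, which allows limits of codes to be decoded before they are known to be
  codes.\<close>

definition bit_coded :: "'a measure \<Rightarrow> ('a \<Rightarrow> nat \<Rightarrow> bool) \<Rightarrow> ((nat \<Rightarrow> bool) \<Rightarrow> 'a) \<Rightarrow> bool" where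
  "bit_coded M h g \<longleftrightarrow> h \<in> M \<rightarrow>\<^sub>M bits \<and> g \<in> bits \<rightarrow>\<^sub>M M \<and> (\<forall>x\<in>space M. g (h x) = x)"

lemma dense_sequence:
  obtains x :: "nat \<Rightarrow> 'a::{metric_space, second_countable_topology}"
  where "\<And>y e. e > 0 \<Longrightarrow> \<exists>k. dist y (x k) < e"
proof -
  obtain D :: "'a set" where D: "countable D" "\<And>X. open X \<Longrightarrow> X \<noteq> {} \<Longrightarrow> \<exists>d\<in>D. d \<in> X"
    using countable_dense_setE by blast
  have "D \<noteq> {}" using D(2)[of UNIV] by auto
  show ?thesis
  proof (rule that[of "from_nat_into D"])
    fix y :: 'a and e :: real assume "e > 0"
    then obtain d where "d \<in> D" "d \<in> ball y e" using D(2)[of "ball y e"] by force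
    then show "\<exists>k. dist y (from_nat_into D k) < e"
      using D(1) from_nat_into_to_nat_on[OF D(1) \<open>d \<in> D\<close>] by (intro exI[of _ "to_nat_on D d"]) simp
  qed
qed

text \<open>Bit \<open>(m, k)\<close> of a point tells whether it is within \<open>(1/2) ^ m\<close>
  of the \<open>k\<close>-th point of a dense sequence. The first true bit of level \<open>m\<close>
  gives an approximation of that precision, and completeness makes the approximations
  converge.\<close>

lemma bit_coded_polish:
  obtains h g where "bit_coded (borel :: 'a::{complete_space, second_countable_topology} measure) h g"
proof -
  obtain x :: "nat \<Rightarrow> 'a" where x: "\<And>y e. e > 0 \<Longrightarrow> \<exists>k. dist y (x k) < e"
    using dense_sequence by blast
  define h where "h y i = (case prod_decode i of (m, k) \<Rightarrow> dist y (x k) < (1/2) ^ m)" for y i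
  define s where "s m b = x (LEAST k. b (prod_encode (m, k)))" for m b
  \<comment> \<open>For bit sequences whose approximations are not Cauchy the constant
    \<open>x 0\<close> is used; then the limit exists for every sequence of bits and is measurable
    as a pointwise limit.\<close>
  define s' where "s' m b = (if Cauchy (\<lambda>m. s m b) then s m b else x 0)" for m b
  define g where "g b = lim (\<lambda>m. s' m b)" for b
  have [measurable]: "s m \<in> borel_measurable bits" for m
    unfolding s_def by (rule measurable_compose[OF measurable_Least]) auto
  have [measurable]: "s' m \<in> borel_measurable bits" for m
    unfolding s'_def by measurable
  have "(\<lambda>m. s' m b) \<longlonglongrightarrow> g b" for b
  proof -
    have "Cauchy (\<lambda>m. s' m b)"
    proof (cases "Cauchy (\<lambda>m. s m b)")
      case True then show ?thesis by (simp add: s'_def)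
    next
      case False
      then have "(\<lambda>m. s' m b) = (\<lambda>m. x 0)" by (simp add: s'_def)
      then show ?thesis by (simp only: LIMSEQ_imp_Cauchy[OF tendsto_const])
    qed
    then show ?thesis unfolding g_def by (intro convergent_LIMSEQ_iff[THEN iffD1] Cauchy_convergent)
  qed
  then have g: "g \<in> borel_measurable bits"
    by (intro borel_measurable_LIMSEQ_metric[where f = s' and g = g]) auto
  have h: "h \<in> borel \<rightarrow>\<^sub>M bits"
  proof (rule measurable_bitsI)
    fix i show "Measurable.pred borel (\<lambda>y. h y i)"
      unfolding h_def by (cases "prod_decode i") simp
  qed
  have "g (h y) = y" for y
  proof -
    have le: "dist y (s m (h y)) < (1/2) ^ m" for m
    proof -
      have "\<exists>k. h y (prod_encode (m, k))" using x[of "(1/2)^m" y] by (auto simp: h_def)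
      from LeastI_ex[OF this] show ?thesis by (simp add: s_def h_def)
    qed
    have "(\<lambda>m. (1/2::real) ^ m) \<longlonglongrightarrow> 0" by (intro LIMSEQ_power_zero) auto
    then have "(\<lambda>m. dist (s m (h y)) y) \<longlonglongrightarrow> 0"
      by (rule tendsto_sandwich[OF _ _ tendsto_const, rotated 2]) (use le in \<open>auto simp: dist_commute less_imp_le\<close>)
    then have lim: "(\<lambda>m. s m (h y)) \<longlonglongrightarrow> y" by (rule tendsto_dist_iff[THEN iffD2])
    then have "(\<lambda>m. s' m (h y)) \<longlonglongrightarrow> y" by (simp add: s'_def LIMSEQ_imp_Cauchy)
    then show ?thesis unfolding g_def by (rule limI)
  qed
  then have "bit_coded borel h g" using g h by (auto simp: bit_coded_def)
  then show ?thesis by (rule that)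
qed

text \<open>Any countable family of measurable sets becomes a family of one-bit cylinders: the odd
  bits record membership, the even bits keep the old code, and decoding ignores the odd
  ones.\<close>

lemma bit_coded_append:
  assumes "bit_coded M h g" and A: "\<And>i. A i \<in> sets M"
  shows "bit_coded M (\<lambda>x i. if even i then h x (i div 2) else x \<in> A (i div 2)) (\<lambda>b. g (\<lambda>i. b (2 * i)))"
proof -
  have [measurable]: "h \<in> M \<rightarrow>\<^sub>M bits" "g \<in> bits \<rightarrow>\<^sub>M M" and "\<forall>x\<in>space M. g (h x) = x"
    using assms by (auto simp: bit_coded_def)
  note [measurable] = A
  have "(\<lambda>x i. if even i then h x (i div 2) else x \<in> A (i div 2)) \<in> M \<rightarrow>\<^sub>M bits"
    by (rule measurable_bitsI) measurable
  moreover have "(\<lambda>b i. b (2 * i)) \<in> bits \<rightarrow>\<^sub>M bits"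
    by (rule measurable_bitsI) measurable
  then have "(\<lambda>b. g (\<lambda>i. b (2 * i))) \<in> bits \<rightarrow>\<^sub>M M" by measurable
  ultimately show ?thesis using \<open>\<forall>x\<in>space M. g (h x) = x\<close> by (simp add: bit_coded_def)
qed

section \<open>Limits of couplings\<close>

lemma couplingsD:
  assumes "\<theta> \<in> couplings \<mu> \<nu>"
  shows "prob_space \<theta>" "sets \<theta> = sets (\<mu> \<Otimes>\<^sub>M \<nu>)" "distr \<theta> \<mu> fst = \<mu>" "distr \<theta> \<nu> snd = \<nu>"
    "space \<theta> = space \<mu> \<times> space \<nu>"
  using assms sets_eq_imp_space_eq[of \<theta> "\<mu> \<Otimes>\<^sub>M \<nu>"] by (auto simp: couplings_def space_pair_measure)

lemma coupling_measure_fst: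
  assumes "\<theta> \<in> couplings \<mu> \<nu>" "A \<in> sets \<mu>"
  shows "measure \<theta> (A \<times> space \<nu>) = measure \<mu> A"
proof -
  note c = couplingsD[OF assms(1)]
  note [measurable_cong] = c(2)
  have "measure \<mu> A = measure (distr \<theta> \<mu> fst) A" by (simp add: c)
  also have "\<dots> = measure \<theta> (fst -` A \<inter> space \<theta>)"
    using assms(2) by (intro measure_distr) measurable
  also have "fst -` A \<inter> space \<theta> = A \<times> space \<nu>"
    using sets.sets_into_space[OF assms(2)] by (auto simp: c)
  finally show ?thesis by simp
qed

lemma coupling_measure_snd:
  assumes "\<theta> \<in> couplings \<mu> \<nu>" "A \<in> sets \<nu>"
  shows "measure \<theta> (space \<mu> \<times> A) = measure \<nu> A"
proof -
  note c = couplingsD[OF assms(1)]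
  note [measurable_cong] = c(2)
  have "measure \<nu> A = measure (distr \<theta> \<nu> snd) A" by (simp add: c)
  also have "\<dots> = measure \<theta> (snd -` A \<inter> space \<theta>)"
    using assms(2) by (intro measure_distr) measurable
  also have "snd -` A \<inter> space \<theta> = space \<mu> \<times> A"
    using sets.sets_into_space[OF assms(2)] by (auto simp: c)
  finally show ?thesis by simp
qed

section \<open>Codes for products\<close>

definition cylM :: "'a measure \<Rightarrow> ('a \<Rightarrow> nat \<Rightarrow> bool) \<Rightarrow> nat set \<Rightarrow> 'a set" where
  "cylM M h I = {x \<in> space M. \<forall>i\<in>I. h x i}"

lemma cylM_sets [measurable]: "h \<in> M \<rightarrow>\<^sub>M bits \<Longrightarrow> cylM M h I \<in> sets M"
  unfolding cylM_def by measurable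

lemma cylM_Int: "cylM M h I \<inter> cylM M h J = cylM M h (I \<union> J)"
  by (auto simp: cylM_def)

definition half_ev :: "nat set \<Rightarrow> nat set" where "half_ev I = {i. 2 * i \<in> I}"
definition half_od :: "nat set \<Rightarrow> nat set" where "half_od I = {i. 2 * i + 1 \<in> I}"

lemma finite_half: "finite I \<Longrightarrow> finite (half_ev I)" "finite I \<Longrightarrow> finite (half_od I)"
  unfolding half_ev_def half_od_def
  using finite_vimageI[of I "\<lambda>i. 2 * i"] finite_vimageI[of I "\<lambda>i. 2 * i + 1"]
  by (auto simp: vimage_def inj_on_def)

lemma half_Un:
  "half_ev ((*) 2 ` I \<union> (\<lambda>i. 2 * i + 1) ` J) = I" "half_od ((*) 2 ` I \<union> (\<lambda>i. 2 * i + 1) ` J) = J"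
  unfolding half_ev_def half_od_def by (auto, presburger+)

text \<open>Interleaving is chosen so that the cylinders of a pair are exactly the rectangles of
  cylinders; \<open>half_ev\<close> and \<open>half_od\<close> split the index set
  accordingly.\<close>

definition pair_code :: "('a \<Rightarrow> nat \<Rightarrow> bool) \<Rightarrow> ('b \<Rightarrow> nat \<Rightarrow> bool) \<Rightarrow> 'a \<times> 'b \<Rightarrow> nat \<Rightarrow> bool" where
  "pair_code h h' = (\<lambda>(x, y) i. if even i then h x (i div 2) else h' y (i div 2))"

lemma measurable_pair_code:
  assumes [measurable]: "h \<in> M \<rightarrow>\<^sub>M bits" "h' \<in> N \<rightarrow>\<^sub>M bits"
  shows "pair_code h h' \<in> M \<Otimes>\<^sub>M N \<rightarrow>\<^sub>M bits"
  unfolding pair_code_def split_beta by (rule measurable_bitsI) measurable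

lemma measurable_ev_od [measurable]:
  "(\<lambda>b i. b (2 * i)) \<in> bits \<rightarrow>\<^sub>M bits" "(\<lambda>b i. b (2 * i + 1)) \<in> bits \<rightarrow>\<^sub>M bits"
  by (auto intro!: measurable_bitsI)

lemma pair_code_all:
  "(\<forall>i\<in>I. pair_code h h' (x, y) i) \<longleftrightarrow> (\<forall>i\<in>half_ev I. h x i) \<and> (\<forall>i\<in>half_od I. h' y i)"
proof (intro iffI conjI ballI)
  fix i assume *: "\<forall>i\<in>I. pair_code h h' (x, y) i"
  show "h x i" if "i \<in> half_ev I" using bspec[OF *, of "2 * i"] that by (simp add: half_ev_def pair_code_def)
  show "h' y i" if "i \<in> half_od I" using bspec[OF *, of "2 * i + 1"] that by (simp add: half_od_def pair_code_def)
next
  fix i assume "(\<forall>i\<in>half_ev I. h x i) \<and> (\<forall>i\<in>half_od I. h' y i)" "i \<in> I"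
  then show "pair_code h h' (x, y) i"
    by (auto simp: half_ev_def half_od_def pair_code_def elim!: evenE oddE)
qed

lemma cylM_pair_code: "cylM (M \<Otimes>\<^sub>M N) (pair_code h h') I = cylM M h (half_ev I) \<times> cylM N h' (half_od I)"
  by (simp add: set_eq_iff cylM_def space_pair_measure pair_code_all) blast

lemma bit_coded_pair:
  assumes "bit_coded M h g" "bit_coded N h' g'"
  shows "bit_coded (M \<Otimes>\<^sub>M N) (pair_code h h') (\<lambda>b. (g (\<lambda>i. b (2 * i)), g' (\<lambda>i. b (2 * i + 1))))"
proof -
  have [measurable]: "h \<in> M \<rightarrow>\<^sub>M bits" "g \<in> bits \<rightarrow>\<^sub>M M" "h' \<in> N \<rightarrow>\<^sub>M bits" "g' \<in> bits \<rightarrow>\<^sub>M N"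
    using assms by (auto simp: bit_coded_def)
  have "(\<lambda>b. (g (\<lambda>i. b (2 * i)), g' (\<lambda>i. b (2 * i + 1)))) \<in> bits \<rightarrow>\<^sub>M M \<Otimes>\<^sub>M N"
    by measurable
  then show ?thesis
    unfolding bit_coded_def
  proof (intro conjI ballI)
    show "pair_code h h' \<in> M \<Otimes>\<^sub>M N \<rightarrow>\<^sub>M bits" by (rule measurable_pair_code) measurable
    show "(g (\<lambda>i. pair_code h h' z (2 * i)), g' (\<lambda>i. pair_code h h' z (2 * i + 1))) = z"
      if "z \<in> space (M \<Otimes>\<^sub>M N)" for z
      using that assms by (auto simp: bit_coded_def space_pair_measure pair_code_def)
  qed
qed

text \<open>A measurable set is the preimage under \<open>h\<close> of its preimage under
  \<open>g\<close>, so the whole sigma-algebra is pulled back from the Cantor space, where the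
  cylinders generate.\<close>

lemma sets_bit_coded:
  assumes "bit_coded M h g"
  shows "sets M = sigma_sets (space M) (cylM M h ` {I. finite I})"
proof
  have h: "h \<in> M \<rightarrow>\<^sub>M bits" and g: "g \<in> bits \<rightarrow>\<^sub>M M" and inv: "\<And>x. x \<in> space M \<Longrightarrow> g (h x) = x"
    using assms by (auto simp: bit_coded_def)
  have cyl: "cylM M h I = h -` cyl I \<inter> space M" for I by (auto simp: cylM_def cyl_def)
  have gen: "h -` B \<inter> space M \<in> sigma_sets (space M) (cylM M h ` {I. finite I})" if "B \<in> sets bits" for B
  proof -
    have "h -` B \<inter> space M \<in> {h -` A \<inter> space M |A. A \<in> sigma_sets UNIV (cyl ` {I. finite I})}"
      using that sets_bits_cyl by auto
    also have "\<dots> = sigma_sets (space M) {h -` A \<inter> space M |A. A \<in> cyl ` {I. finite I}}"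
      by (rule sigma_sets_vimage_commute) auto
    also have "{h -` A \<inter> space M |A. A \<in> cyl ` {I. finite I}} = cylM M h ` {I. finite I}"
      by (auto simp: cyl)
    finally show ?thesis .
  qed
  show "sets M \<subseteq> sigma_sets (space M) (cylM M h ` {I. finite I})"
  proof
    fix A assume A: "A \<in> sets M"
    then have "A = h -` (g -` A) \<inter> space M" using inv sets.sets_into_space[OF A] by auto
    moreover have "g -` A \<in> sets bits" using measurable_sets[OF g A] by simp
    ultimately show "A \<in> sigma_sets (space M) (cylM M h ` {I. finite I})" using gen by metis
  qed
  show "sigma_sets (space M) (cylM M h ` {I. finite I}) \<subseteq> sets M"
    using h by (intro sets.sigma_sets_subset) auto
qed

text \<open>The decoding maps turn a limit on the Cantor space back into a measure on the original space;
  the fixed marginals guarantee that almost every limit code is the code of a point.\<close>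

lemma coupling_limit:
  assumes M: "bit_coded M h g" and N: "bit_coded N h' g'"
    and \<mu>: "prob_space \<mu>" "sets \<mu> = sets M" and \<nu>: "prob_space \<nu>" "sets \<nu> = sets N"
    and \<theta>: "\<And>n. \<theta> n \<in> couplings \<mu> \<nu>"
    and p: "\<And>I J. finite I \<Longrightarrow> finite J \<Longrightarrow> (\<lambda>n. measure (\<theta> n) (cylM M h I \<times> cylM N h' J)) \<longlonglongrightarrow> p I J"
  obtains \<theta>' where "\<theta>' \<in> couplings \<mu> \<nu>"
    "\<And>I J. finite I \<Longrightarrow> finite J \<Longrightarrow> measure \<theta>' (cylM M h I \<times> cylM N h' J) = p I J"
proof -
  note [measurable_cong] = \<mu>(2) \<nu>(2)
  have [measurable]: "h \<in> M \<rightarrow>\<^sub>M bits" "g \<in> bits \<rightarrow>\<^sub>M M" "h' \<in> N \<rightarrow>\<^sub>M bits" "g' \<in> bits \<rightarrow>\<^sub>M N"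
    and inv: "\<And>x. x \<in> space M \<Longrightarrow> g (h x) = x" "\<And>x. x \<in> space N \<Longrightarrow> g' (h' x) = x"
    using M N by (auto simp: bit_coded_def)
  have sp: "space \<mu> = space M" "space \<nu> = space N" using \<mu> \<nu> by (auto dest: sets_eq_imp_space_eq)
  have sets\<theta> [measurable_cong]: "sets (\<theta> n) = sets (M \<Otimes>\<^sub>M N)" for n
    using couplingsD(2)[OF \<theta>] sets_pair_measure_cong[OF \<mu>(2) \<nu>(2)] by simp
  have space\<theta>: "space (\<theta> n) = space M \<times> space N" for n
    using couplingsD(5)[OF \<theta>] sp by simp
  interpret \<theta>: prob_space "\<theta> n" for n using couplingsD(1)[OF \<theta>] .
  define k where "k = pair_code h h'"
  have k [measurable]: "k \<in> M \<Otimes>\<^sub>M N \<rightarrow>\<^sub>M bits"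
    unfolding k_def by (rule measurable_pair_code) measurable
  have k': "k \<in> \<theta> n \<rightarrow>\<^sub>M bits" for n by measurable
  define \<rho> where "\<rho> n = distr (\<theta> n) bits k" for n
  define ev od where "ev = (\<lambda>(b::nat\<Rightarrow>bool) i. b (2 * i))" and "od = (\<lambda>(b::nat\<Rightarrow>bool) i. b (2 * i + 1))"
  have ev [measurable]: "ev \<in> bits \<rightarrow>\<^sub>M bits" and od [measurable]: "od \<in> bits \<rightarrow>\<^sub>M bits"
    unfolding ev_def od_def by measurable
  have k_cyl: "k -` cyl I \<inter> (space M \<times> space N) = cylM M h (half_ev I) \<times> cylM N h' (half_od I)" for I
    unfolding k_def cylM_pair_code[symmetric] by (auto simp: cyl_def cylM_def space_pair_measure)
  have lim\<rho>: "(\<lambda>n. measure (\<rho> n) (cyl I)) \<longlonglongrightarrow> p (half_ev I) (half_od I)" if "finite I" for I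
    using p[OF finite_half(1)[OF that] finite_half(2)[OF that]] by (simp add: \<rho>_def measure_distr[OF k'] space\<theta> k_cyl)
  obtain \<rho>' where \<rho>': "prob_space \<rho>'" "sets \<rho>' = sets bits"
    and m\<rho>': "\<And>I. finite I \<Longrightarrow> measure \<rho>' (cyl I) = p (half_ev I) (half_od I)"
    by (rule bits_limit[where \<rho> = \<rho>, OF _ _ lim\<rho>]) (auto simp: \<rho>_def intro!: \<theta>.prob_space_distr k')
  interpret \<rho>': prob_space \<rho>' by fact
  note [measurable_cong] = \<rho>'(2)
  have space\<rho>': "space \<rho>' = UNIV" using sets_eq_imp_space_eq[OF \<rho>'(2)] by simp
  have ev': "ev \<in> \<rho>' \<rightarrow>\<^sub>M bits" and od': "od \<in> \<rho>' \<rightarrow>\<^sub>M bits" by measurable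
  have h\<mu>: "h \<in> \<mu> \<rightarrow>\<^sub>M bits" and h\<nu>: "h' \<in> \<nu> \<rightarrow>\<^sub>M bits" by measurable
  \<comment> \<open>Rectangles with one full side have a mass that does not depend on
    \<open>n\<close>, namely that of the fixed marginal; this pins down the marginals of the
    limit.\<close>
  have p1: "p I {} = measure \<mu> (cylM M h I)" if "finite I" for I
  proof -
    have "measure (\<theta> n) (cylM M h I \<times> cylM N h' {}) = measure \<mu> (cylM M h I)" for n
      using coupling_measure_fst[OF \<theta>, of "cylM M h I" n] by (simp add: cylM_def[of N] sp \<mu>)
    then show ?thesis using p[OF that, of "{}"] by (simp add: LIMSEQ_const_iff)
  qed
  have p2: "p {} I = measure \<nu> (cylM N h' I)" if "finite I" for I
  proof -
    have "measure (\<theta> n) (cylM M h {} \<times> cylM N h' I) = measure \<nu> (cylM N h' I)" for n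
      using coupling_measure_snd[OF \<theta>, of "cylM N h' I" n] by (simp add: cylM_def[of M] sp \<nu>)
    then show ?thesis using p[of "{}", OF _ that] by (simp add: LIMSEQ_const_iff)
  qed
  have ev_cyl: "ev -` cyl I = cyl ((*) 2 ` I)" and od_cyl: "od -` cyl I = cyl ((\<lambda>i. 2 * i + 1) ` I)" for I
    by (auto simp: ev_def od_def cyl_def)
  have dev: "distr \<rho>' bits ev = distr \<mu> bits h"
  proof (rule bits_measure_eqI)
    fix I :: "nat set" assume I: "finite I"
    have "measure (distr \<rho>' bits ev) (cyl I) = p I {}"
      using m\<rho>'[of "(*) 2 ` I"] half_Un[of I "{}"] I by (simp add: measure_distr[OF ev'] space\<rho>' ev_cyl)
    also have "\<dots> = measure (distr \<mu> bits h) (cyl I)"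
      by (subst p1[OF I], subst measure_distr[OF h\<mu> cyl_in_sets]) (auto simp: cylM_def cyl_def sp intro!: arg_cong[where f = "measure \<mu>"])
    finally show "measure (distr \<rho>' bits ev) (cyl I) = measure (distr \<mu> bits h) (cyl I)" .
  qed (auto intro!: \<rho>'.prob_space_distr prob_space.prob_space_distr[OF \<mu>(1)])
  have dod: "distr \<rho>' bits od = distr \<nu> bits h'"
  proof (rule bits_measure_eqI)
    fix I :: "nat set" assume I: "finite I"
    have "measure (distr \<rho>' bits od) (cyl I) = p {} I"
      using m\<rho>'[of "(\<lambda>i. 2 * i + 1) ` I"] half_Un[of "{}" I] I by (simp add: measure_distr[OF od'] space\<rho>' od_cyl)
    also have "\<dots> = measure (distr \<nu> bits h') (cyl I)"
      by (subst p2[OF I], subst measure_distr[OF h\<nu> cyl_in_sets]) (auto simp: cylM_def cyl_def sp intro!: arg_cong[where f = "measure \<nu>"])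
    finally show "measure (distr \<rho>' bits od) (cyl I) = measure (distr \<nu> bits h') (cyl I)" .
  qed (auto intro!: \<rho>'.prob_space_distr prob_space.prob_space_distr[OF \<nu>(1)])
  define dec where "dec = (\<lambda>b. (g (ev b), g' (od b)))"
  have dec: "dec \<in> \<rho>' \<rightarrow>\<^sub>M M \<Otimes>\<^sub>M N" unfolding dec_def by measurable
  define \<theta>' where "\<theta>' = distr \<rho>' (M \<Otimes>\<^sub>M N) dec"
  have sets\<theta>' [measurable_cong]: "sets \<theta>' = sets (M \<Otimes>\<^sub>M N)" by (simp add: \<theta>'_def)
  have "distr \<theta>' \<mu> fst = distr (distr \<rho>' bits ev) \<mu> g"
    unfolding \<theta>'_def by (subst distr_distr, measurable, subst distr_distr) (auto simp: dec_def o_def intro: dec)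
  also have "\<dots> = distr \<mu> \<mu> (\<lambda>x. x)"
    unfolding dev by (subst distr_distr, measurable) (rule distr_cong, simp_all add: sp inv)
  finally have d1: "distr \<theta>' \<mu> fst = \<mu>" by (simp add: distr_id2)
  have "distr \<theta>' \<nu> snd = distr (distr \<rho>' bits od) \<nu> g'"
    unfolding \<theta>'_def by (subst distr_distr, measurable, subst distr_distr) (auto simp: dec_def o_def intro: dec)
  also have "\<dots> = distr \<nu> \<nu> (\<lambda>x. x)"
    unfolding dod by (subst distr_distr, measurable) (rule distr_cong, simp_all add: sp inv)
  finally have d2: "distr \<theta>' \<nu> snd = \<nu>" by (simp add: distr_id2)
  \<comment> \<open>Being a code is expressed by \<open>h (g b) = b\<close>, bit by bit, which is a
    measurable condition. It holds almost surely for the law of \<open>h\<close> under \<mu>, and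
    that is the law of the even bits of the limit; likewise for \<nu> and the odd bits.\<close>
  have P1: "Measurable.pred bits (\<lambda>b. \<forall>i. h (g b) i = b i)" "Measurable.pred bits (\<lambda>b. \<forall>i. h' (g' b) i = b i)"
    by measurable
  have "AE b in distr \<rho>' bits ev. \<forall>i. h (g b) i = b i"
    unfolding dev by (subst AE_distr_iff[OF h\<mu>]) (use P1 in \<open>auto simp: pred_def sp inv\<close>)
  then have AE1: "AE b in \<rho>'. \<forall>i. h (g (ev b)) i = ev b i"
    by (subst (asm) AE_distr_iff[OF ev']) (use P1 in \<open>auto simp: pred_def\<close>)
  have "AE b in distr \<rho>' bits od. \<forall>i. h' (g' b) i = b i"
    unfolding dod by (subst AE_distr_iff[OF h\<nu>]) (use P1 in \<open>auto simp: pred_def sp inv\<close>)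
  then have AE2: "AE b in \<rho>'. \<forall>i. h' (g' (od b)) i = od b i"
    by (subst (asm) AE_distr_iff[OF od']) (use P1 in \<open>auto simp: pred_def\<close>)
  have gsp: "g b \<in> space M" "g' b \<in> space N" for b
    using measurable_space[of g bits M b] measurable_space[of g' bits N b] by auto
  show ?thesis
  proof
    show "\<theta>' \<in> couplings \<mu> \<nu>"
      unfolding couplings_def using d1 d2 sets_pair_measure_cong[OF \<mu>(2) \<nu>(2)]
      by (auto simp: \<theta>'_def intro!: \<rho>'.prob_space_distr dec)
    fix I J :: "nat set" assume IJ: "finite I" "finite J"
    have "measure \<theta>' (cylM M h I \<times> cylM N h' J) = measure \<rho>' (dec -` (cylM M h I \<times> cylM N h' J) \<inter> space \<rho>')"
      unfolding \<theta>'_def by (rule measure_distr[OF dec]) measurable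
    \<comment> \<open>Decoding and coding again may change a sequence that is not a code, so the two
      sets agree only up to a null set.\<close>
    also have "\<dots> = measure \<rho>' (cyl ((*) 2 ` I \<union> (\<lambda>i. 2 * i + 1) ` J))"
    proof (rule \<rho>'.finite_measure_eq_AE)
      show "AE b in \<rho>'. b \<in> dec -` (cylM M h I \<times> cylM N h' J) \<inter> space \<rho>' \<longleftrightarrow> b \<in> cyl ((*) 2 ` I \<union> (\<lambda>i. 2 * i + 1) ` J)"
        using AE1 AE2
        by eventually_elim (auto simp: dec_def cylM_def cyl_def gsp space\<rho>' ev_def od_def)
      show "dec -` (cylM M h I \<times> cylM N h' J) \<inter> space \<rho>' \<in> sets \<rho>'"
        by (rule measurable_sets[OF dec]) measurable
    qed (simp add: \<rho>'(2))
    also have "\<dots> = p I J"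
      by (subst m\<rho>') (simp_all only: half_Un IJ finite_Un finite_imageI simp_thms)
    finally show "measure \<theta>' (cylM M h I \<times> cylM N h' J) = p I J" .
  qed
qed

text \<open>The indices are thinned out digit by digit: \<open>N i\<close> keeps the indices whose first \<open>i\<close> digits
  agree with the smallest digits that recur infinitely often. All choices are measurable.\<close>

lemma measurable_common_digits:
  fixes D :: "nat \<Rightarrow> nat \<Rightarrow> 'w \<Rightarrow> nat"
  assumes D [measurable]: "\<And>n i. D n i \<in> M \<rightarrow>\<^sub>M count_space UNIV"
    and B: "\<And>n i w. w \<in> space M \<Longrightarrow> D n i w \<le> B i"
  obtains r :: "nat \<Rightarrow> 'w \<Rightarrow> nat" where "\<And>k. r k \<in> M \<rightarrow>\<^sub>M count_space UNIV"
    "\<And>k w. w \<in> space M \<Longrightarrow> k \<le> r k w"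
    "\<And>i w. w \<in> space M \<Longrightarrow> \<exists>v. \<forall>k>i. D (r k w) i w = v"
proof -
  define N where "N = rec_nat (\<lambda>w n. True)
    (\<lambda>i N w n. N w n \<and> D n i w = (LEAST v. \<exists>\<^sub>F m in sequentially. N w m \<and> D m i w = v))"
  define v where "v i w = (LEAST v. \<exists>\<^sub>F m in sequentially. N i w m \<and> D m i w = v)" for i w
  have N0: "N 0 w n" for w n by (simp add: N_def)
  have NS: "N (Suc i) w n \<longleftrightarrow> N i w n \<and> D n i w = v i w" for i w n by (simp add: N_def v_def)
  \<comment> \<open>Pigeonhole: infinitely many indices remain and the digit takes only values up to
    \<open>B i\<close>, so some value recurs infinitely often.\<close>
  have inf: "\<exists>\<^sub>F m in sequentially. N i w m" if "w \<in> space M" for i w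
  proof (induction i)
    case (Suc i)
    have "\<exists>\<^sub>F m in sequentially. \<exists>u\<in>{..B i}. N i w m \<and> D m i w = u"
      using Suc.IH by (rule frequently_elim1) (simp add: B[OF that])
    from frequently_bex_finite[OF finite_atMost this]
    have "\<exists>u. \<exists>\<^sub>F m in sequentially. N i w m \<and> D m i w = u" by (rule bexE) (rule exI)
    from LeastI_ex[OF this] show ?case unfolding NS v_def .
  qed (simp add: N0)
  have meas: "Measurable.pred M (\<lambda>w. N i w n)" for i n
  proof (induction i arbitrary: n)
    case (Suc i)
    have 1: "Measurable.pred M (\<lambda>w. D n i w = u)" for n u
      by (rule measurable_compose[OF D]) simp
    have 2: "Measurable.pred M (\<lambda>w. m \<le> n \<and> N i w n \<and> D n i w = u)" for m n u
      by (rule pred_intros_logic(3)[OF _ pred_intros_logic(3)[OF Suc 1]]) simp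
    have v: "v i \<in> M \<rightarrow>\<^sub>M count_space UNIV"
      unfolding v_def frequently_sequentially by (rule measurable_Least pred_intros_countable 2)+
    have "Measurable.pred M (\<lambda>w. \<exists>u. D n i w = u \<and> v i w = u)"
      by (rule pred_intros_countable(2), rule pred_intros_logic(3)[OF 1], rule measurable_compose[OF v]) simp
    moreover have "(\<lambda>w. \<exists>u. D n i w = u \<and> v i w = u) = (\<lambda>w. D n i w = v i w)" by auto
    ultimately have "Measurable.pred M (\<lambda>w. D n i w = v i w)" by (rule back_subst)
    then show ?case unfolding NS by (rule pred_intros_logic(3)[OF Suc])
  qed (simp add: N0)
  \<comment> \<open>Diagonal choice: the \<open>k\<close>-th index is taken from the
    \<open>k\<close>-th thinning, so digit \<open>i\<close> is frozen for all
    \<open>k > i\<close>.\<close>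
  define r where "r k w = (LEAST n. k \<le> n \<and> N k w n)" for k w
  have r: "k \<le> r k w \<and> N k w (r k w)" if "w \<in> space M" for k w
  proof -
    have "\<exists>n. k \<le> n \<and> N k w n"
      using inf[OF that, of k] by (auto simp: frequently_sequentially)
    from LeastI_ex[OF this] show ?thesis by (simp add: r_def)
  qed
  have mono: "N i w n \<Longrightarrow> j \<le> i \<Longrightarrow> N j w n" for i j w n
    by (induction i) (auto simp: NS le_Suc_eq)
  show ?thesis
  proof
    show "r k \<in> M \<rightarrow>\<^sub>M count_space UNIV" for k
      unfolding r_def by (rule measurable_Least, rule pred_intros_logic(3)[OF _ meas]) simp
    show "k \<le> r k w" if "w \<in> space M" for k w using r[OF that] by simp
    show "\<exists>v. \<forall>k>i. D (r k w) i w = v" if "w \<in> space M" for i w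
    proof (intro exI allI impI)
      fix k assume "i < k"
      then have "N (Suc i) w (r k w)" using r[OF that, of k] by (auto intro: mono)
      then show "D (r k w) i w = v i w" by (simp add: NS)
    qed
  qed
qed

text \<open>Constancy of the integer part of \<open>2 ^ m * p n i w\<close> confines the tail of the
  sequence to an interval of length \<open>(1/2) ^ m\<close>; this for all \<open>m\<close> gives
  Cauchy sequences for all \<open>i\<close> at once. The bound \<open>k \<le> r k w\<close> stands
  in for strict monotonicity, since it already sends the indices to infinity.\<close>

lemma measurable_convergent_subsequence:
  fixes p :: "nat \<Rightarrow> nat \<Rightarrow> 'w \<Rightarrow> real"
  assumes p [measurable]: "\<And>n i. p n i \<in> borel_measurable M"
    and p01: "\<And>n i w. w \<in> space M \<Longrightarrow> 0 \<le> p n i w \<and> p n i w \<le> 1"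
  obtains r :: "nat \<Rightarrow> 'w \<Rightarrow> nat" where "\<And>k. r k \<in> M \<rightarrow>\<^sub>M count_space UNIV"
    "\<And>k w. w \<in> space M \<Longrightarrow> k \<le> r k w"
    "\<And>i w. w \<in> space M \<Longrightarrow> convergent (\<lambda>k. p (r k w) i w)"
proof -
  define D where "D n j w = (case prod_decode j of (i, m) \<Rightarrow> nat \<lfloor>2 ^ m * p n i w\<rfloor>)" for n j w
  have Dm: "D n j \<in> M \<rightarrow>\<^sub>M count_space UNIV" for n j
    unfolding D_def by (cases "prod_decode j") simp
  have Db: "D n j w \<le> 2 ^ snd (prod_decode j)" if "w \<in> space M" for n j w
  proof -
    obtain i m where im: "prod_decode j = (i, m)" by (cases "prod_decode j")
    have "2 ^ m * p n i w \<le> 2 ^ m" using p01[OF that, of n i] by simp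
    then have "\<lfloor>2 ^ m * p n i w\<rfloor> \<le> 2 ^ m"
      unfolding floor_le_iff of_int_power of_int_numeral by linarith
    then have "nat \<lfloor>2 ^ m * p n i w\<rfloor> \<le> 2 ^ m" by (simp add: nat_le_iff)
    then show ?thesis by (simp add: D_def im)
  qed
  obtain r where r: "\<And>k. r k \<in> M \<rightarrow>\<^sub>M count_space UNIV" "\<And>k w. w \<in> space M \<Longrightarrow> k \<le> r k w"
    and D: "\<And>i w. w \<in> space M \<Longrightarrow> \<exists>v. \<forall>k>i. D (r k w) i w = v"
    by (rule measurable_common_digits[where D = D, OF Dm Db]) (assumption, rule that)
  have "Cauchy (\<lambda>k. p (r k w) i w)" if w: "w \<in> space M" for i w
  proof (rule metric_CauchyI)
    fix e :: real assume "e > 0"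
    then obtain m where m: "(1/2::real) ^ m < e" using real_arch_pow_inv[of e "1/2"] by auto
    let ?j = "prod_encode (i, m)"
    obtain v where v: "\<And>k. k > ?j \<Longrightarrow> D (r k w) ?j w = v" using D[OF w] by blast
    have b: "real v \<le> 2 ^ m * p (r k w) i w \<and> 2 ^ m * p (r k w) i w < real v + 1" if "k > ?j" for k
    proof -
      have "v = nat \<lfloor>2 ^ m * p (r k w) i w\<rfloor>" using v[OF that] by (simp add: D_def)
      moreover have "0 \<le> 2 ^ m * p (r k w) i w" using p01[OF w, of "r k w" i] by simp
      ultimately show ?thesis by linarith
    qed
    show "\<exists>K. \<forall>k\<ge>K. \<forall>l\<ge>K. dist (p (r k w) i w) (p (r l w) i w) < e"
    proof (intro exI allI impI)
      fix k l assume "Suc ?j \<le> k" "Suc ?j \<le> l"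
      then have "\<bar>2 ^ m * p (r k w) i w - 2 ^ m * p (r l w) i w\<bar> < 1" using b[of k] b[of l] by auto
      then have "2 ^ m * \<bar>p (r k w) i w - p (r l w) i w\<bar> < 1"
        by (simp add: right_diff_distrib[symmetric] abs_mult)
      then have "\<bar>p (r k w) i w - p (r l w) i w\<bar> < (1/2) ^ m" by (simp add: field_simps power_divide)
      then show "dist (p (r k w) i w) (p (r l w) i w) < e" using m by (simp add: dist_real_def)
    qed
  qed
  from that[OF r Cauchy_convergent[OF this]] show ?thesis .
qed

text \<open>Countable step functions of rectangles approximate the cost from below, so that Fatou's lemma
  applies to the sum.\<close>

lemma step_cost_liminf:
  fixes \<theta> :: "nat \<Rightarrow> 'a measure" and a :: "nat \<Rightarrow> real"
  assumes fin: "\<And>n. prob_space (\<theta> n)" "prob_space \<theta>'" and sets: "\<And>n. sets (\<theta> n) = sets \<theta>'"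
    and S: "\<And>i. S i \<in> sets \<theta>'" and conv: "\<And>i. (\<lambda>n. measure (\<theta> n) (S i)) \<longlonglongrightarrow> measure \<theta>' (S i)"
    and le: "\<And>x. x \<in> space \<theta>' \<Longrightarrow> (\<Sum>i. ennreal (a i) * indicator (S i) x) \<le> c x"
  shows "(\<integral>\<^sup>+x. (\<Sum>i. ennreal (a i) * indicator (S i) x) \<partial>\<theta>') \<le> liminf (\<lambda>n. \<integral>\<^sup>+x. c x \<partial>\<theta> n)"
proof -
  interpret \<theta>: prob_space "\<theta> n" for n by fact
  interpret \<theta>': prob_space \<theta>' by fact
  have S' [measurable]: "S i \<in> sets (\<theta> n)" for i n using S sets by auto
  note [measurable] = S
  have conv': "(\<lambda>n. emeasure (\<theta> n) (S i)) \<longlonglongrightarrow> emeasure \<theta>' (S i)" for i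
    unfolding \<theta>.emeasure_eq_measure \<theta>'.emeasure_eq_measure using conv by (intro tendsto_ennrealI)
  have eq: "(\<integral>\<^sup>+x. (\<Sum>i. ennreal (a i) * indicator (S i) x) \<partial>N) = (\<Sum>i. ennreal (a i) * emeasure N (S i))"
    if S: "\<And>i. S i \<in> sets N" for N
  proof -
    have "(\<integral>\<^sup>+x. (\<Sum>i. ennreal (a i) * indicator (S i) x) \<partial>N) = (\<Sum>i. \<integral>\<^sup>+x. ennreal (a i) * indicator (S i) x \<partial>N)"
      by (intro nn_integral_suminf borel_measurable_times_ennreal borel_measurable_const borel_measurable_indicator S)
    then show ?thesis by (simp only: nn_integral_cmult_indicator[OF S])
  qed
  have "(\<integral>\<^sup>+x. (\<Sum>i. ennreal (a i) * indicator (S i) x) \<partial>\<theta>') = (\<Sum>i. ennreal (a i) * emeasure \<theta>' (S i))"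
    by (rule eq[OF S])
  also have "\<dots> \<le> (\<Sum>i. liminf (\<lambda>n. ennreal (a i) * emeasure (\<theta> n) (S i)))"
  proof (rule suminf_le)
    fix i
    have "(\<lambda>n. ennreal (a i) * emeasure (\<theta> n) (S i)) \<longlonglongrightarrow> ennreal (a i) * emeasure \<theta>' (S i)"
      by (intro ennreal_tendsto_cmult conv') simp
    then show "ennreal (a i) * emeasure \<theta>' (S i) \<le> liminf (\<lambda>n. ennreal (a i) * emeasure (\<theta> n) (S i))"
      by (simp add: lim_imp_Liminf)
  qed auto
  also have "\<dots> \<le> liminf (\<lambda>n. \<Sum>i. ennreal (a i) * emeasure (\<theta> n) (S i))"
    using nn_integral_liminf[of "\<lambda>n i. ennreal (a i) * emeasure (\<theta> n) (S i)" "count_space UNIV"]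
    by (simp add: nn_integral_count_space_nat)
  also have "\<dots> \<le> liminf (\<lambda>n. \<integral>\<^sup>+x. c x \<partial>\<theta> n)"
    unfolding eq[OF S', symmetric] using le sets_eq_imp_space_eq[OF sets]
    by (intro Liminf_mono always_eventually allI nn_integral_mono) auto
  finally show ?thesis .
qed


section \<open>Countable partitions into cells of small diameter\<close>

text \<open>Separability in measurable form: at every scale countably many measurable cells cover
  the space. Stated for a bare pseudometric on a measurable space, it serves for \<open>dist\<close>
  and for \<open>w2\<close>, where the sigma-algebra is at first only the one generated by
  evaluation.\<close>

locale small_cells =
  fixes M :: "'a measure" and d :: "'a \<Rightarrow> 'a \<Rightarrow> real" and C :: "nat \<Rightarrow> nat \<Rightarrow> 'a set"
  assumes C_sets [measurable]: "C m k \<in> sets M"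
    and C_disj: "disjoint_family (C m)"
    and C_cover: "(\<Union>k. C m k) = space M"
    and C_small: "x \<in> C m k \<Longrightarrow> y \<in> C m k \<Longrightarrow> d x y \<le> (1/2) ^ m"
    and d_nonneg: "x \<in> space M \<Longrightarrow> y \<in> space M \<Longrightarrow> 0 \<le> d x y"
    and d_sym: "x \<in> space M \<Longrightarrow> y \<in> space M \<Longrightarrow> d x y = d y x"
    and d_tri: "x \<in> space M \<Longrightarrow> y \<in> space M \<Longrightarrow> z \<in> space M \<Longrightarrow> d x z \<le> d x y + d y z"
begin

definition "idx m x = (LEAST k. x \<in> C m k)"
definition "rep m k = (SOME x. x \<in> C m k)"
text \<open>Moving from the representatives to arbitrary points of the two cells changes the
  distance by at most \<open>2 * (1/2) ^ m\<close>. The value is thus a lower bound on the whole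
  rectangle and misses the distance by at most twice that amount; the truncation at 0 keeps its
  square below the squared distance.\<close>

definition "lower m k l = max 0 (d (rep m k) (rep m l) - 2 * (1/2) ^ m)"

lemma idx: "x \<in> space M \<Longrightarrow> x \<in> C m (idx m x)"
  unfolding idx_def using C_cover[of m] by (metis LeastI UN_E)

lemma idx_unique: "x \<in> C m k \<Longrightarrow> idx m x = k"
  using idx[of x m] C_disj[of m] sets.sets_into_space[OF C_sets[of m k]]
  by (auto simp: disjoint_family_on_def)

lemma rep: "x \<in> C m k \<Longrightarrow> rep m k \<in> C m k"
  unfolding rep_def by (rule someI)

lemma C_space: "x \<in> C m k \<Longrightarrow> x \<in> space M"
  using C_cover[of m] by auto

lemma lower_bounds:
  assumes "x \<in> C m k" "y \<in> C m l"
  shows "lower m k l \<le> d x y" "d x y - 4 * (1/2) ^ m \<le> lower m k l" "0 \<le> lower m k l"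
proof -
  let ?r = "rep m k" and ?s = "rep m l"
  have sp: "x \<in> space M" "y \<in> space M" "?r \<in> space M" "?s \<in> space M"
    using assms rep C_space by blast+
  have "d x ?r \<le> (1/2) ^ m" "d y ?s \<le> (1/2) ^ m" "d ?r x \<le> (1/2) ^ m" "d ?s y \<le> (1/2) ^ m"
    using assms rep C_small by blast+
  moreover have "d ?r ?s \<le> d ?r x + d x ?s" "d x ?s \<le> d x y + d y ?s"
    "d x y \<le> d x ?r + d ?r y" "d ?r y \<le> d ?r ?s + d ?s y"
    using d_tri sp by blast+
  moreover have "0 \<le> d x y" using d_nonneg sp by blast
  ultimately show "lower m k l \<le> d x y" "d x y - 4 * (1/2) ^ m \<le> lower m k l" "0 \<le> lower m k l"
    by (auto simp: lower_def)
qed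

lemma lower_tendsto:
  assumes "x \<in> space M" "y \<in> space M"
  shows "(\<lambda>m. lower m (idx m x) (idx m y)) \<longlonglongrightarrow> d x y"
proof (rule tendsto_sandwich)
  have "(\<lambda>m. d x y - 4 * (1/2) ^ m) \<longlonglongrightarrow> d x y - 4 * 0"
    by (intro tendsto_intros LIMSEQ_power_zero) auto
  then show "(\<lambda>m. d x y - 4 * (1/2) ^ m) \<longlonglongrightarrow> d x y" by simp
qed (use lower_bounds[OF idx[OF assms(1)] idx[OF assms(2)]] in auto)

lemma measurable_idx [measurable]: "idx m \<in> M \<rightarrow>\<^sub>M count_space UNIV"
  unfolding idx_def by (rule measurable_Least, rule pred_sets2[OF C_sets measurable_ident_sets[OF refl]])

lemma measurable_lower:
  "(\<lambda>z. lower m (idx m (fst z)) (idx m (snd z))) \<in> borel_measurable (M \<Otimes>\<^sub>M M)"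
proof (rule measurable_compose_countable[where f = "\<lambda>k z. lower m k (idx m (snd z))" and g = "\<lambda>z. idx m (fst z)"])
  show "(\<lambda>z. lower m k (idx m (snd z))) \<in> borel_measurable (M \<Otimes>\<^sub>M M)" for k
    by (rule measurable_compose_countable[where f = "\<lambda>l z. lower m k l" and g = "\<lambda>z. idx m (snd z)"]) measurable
qed measurable

text \<open>The distance is a pointwise limit of functions of the two cell indices. Applied to
  \<open>w2\<close>, this is the source of the joint measurability of the Wasserstein
  distance.\<close>

lemma borel_measurable_d: "(\<lambda>(x, y). d x y) \<in> borel_measurable (M \<Otimes>\<^sub>M M)"
  by (rule borel_measurable_LIMSEQ_metric[OF measurable_lower])
     (auto simp: space_pair_measure intro: lower_tendsto)

text \<open>The rectangles are disjoint, so a single term survives; the form of a series is the one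
  that passes to limits of measures.\<close>

lemma step_sum:
  assumes "x \<in> space M" "y \<in> space M"
  shows "(\<Sum>i. ennreal ((case prod_decode i of (k, l) \<Rightarrow> lower m k l)\<^sup>2)
      * indicator (case prod_decode i of (k, l) \<Rightarrow> C m k \<times> C m l) (x, y))
    = ennreal ((lower m (idx m x) (idx m y))\<^sup>2)" (is "suminf ?f = _")
proof -
  let ?i = "prod_encode (idx m x, idx m y)"
  have "suminf ?f = sum ?f {?i}"
  proof (rule suminf_finite)
    fix n assume n: "n \<notin> {?i}"
    obtain k l where kl: "prod_decode n = (k, l)" by (cases "prod_decode n")
    then have "n = prod_encode (k, l)" by (metis prod_decode_inverse)
    with n have "(k, l) \<noteq> (idx m x, idx m y)" by auto
    then have "(x, y) \<notin> C m k \<times> C m l" using idx_unique by blast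
    then show "?f n = 0" by (simp add: kl)
  qed simp
  also have "\<dots> = ennreal ((lower m (idx m x) (idx m y))\<^sup>2)"
    using assms idx by simp
  finally show ?thesis .
qed

text \<open>Lower semicontinuity of the cost under convergence on rectangles of cells. At a fixed
  scale the step cost is controlled by \<open>step_cost_liminf\<close>; a second application of
  Fatou's lemma, now along the scale \<open>m\<close> under the limit measure, recovers the full
  cost.\<close>

lemma quad_cost_le_liminf:
  assumes prob: "\<And>n. prob_space (\<theta> n)" "prob_space \<theta>'"
    and sets: "\<And>n. sets (\<theta> n) = sets (M \<Otimes>\<^sub>M M)" "sets \<theta>' = sets (M \<Otimes>\<^sub>M M)"
    and conv: "\<And>m k l. (\<lambda>n. measure (\<theta> n) (C m k \<times> C m l)) \<longlonglongrightarrow> measure \<theta>' (C m k \<times> C m l)"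
  shows "quad_cost d \<theta>' \<le> liminf (\<lambda>n. quad_cost d (\<theta> n))"
proof -
  note [measurable_cong] = sets(2)
  have sp: "space \<theta>' = space M \<times> space M"
    using sets_eq_imp_space_eq[OF sets(2)] by (simp add: space_pair_measure)
  let ?l = "\<lambda>m z. ennreal ((lower m (idx m (fst z)) (idx m (snd z)))\<^sup>2)"
  have step: "(\<integral>\<^sup>+z. ?l m z \<partial>\<theta>') \<le> liminf (\<lambda>n. quad_cost d (\<theta> n))" for m
  proof -
    let ?f = "\<lambda>z i. ennreal ((case prod_decode i of (k, l) \<Rightarrow> lower m k l)\<^sup>2)
      * indicator (case prod_decode i of (k, l) \<Rightarrow> C m k \<times> C m l) z"
    have "(\<integral>\<^sup>+z. ?l m z \<partial>\<theta>') = (\<integral>\<^sup>+z. (\<Sum>i. ?f z i) \<partial>\<theta>')"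
      by (intro nn_integral_cong) (auto simp: sp step_sum)
    also have "\<dots> \<le> liminf (\<lambda>n. \<integral>\<^sup>+z. (case z of (x, y) \<Rightarrow> ennreal ((d x y)\<^sup>2)) \<partial>\<theta> n)"
    proof (rule step_cost_liminf[OF prob])
      show "(\<Sum>i. ?f z i) \<le> (case z of (x, y) \<Rightarrow> ennreal ((d x y)\<^sup>2))" if "z \<in> space \<theta>'" for z
        using that lower_bounds[OF idx idx]
        by (auto simp: sp step_sum intro!: ennreal_leI power_mono)
    qed (use sets conv in \<open>auto split: prod.split\<close>)
    finally show ?thesis by (simp add: quad_cost_def)
  qed
  have "quad_cost d \<theta>' = (\<integral>\<^sup>+z. liminf (\<lambda>m. ?l m z) \<partial>\<theta>')"
    unfolding quad_cost_def
  proof (intro nn_integral_cong)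
    fix z assume "z \<in> space \<theta>'"
    then have "(\<lambda>m. ?l m z) \<longlonglongrightarrow> ennreal ((d (fst z) (snd z))\<^sup>2)"
      by (intro tendsto_ennrealI tendsto_power lower_tendsto) (auto simp: sp)
    from lim_imp_Liminf[OF _ this]
    show "(case z of (x, y) \<Rightarrow> ennreal ((d x y)\<^sup>2)) = liminf (\<lambda>m. ?l m z)"
      by (simp add: split_beta)
  qed
  also have "\<dots> \<le> liminf (\<lambda>m. \<integral>\<^sup>+z. ?l m z \<partial>\<theta>')"
    by (rule nn_integral_liminf) (use measurable_lower in measurable)
  also have "\<dots> \<le> liminf (\<lambda>m::nat. liminf (\<lambda>n. quad_cost d (\<theta> n)))"
    using step by (intro Liminf_mono always_eventually allI)
  also have "\<dots> = liminf (\<lambda>n. quad_cost d (\<theta> n))" by (simp add: Liminf_const)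
  finally show ?thesis .
qed

end

abbreviation opt_cost :: "('a \<Rightarrow> 'a \<Rightarrow> real) \<Rightarrow> 'a measure \<Rightarrow> 'a measure \<Rightarrow> ennreal" where
  "opt_cost d \<mu> \<nu> \<equiv> INF \<theta>\<in>couplings \<mu> \<nu>. quad_cost d \<theta>"

lemma pair_measure_couplings:
  assumes "prob_space \<mu>" "prob_space \<nu>"
  shows "\<mu> \<Otimes>\<^sub>M \<nu> \<in> couplings \<mu> \<nu>"
proof -
  interpret \<mu>: prob_space \<mu> by fact
  interpret \<nu>: prob_space \<nu> by fact
  interpret P: pair_prob_space \<mu> \<nu> ..
  have "distr (\<mu> \<Otimes>\<^sub>M \<nu>) \<nu> snd = \<nu>"
  proof (rule measure_eqI)
    fix A assume "A \<in> sets (distr (\<mu> \<Otimes>\<^sub>M \<nu>) \<nu> snd)"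
    then have A: "A \<in> sets \<nu>" by simp
    have "snd -` A \<inter> space (\<mu> \<Otimes>\<^sub>M \<nu>) = space \<mu> \<times> A"
      using sets.sets_into_space[OF A] by (auto simp: space_pair_measure)
    then have "emeasure (distr (\<mu> \<Otimes>\<^sub>M \<nu>) \<nu> snd) A = emeasure \<mu> (space \<mu>) * emeasure \<nu> A"
      using A by (simp add: emeasure_distr \<nu>.emeasure_pair_measure_Times)
    then show "emeasure (distr (\<mu> \<Otimes>\<^sub>M \<nu>) \<nu> snd) A = emeasure \<nu> A" by (simp add: \<mu>.emeasure_space_1)
  qed simp
  then show ?thesis
    using \<nu>.distr_pair_fst P.prob_space_axioms by (simp add: couplings_def)
qed

text \<open>Sequences that decode outside \<open>A\<close> are sent to the fixed point
  \<open>a\<close>, so that decoding stays total. The case of interest is \<open>prob2\<close> as a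
  subset of all probability measures.\<close>

lemma bit_coded_restrict:
  assumes "bit_coded M h g" and A: "A \<in> sets M" and a: "a \<in> A"
  shows "bit_coded (restrict_space M A) h (\<lambda>b. if g b \<in> A then g b else a)"
  unfolding bit_coded_def
proof (intro conjI ballI)
  have [measurable]: "h \<in> M \<rightarrow>\<^sub>M bits" "g \<in> bits \<rightarrow>\<^sub>M M" and inv: "\<And>x. x \<in> space M \<Longrightarrow> g (h x) = x"
    using assms by (auto simp: bit_coded_def)
  have aM: "a \<in> space M" using A a sets.sets_into_space by auto
  have P: "Measurable.pred bits (\<lambda>b. g b \<in> A)" using A by (rule pred_sets2) measurable
  show "h \<in> restrict_space M A \<rightarrow>\<^sub>M bits" by (intro measurable_restrict_space1) measurable
  show "(\<lambda>b. if g b \<in> A then g b else a) \<in> bits \<rightarrow>\<^sub>M restrict_space M A"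
    using a aM P by (intro measurable_restrict_space2 measurable_If) (auto simp: pred_def)
  show "(if g (h x) \<in> A then g (h x) else a) = x" if "x \<in> space (restrict_space M A)" for x
    using that A inv sets.sets_into_space[OF A] by (auto simp: space_restrict_space)
qed

text \<open>A probability measure is coded by its values on the cylinders; by \<open>bits_limit\<close> the sequences
  that arise in this way form a closed set.\<close>

lemma bit_coded_prob_algebra:
  assumes M: "bit_coded M h g"
  obtains h' g' where "bit_coded (prob_algebra M) h' g'"
proof -
  have [measurable]: "h \<in> M \<rightarrow>\<^sub>M bits" "g \<in> bits \<rightarrow>\<^sub>M M" and inv: "\<And>x. x \<in> space M \<Longrightarrow> g (h x) = x"
    using M by (auto simp: bit_coded_def)
  obtain hr gr where R: "bit_coded (borel :: (nat \<Rightarrow> real) measure) hr gr"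
    by (rule bit_coded_polish)
  define enc where "enc \<mu> i = measure \<mu> (cylM M h (set_decode i))" for \<mu> i
  have enc: "enc \<in> prob_algebra M \<rightarrow>\<^sub>M borel"
    unfolding enc_def by (intro measurable_coordinatewise_then_product measurable_measure_prob_algebra) measurable
  define is_law where "is_law p \<rho> \<longleftrightarrow> prob_space \<rho> \<and> sets \<rho> = sets bits \<and> (\<forall>i. p i = measure \<rho> (cyl (set_decode i)))"
    for p :: "nat \<Rightarrow> real" and \<rho>
  define good where "good = {p. \<exists>\<rho>. is_law p \<rho>}"
  have "closed good"
  proof (subst closed_sequential_limits, intro allI impI, elim conjE)
    fix x and l :: "nat \<Rightarrow> real"
    assume x: "\<forall>n. x n \<in> good" and lim: "x \<longlonglongrightarrow> l"
    have "(\<lambda>n. x n i) \<longlonglongrightarrow> l i" for i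
      using continuous_on_tendsto_compose[OF continuous_on_product_coordinates lim] by simp
    moreover obtain \<rho> where \<rho>: "\<And>n. is_law (x n) (\<rho> n)"
      using x unfolding good_def by (simp, metis)
    moreover have "measure (\<rho> n) (cyl I) = x n (set_encode I)" if "finite I" for n I
      using \<rho>[of n] that by (simp add: is_law_def)
    ultimately have "(\<lambda>n. measure (\<rho> n) (cyl I)) \<longlonglongrightarrow> l (set_encode I)" if "finite I" for I
      using that by simp
    then obtain \<rho>' where "prob_space \<rho>'" "sets \<rho>' = sets bits" "\<And>I. finite I \<Longrightarrow> measure \<rho>' (cyl I) = l (set_encode I)"
      using \<rho> by (rule_tac bits_limit[where \<rho> = \<rho> and p = "\<lambda>I. l (set_encode I)"]) (auto simp: is_law_def)
    then have "is_law l \<rho>'" by (simp add: is_law_def)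
    then show "l \<in> good" by (auto simp: good_def)
  qed
  then have good: "good \<in> sets borel" by simp
  define \<delta> where "\<delta> = return bits (\<lambda>_. False)"
  \<comment> \<open>A law is determined by its values on cylinders, so the choice is unique;
    sequences that belong to no law get the point mass \<delta>.\<close>
  define G where "G p = (if p \<in> good then SOME \<rho>. is_law p \<rho> else \<delta>)" for p
  have law: "is_law p (G p)" if "p \<in> good" for p
    using that by (auto simp: G_def good_def intro: someI)
  have ps: "prob_space (G p)" "sets (G p) = sets bits" for p
  proof -
    have "prob_space \<delta>" "sets \<delta> = sets bits" by (auto simp: \<delta>_def intro!: prob_space_return)
    then show "prob_space (G p)" "sets (G p) = sets bits"
      using law[of p] by (cases "p \<in> good"; simp add: is_law_def G_def)+
  qed
  \<comment> \<open>Measurability is tested on cylinders, where the mass of the chosen law is a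
    coordinate of the sequence.\<close>
  have G: "G \<in> borel \<rightarrow>\<^sub>M prob_algebra bits"
  proof (rule measurable_prob_algebra_generated[OF sets_bits_cyl Int_stable_cyl])
    fix A assume "A \<in> cyl ` {I. finite I}"
    then obtain I where I: "finite I" "A = cyl I" by auto
    have "emeasure (G p) A = (if p \<in> good then ennreal (p (set_encode I)) else emeasure \<delta> A)" for p
    proof (cases "p \<in> good")
      case True
      interpret prob_space "G p" by (rule ps)
      show ?thesis using law[OF True] I True by (simp add: emeasure_eq_measure is_law_def)
    qed (simp add: G_def)
    moreover have "(\<lambda>p. if p \<in> good then ennreal (p (set_encode I)) else emeasure \<delta> A) \<in> borel_measurable borel"
      using good by (intro measurable_If measurable_compose[OF _ measurable_ennreal] borel_measurable_continuous_onI continuous_on_product_coordinates) auto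
    ultimately show "(\<lambda>p. emeasure (G p) A) \<in> borel_measurable borel" by (simp only:)
  qed (use ps in auto)
  define dec where "dec p = distr (G p) M g" for p
  have dec: "dec \<in> borel \<rightarrow>\<^sub>M prob_algebra M"
    unfolding dec_def by (rule measurable_compose[OF G measurable_distr_prob_space]) measurable
  have inverse: "dec (enc \<mu>) = \<mu>" if "\<mu> \<in> space (prob_algebra M)" for \<mu>
  proof -
    have \<mu>: "prob_space \<mu>" and s\<mu> [measurable_cong]: "sets \<mu> = sets M"
      using that by (auto simp: space_prob_algebra)
    have sp: "space \<mu> = space M" using s\<mu> by (rule sets_eq_imp_space_eq)
    have h\<mu>: "h \<in> \<mu> \<rightarrow>\<^sub>M bits" and g\<mu>: "g \<in> bits \<rightarrow>\<^sub>M M" by measurable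
    have L: "is_law (enc \<mu>) (distr \<mu> bits h)"
    proof -
      have "enc \<mu> i = measure (distr \<mu> bits h) (cyl (set_decode i))" for i
        by (subst measure_distr[OF h\<mu> cyl_in_sets])
           (auto simp: enc_def cylM_def cyl_def sp intro!: arg_cong[where f = "measure \<mu>"])
      then show ?thesis using prob_space.prob_space_distr[OF \<mu> h\<mu>] by (simp add: is_law_def)
    qed
    then have "enc \<mu> \<in> good" by (auto simp: good_def)
    then have L': "is_law (enc \<mu>) (G (enc \<mu>))" by (rule law)
    have "G (enc \<mu>) = distr \<mu> bits h"
    proof (rule bits_measure_eqI)
      fix I :: "nat set" assume "finite I"
      then show "measure (G (enc \<mu>)) (cyl I) = measure (distr \<mu> bits h) (cyl I)"
        using L L' unfolding is_law_def by (metis set_encode_inverse)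
    qed (use L L' in \<open>auto simp: is_law_def\<close>)
    then have "dec (enc \<mu>) = distr (distr \<mu> bits h) M g" by (simp add: dec_def)
    also have "\<dots> = distr \<mu> M (g \<circ> h)" by (rule distr_distr[OF g\<mu> h\<mu>])
    also have "\<dots> = distr \<mu> \<mu> (\<lambda>x. x)" by (rule distr_cong) (simp_all add: sp inv s\<mu>)
    finally show ?thesis by (simp add: distr_id2)
  qed
  have "bit_coded (prob_algebra M) (\<lambda>\<mu>. hr (enc \<mu>)) (\<lambda>b. dec (gr b))"
  proof -
    have "hr \<in> borel \<rightarrow>\<^sub>M bits" "gr \<in> bits \<rightarrow>\<^sub>M borel" "\<And>p. gr (hr p) = p"
      using R by (auto simp: bit_coded_def)
    then show ?thesis
      using inverse by (auto simp: bit_coded_def intro!: measurable_compose[OF enc] measurable_compose[OF _ dec])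
  qed
  then show ?thesis by (rule that)
qed

section \<open>Limits of couplings that depend on a parameter\<close>

lemma half_decomp: "(*) 2 ` half_ev I \<union> (\<lambda>i. 2 * i + 1) ` half_od I = I"
proof (intro equalityI subsetI)
  show "x \<in> (*) 2 ` half_ev I \<union> (\<lambda>i. 2 * i + 1) ` half_od I" if "x \<in> I" for x
    using that by (cases "even x") (auto simp: half_ev_def half_od_def elim!: evenE oddE)
qed (auto simp: half_ev_def half_od_def)

text \<open>Each cell is a one-bit cylinder of the code, so convergence on rectangles of cylinders
  includes the rectangles of cells, on which the cost is controlled.\<close>

locale coded_cells = small_cells +
  fixes h g and b :: "nat \<Rightarrow> nat \<Rightarrow> nat"
  assumes code: "bit_coded M h g" and C_cylM: "C m k = cylM M h {b m k}"

lemma (in small_cells) ex_coded_cells: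
  assumes "bit_coded M h0 g0"
  obtains h g b where "coded_cells M d C h g b"
proof -
  let ?A = "\<lambda>i. case prod_decode i of (m, k) \<Rightarrow> C m k"
  let ?h = "\<lambda>x i. if even i then h0 x (i div 2) else x \<in> ?A (i div 2)"
  have "?A i \<in> sets M" for i by (auto split: prod.split)
  from bit_coded_append[OF assms this]
  have c: "bit_coded M ?h (\<lambda>b. g0 (\<lambda>i. b (2 * i)))" .
  have "C m k = cylM M ?h {2 * prod_encode (m, k) + 1}" for m k
    using sets.sets_into_space[OF C_sets] by (auto simp: cylM_def)
  then have "coded_cells M d C ?h (\<lambda>b. g0 (\<lambda>i. b (2 * i))) (\<lambda>m k. 2 * prod_encode (m, k) + 1)"
    using c by unfold_locales
  then show ?thesis by (rule that)
qed

context coded_cells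
begin

text \<open>The subsequence is chosen measurably in \<open>w\<close>, the limit coupling by plain
  choice for each \<open>w\<close>. The latter is measurable all the same, because its mass on every
  cylinder is forced to be the limit \<open>l\<close>, and the cylinders generate.\<close>

lemma measurable_coupling_limit:
  fixes W :: "'w measure" and \<gamma> :: "nat \<Rightarrow> 'w \<Rightarrow> ('a \<times> 'a) measure"
  assumes \<mu>: "\<And>w. w \<in> space W \<Longrightarrow> \<mu> w \<in> space (prob_algebra M)"
    and \<nu>: "\<And>w. w \<in> space W \<Longrightarrow> \<nu> w \<in> space (prob_algebra M)"
    and \<gamma>: "\<And>n w. w \<in> space W \<Longrightarrow> \<gamma> n w \<in> couplings (\<mu> w) (\<nu> w)"
    and meas: "\<And>n A. A \<in> sets (M \<Otimes>\<^sub>M M) \<Longrightarrow> (\<lambda>w. measure (\<gamma> n w) A) \<in> borel_measurable W"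
    and cost: "\<And>w. w \<in> space W \<Longrightarrow> (\<lambda>n. quad_cost d (\<gamma> n w)) \<longlonglongrightarrow> c w"
  obtains \<gamma>' where "\<gamma>' \<in> W \<rightarrow>\<^sub>M prob_algebra (M \<Otimes>\<^sub>M M)"
    "\<And>w. w \<in> space W \<Longrightarrow> \<gamma>' w \<in> couplings (\<mu> w) (\<nu> w)"
    "\<And>w. w \<in> space W \<Longrightarrow> quad_cost d (\<gamma>' w) \<le> c w"
proof -
  let ?h2 = "pair_code h h"
  let ?cyl = "\<lambda>I. cylM (M \<Otimes>\<^sub>M M) ?h2 I"
  have h: "h \<in> M \<rightarrow>\<^sub>M bits" using code by (simp add: bit_coded_def)
  note h2 = measurable_pair_code[OF h h]
  have sets\<gamma>: "sets \<theta> = sets (M \<Otimes>\<^sub>M M)" if "w \<in> space W" "\<theta> \<in> couplings (\<mu> w) (\<nu> w)" for w \<theta>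
    using couplingsD(2)[OF that(2)] \<mu>[OF that(1)] \<nu>[OF that(1)]
      sets_pair_measure_cong[of "\<mu> w" M "\<nu> w" M] by (simp add: space_prob_algebra)
  have cyl2: "?cyl ((*) 2 ` I \<union> (\<lambda>i. 2 * i + 1) ` J) = cylM M h I \<times> cylM M h J" for I J
    unfolding cylM_pair_code half_Un ..
  define p where "p n i w = measure (\<gamma> n w) (?cyl (set_decode i))" for n i w
  have p: "p n i \<in> borel_measurable W" for n i
    unfolding p_def by (intro meas cylM_sets h2)
  have p01: "0 \<le> p n i w \<and> p n i w \<le> 1" if "w \<in> space W" for n i w
    using prob_space.prob_le_1[OF couplingsD(1)[OF \<gamma>[OF that]]] by (simp add: p_def)
  obtain r where r: "\<And>k. r k \<in> W \<rightarrow>\<^sub>M count_space UNIV" "\<And>k w. w \<in> space W \<Longrightarrow> k \<le> r k w"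
    and conv: "\<And>i w. w \<in> space W \<Longrightarrow> convergent (\<lambda>k. p (r k w) i w)"
    by (rule measurable_convergent_subsequence[where p = p and M = W, OF p p01]) (assumption, rule that)
  define l where "l i w = lim (\<lambda>k. p (r k w) i w)" for i w
  have l_lim: "(\<lambda>k. p (r k w) i w) \<longlonglongrightarrow> l i w" if "w \<in> space W" for i w
    unfolding l_def using conv[OF that] by (simp only: convergent_LIMSEQ_iff)
  have l_meas: "l i \<in> borel_measurable W" for i
  proof (rule borel_measurable_LIMSEQ_metric[where f = "\<lambda>k w. p (r k w) i w"])
    show "(\<lambda>w. p (r k w) i w) \<in> borel_measurable W" for k
      by (rule measurable_compose_countable[where f = "\<lambda>n w. p n i w" and g = "r k", OF p r(1)])
  qed (rule l_lim)
  have "\<exists>\<theta>. \<theta> \<in> couplings (\<mu> w) (\<nu> w) \<and> quad_cost d \<theta> \<le> c w \<and>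
      (\<forall>I. finite I \<longrightarrow> measure \<theta> (?cyl I) = l (set_encode I) w)" if w: "w \<in> space W" for w
  proof -
    let ?e = "\<lambda>I J. set_encode ((*) 2 ` I \<union> (\<lambda>i. 2 * i + 1) ` J)"
    have dec: "set_decode (?e I J) = (*) 2 ` I \<union> (\<lambda>i. 2 * i + 1) ` J" if "finite I" "finite J" for I J
      using that by simp
    have lim: "(\<lambda>k. measure (\<gamma> (r k w) w) (cylM M h I \<times> cylM M h J)) \<longlonglongrightarrow> l (?e I J) w"
      if "finite I" "finite J" for I J
      using l_lim[OF w, of "?e I J"] unfolding p_def dec[OF that] cyl2 .
    obtain \<theta> where \<theta>: "\<theta> \<in> couplings (\<mu> w) (\<nu> w)"
      and m\<theta>: "\<And>I J. finite I \<Longrightarrow> finite J \<Longrightarrow> measure \<theta> (cylM M h I \<times> cylM M h J) = l (?e I J) w"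
    proof (rule coupling_limit[OF code code, where \<mu> = "\<mu> w" and \<nu> = "\<nu> w" and \<theta> = "\<lambda>k. \<gamma> (r k w) w" and p = "\<lambda>I J. l (?e I J) w"])
      show "prob_space (\<mu> w)" "sets (\<mu> w) = sets M" "prob_space (\<nu> w)" "sets (\<nu> w) = sets M"
        using \<mu>[OF w] \<nu>[OF w] by (auto simp: space_prob_algebra)
    qed (use \<gamma>[OF w] lim that in auto)
    have "measure \<theta> (?cyl I) = l (set_encode I) w" if I: "finite I" for I
    proof -
      show ?thesis
        unfolding cylM_pair_code using m\<theta>[OF finite_half(1)[OF I] finite_half(2)[OF I]] unfolding half_decomp .
    qed
    moreover have "quad_cost d \<theta> \<le> c w"
    proof -
      have "quad_cost d \<theta> \<le> liminf (\<lambda>k. quad_cost d (\<gamma> (r k w) w))"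
      proof (rule quad_cost_le_liminf)
        show "(\<lambda>k. measure (\<gamma> (r k w) w) (C m i \<times> C m j)) \<longlonglongrightarrow> measure \<theta> (C m i \<times> C m j)" for m i j
          using lim[of "{b m i}" "{b m j}"] m\<theta>[of "{b m i}" "{b m j}"] by (simp add: C_cylM)
      qed (simp_all add: couplingsD(1)[OF \<gamma>[OF w]] couplingsD(1)[OF \<theta>] sets\<gamma>[OF w \<gamma>[OF w]] sets\<gamma>[OF w \<theta>])
      also have "\<dots> = c w"
      proof (rule lim_imp_Liminf)
        have "filterlim (\<lambda>k. r k w) sequentially sequentially"
          by (rule filterlim_at_top_mono[OF filterlim_ident]) (use r(2)[OF w] in simp)
        from filterlim_compose[OF cost[OF w] this]
        show "(\<lambda>k. quad_cost d (\<gamma> (r k w) w)) \<longlonglongrightarrow> c w" .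
      qed simp
      finally show ?thesis .
    qed
    ultimately show ?thesis using \<theta> by blast
  qed
  then obtain \<gamma>' where \<gamma>': "\<And>w. w \<in> space W \<Longrightarrow> \<gamma>' w \<in> couplings (\<mu> w) (\<nu> w)"
      "\<And>w. w \<in> space W \<Longrightarrow> quad_cost d (\<gamma>' w) \<le> c w"
      "\<And>w I. w \<in> space W \<Longrightarrow> finite I \<Longrightarrow> measure (\<gamma>' w) (?cyl I) = l (set_encode I) w"
    by metis
  show ?thesis
  proof (rule that[OF _ \<gamma>'(1,2)])
    show "\<gamma>' \<in> W \<rightarrow>\<^sub>M prob_algebra (M \<Otimes>\<^sub>M M)"
    proof (rule measurable_prob_algebra_generated[OF sets_bit_coded[OF bit_coded_pair[OF code code]]])
      show "Int_stable (?cyl ` {I. finite I})" by (auto simp: Int_stable_def cylM_Int)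
      show "?cyl ` {I. finite I} \<subseteq> Pow (space (M \<Otimes>\<^sub>M M))" by (auto simp: cylM_def)
      show "prob_space (\<gamma>' w)" "sets (\<gamma>' w) = sets (M \<Otimes>\<^sub>M M)" if "w \<in> space W" for w
        using couplingsD(1)[OF \<gamma>'(1)[OF that]] sets\<gamma>[OF that \<gamma>'(1)[OF that]] .
      fix A assume "A \<in> ?cyl ` {I. finite I}"
      then obtain I where I: "finite I" "A = ?cyl I" by auto
      have "emeasure (\<gamma>' w) A = ennreal (l (set_encode I) w)" if w: "w \<in> space W" for w
      proof -
        interpret prob_space "\<gamma>' w" using couplingsD(1)[OF \<gamma>'(1)[OF w]] .
        show ?thesis using \<gamma>'(3)[OF w I(1)] by (simp add: emeasure_eq_measure I)
      qed
      then show "(\<lambda>w. emeasure (\<gamma>' w) A) \<in> borel_measurable W"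
        by (subst measurable_cong, assumption) (intro measurable_compose[OF l_meas measurable_ennreal])
    qed
  qed
qed

text \<open>A minimizing sequence for one pair of measures is a family without parameter, so the
  measurable statement is used over a one-point space.\<close>

lemma optimal_coupling_exists:
  assumes \<mu>: "\<mu> \<in> space (prob_algebra M)" and \<nu>: "\<nu> \<in> space (prob_algebra M)"
  obtains \<theta> where "\<theta> \<in> couplings \<mu> \<nu>" "quad_cost d \<theta> = opt_cost d \<mu> \<nu>"
proof -
  let ?I = "opt_cost d \<mu> \<nu>"
  have ne: "\<mu> \<Otimes>\<^sub>M \<nu> \<in> couplings \<mu> \<nu>"
    using \<mu> \<nu> by (intro pair_measure_couplings) (auto simp: space_prob_algebra)
  have "\<exists>\<theta>\<in>couplings \<mu> \<nu>. quad_cost d \<theta> \<le> ?I + ennreal (1 / Suc n)" for n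
  proof (cases "?I = \<infinity>")
    case False
    then obtain t where t: "0 \<le> t" "?I = ennreal t" by (cases ?I) auto
    have "?I < ?I + ennreal (1 / Suc n)"
      unfolding t(2) using t(1) by (simp add: ennreal_plus[symmetric] ennreal_less_iff del: ennreal_plus)
    then show ?thesis by (subst (asm) INF_less_iff) (auto intro: less_imp_le)
  qed (use ne in auto)
  then obtain \<theta> where \<theta>: "\<And>n. \<theta> n \<in> couplings \<mu> \<nu>" "\<And>n. quad_cost d (\<theta> n) \<le> ?I + ennreal (1 / Suc n)"
    by metis
  have "(\<lambda>n. ennreal (1 / Suc n)) \<longlonglongrightarrow> ennreal 0"
    by (intro tendsto_ennrealI LIMSEQ_Suc lim_1_over_n[simplified])
  then have up: "(\<lambda>n. ?I + ennreal (1 / Suc n)) \<longlonglongrightarrow> ?I"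
    using tendsto_add[OF tendsto_const[of ?I]] by fastforce
  have lim: "(\<lambda>n. quad_cost d (\<theta> n)) \<longlonglongrightarrow> ?I"
    by (rule tendsto_sandwich[OF _ _ tendsto_const up]) (intro always_eventually allI INF_lower \<theta>)+
  obtain \<gamma>' where "\<gamma>' () \<in> couplings \<mu> \<nu>" "quad_cost d (\<gamma>' ()) \<le> ?I"
  proof (rule measurable_coupling_limit[where W = "count_space (UNIV :: unit set)" and \<mu> = "\<lambda>_. \<mu>" and \<nu> = "\<lambda>_. \<nu>"
        and \<gamma> = "\<lambda>n _. \<theta> n" and c = "\<lambda>_. ?I"])
  qed (use \<mu> \<nu> \<theta> lim that in auto)
  then show ?thesis using that[of "\<gamma>' ()"] by (metis INF_lower antisym)
qed

end

section \<open>The Wasserstein distance\<close>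

lemma wasserstein2_nonneg: "0 \<le> wasserstein2 d \<mu> \<nu>"
  by (simp add: wasserstein2_def)

text \<open>Finiteness matters because \<open>enn2real\<close> sends infinity to 0: if every
  coupling had infinite cost, the distance would read 0.\<close>

lemma wasserstein2_sq:
  assumes "opt_cost d \<mu> \<nu> < \<infinity>"
  shows "ennreal ((wasserstein2 d \<mu> \<nu>)\<^sup>2) = opt_cost d \<mu> \<nu>"
  using assms by (simp add: wasserstein2_def less_top[symmetric])

lemma wasserstein2_le:
  assumes "\<theta> \<in> couplings \<mu> \<nu>" "quad_cost d \<theta> \<le> ennreal (A\<^sup>2)" "0 \<le> A"
  shows "wasserstein2 d \<mu> \<nu> \<le> A"
proof -
  have "opt_cost d \<mu> \<nu> \<le> ennreal (A\<^sup>2)"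
    using assms by (auto intro: INF_lower2)
  then have "enn2real (opt_cost d \<mu> \<nu>) \<le> A\<^sup>2"
    by (intro enn2real_leI) auto
  then show ?thesis unfolding wasserstein2_def using \<open>0 \<le> A\<close> by (simp add: real_le_lsqrt)
qed

lemma wasserstein2_less:
  assumes "opt_cost d \<mu> \<nu> < \<infinity>" "wasserstein2 d \<mu> \<nu> < A"
  obtains \<theta> where "\<theta> \<in> couplings \<mu> \<nu>" "quad_cost d \<theta> < ennreal (A\<^sup>2)"
proof -
  have "(wasserstein2 d \<mu> \<nu>)\<^sup>2 < A\<^sup>2"
    using assms(2) wasserstein2_nonneg by (intro power_strict_mono) auto
  then have "ennreal ((wasserstein2 d \<mu> \<nu>)\<^sup>2) < ennreal (A\<^sup>2)"
    by (simp add: ennreal_less_iff)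
  then show ?thesis
    unfolding wasserstein2_sq[OF assms(1)] INF_less_iff using that by blast
qed

lemma quad_cost_eq: "quad_cost d \<theta> = (\<integral>\<^sup>+z. ennreal ((d (fst z) (snd z))\<^sup>2) \<partial>\<theta>)"
  by (simp add: quad_cost_def case_prod_unfold)

lemma coupling_nn_integral_fst:
  assumes "\<theta> \<in> couplings \<mu> \<nu>" "f \<in> borel_measurable \<mu>"
  shows "(\<integral>\<^sup>+z. f (fst z) \<partial>\<theta>) = (\<integral>\<^sup>+x. f x \<partial>\<mu>)"
proof -
  note [measurable_cong] = couplingsD(2)[OF assms(1)]
  have "(\<integral>\<^sup>+x. f x \<partial>distr \<theta> \<mu> fst) = (\<integral>\<^sup>+z. f (fst z) \<partial>\<theta>)"
    using assms(2) by (intro nn_integral_distr) measurable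
  then show ?thesis by (simp add: couplingsD(3)[OF assms(1)])
qed

lemma coupling_nn_integral_snd:
  assumes "\<theta> \<in> couplings \<mu> \<nu>" "f \<in> borel_measurable \<nu>"
  shows "(\<integral>\<^sup>+z. f (snd z) \<partial>\<theta>) = (\<integral>\<^sup>+x. f x \<partial>\<nu>)"
proof -
  note [measurable_cong] = couplingsD(2)[OF assms(1)]
  have "(\<integral>\<^sup>+x. f x \<partial>distr \<theta> \<nu> snd) = (\<integral>\<^sup>+z. f (snd z) \<partial>\<theta>)"
    using assms(2) by (intro nn_integral_distr) measurable
  then show ?thesis by (simp add: couplingsD(4)[OF assms(1)])
qed

lemma coupling_swap:
  assumes "\<theta> \<in> couplings \<mu> \<nu>"
  shows "distr \<theta> (\<nu> \<Otimes>\<^sub>M \<mu>) prod.swap \<in> couplings \<nu> \<mu>"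
proof -
  note c = couplingsD[OF assms]
  note [measurable_cong] = c(2)
  have [measurable]: "prod.swap \<in> \<theta> \<rightarrow>\<^sub>M \<nu> \<Otimes>\<^sub>M \<mu>"
    unfolding prod.swap_def by measurable
  have "distr (distr \<theta> (\<nu> \<Otimes>\<^sub>M \<mu>) prod.swap) \<nu> fst = distr \<theta> \<nu> snd"
       "distr (distr \<theta> (\<nu> \<Otimes>\<^sub>M \<mu>) prod.swap) \<mu> snd = distr \<theta> \<mu> fst"
    by (subst distr_distr; simp add: o_def)+
  then show ?thesis
    using c by (auto simp: couplings_def intro!: prob_space.prob_space_distr)
qed

lemma density_couplings:
  assumes \<mu>: "prob_space \<mu>" and \<nu>: "prob_space \<nu>" and f [measurable]: "f \<in> borel_measurable (\<mu> \<Otimes>\<^sub>M \<nu>)"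
    and 1: "AE x in \<mu>. (\<integral>\<^sup>+y. f (x, y) \<partial>\<nu>) = 1" and 2: "AE y in \<nu>. (\<integral>\<^sup>+x. f (x, y) \<partial>\<mu>) = 1"
  shows "density (\<mu> \<Otimes>\<^sub>M \<nu>) f \<in> couplings \<mu> \<nu>"
proof -
  interpret \<mu>: prob_space \<mu> by fact
  interpret \<nu>: prob_space \<nu> by fact
  interpret P: pair_prob_space \<mu> \<nu> ..
  let ?\<theta> = "density (\<mu> \<Otimes>\<^sub>M \<nu>) f"
  have d1: "distr ?\<theta> \<mu> fst = \<mu>"
  proof (rule measure_eqI)
    fix A assume "A \<in> sets (distr ?\<theta> \<mu> fst)"
    then have A [measurable]: "A \<in> sets \<mu>" by simp
    have m: "(\<lambda>z. f z * indicator A (fst z)) \<in> borel_measurable (\<mu> \<Otimes>\<^sub>M \<nu>)"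
      by (rule borel_measurable_times_ennreal[OF f measurable_compose[OF measurable_fst borel_measurable_indicator[OF A]]])
    have "emeasure (distr ?\<theta> \<mu> fst) A = (\<integral>\<^sup>+z. f z * indicator A (fst z) \<partial>(\<mu> \<Otimes>\<^sub>M \<nu>))"
      by (subst emeasure_distr, measurable, subst emeasure_density)
         (auto intro!: nn_integral_cong split: split_indicator)
    also have "\<dots> = (\<integral>\<^sup>+x. \<integral>\<^sup>+y. f (x, y) * indicator A x \<partial>\<nu> \<partial>\<mu>)"
      using \<nu>.nn_integral_fst[OF m, symmetric] unfolding fst_conv .
    also have "\<dots> = (\<integral>\<^sup>+x. indicator A x \<partial>\<mu>)"
    proof (rule nn_integral_cong_AE)
      show "AE x in \<mu>. (\<integral>\<^sup>+y. f (x, y) * indicator A x \<partial>\<nu>) = indicator A x"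
        using 1 AE_space by eventually_elim (simp add: nn_integral_multc)
    qed
    finally show "emeasure (distr ?\<theta> \<mu> fst) A = emeasure \<mu> A" by simp
  qed simp
  have d2: "distr ?\<theta> \<nu> snd = \<nu>"
  proof (rule measure_eqI)
    fix A assume "A \<in> sets (distr ?\<theta> \<nu> snd)"
    then have A [measurable]: "A \<in> sets \<nu>" by simp
    have m: "(\<lambda>z. f z * indicator A (snd z)) \<in> borel_measurable (\<mu> \<Otimes>\<^sub>M \<nu>)"
      by (rule borel_measurable_times_ennreal[OF f measurable_compose[OF measurable_snd borel_measurable_indicator[OF A]]])
    have "emeasure (distr ?\<theta> \<nu> snd) A = (\<integral>\<^sup>+z. f z * indicator A (snd z) \<partial>(\<mu> \<Otimes>\<^sub>M \<nu>))"
      by (subst emeasure_distr, measurable, subst emeasure_density)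
         (auto intro!: nn_integral_cong split: split_indicator)
    also have "\<dots> = (\<integral>\<^sup>+y. \<integral>\<^sup>+x. f (x, y) * indicator A y \<partial>\<mu> \<partial>\<nu>)"
      using P.nn_integral_snd[OF m, symmetric] unfolding snd_conv .
    also have "\<dots> = (\<integral>\<^sup>+x. indicator A x \<partial>\<nu>)"
    proof (rule nn_integral_cong_AE)
      show "AE y in \<nu>. (\<integral>\<^sup>+x. f (x, y) * indicator A y \<partial>\<mu>) = indicator A y"
        using 2 AE_space by eventually_elim (simp add: nn_integral_multc)
    qed
    finally show "emeasure (distr ?\<theta> \<nu> snd) A = emeasure \<nu> A" by simp
  qed simp
  have "prob_space ?\<theta>"
  proof (rule prob_spaceI)
    have "emeasure (distr ?\<theta> \<mu> fst) (space \<mu>) = emeasure ?\<theta> (fst -` space \<mu> \<inter> space ?\<theta>)"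
      by (rule emeasure_distr) auto
    moreover have "fst -` space \<mu> \<inter> space ?\<theta> = space ?\<theta>" by (auto simp: space_pair_measure)
    ultimately show "emeasure ?\<theta> (space ?\<theta>) = 1" using d1 \<mu>.emeasure_space_1 by simp
  qed
  then show ?thesis using d1 d2 by (simp add: couplings_def)
qed

lemma measurable_fun2_nat:
  assumes "f \<in> M \<rightarrow>\<^sub>M count_space (UNIV :: nat set)" "g \<in> M \<rightarrow>\<^sub>M count_space (UNIV :: nat set)"
    and "\<And>k l. F k l \<in> space N"
  shows "(\<lambda>x. F (f x) (g x)) \<in> M \<rightarrow>\<^sub>M N"
proof (rule measurable_compose_countable[where f = "\<lambda>k x. F k (g x)" and g = f, OF _ assms(1)])
  show "(\<lambda>x. F k (g x)) \<in> M \<rightarrow>\<^sub>M N" for k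
    by (rule measurable_compose_countable[where f = "\<lambda>l x. F k l" and g = g, OF _ assms(2)]) (simp add: assms(3))
qed

text \<open>Balls whose radius is half the wanted diameter, centred at a dense sequence and made
  disjoint in order.\<close>

lemma ex_small_cells:
  obtains C where "small_cells (borel :: 'a::{metric_space, second_countable_topology} measure) dist C"
proof -
  obtain x :: "nat \<Rightarrow> 'a" where x: "\<And>y e. e > 0 \<Longrightarrow> \<exists>k. dist y (x k) < e"
    using dense_sequence by blast
  let ?B = "\<lambda>m k. ball (x k) ((1/2) ^ Suc m)"
  have "small_cells borel dist (\<lambda>m. disjointed (?B m))"
  proof
    show "disjointed (?B m) k \<in> sets borel" for m k
      by (rule sets.range_disjointed_sets'[THEN subsetD, of "?B m"]) auto
    show "disjoint_family (disjointed (?B m))" for m by (rule disjoint_family_disjointed)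
    have "y \<in> (\<Union>k. ?B m k)" for m y using x[of "(1/2) ^ Suc m" y] by (auto simp: dist_commute)
    then show "(\<Union>k. disjointed (?B m) k) = space borel" for m by (auto simp: UN_disjointed_eq)
    show "dist y z \<le> (1/2) ^ m" if "y \<in> disjointed (?B m) k" "z \<in> disjointed (?B m) k" for y z m k
    proof -
      have "dist (x k) y < (1/2) ^ Suc m" "dist (x k) z < (1/2) ^ Suc m"
        using that disjointed_subset[of "?B m" k] by auto
      then show ?thesis using dist_triangle3[of y z "x k"] by simp
    qed
  qed (auto simp: dist_commute dist_triangle)
  then show ?thesis by (rule that)
qed

section \<open>Gluing of couplings\<close>

text \<open>Weighted Cauchy-Schwarz inequality for the summands \<open>a\<close>, \<open>e\<close>,
  \<open>b\<close> with weights \<open>A\<close>, \<open>e\<close>, \<open>B\<close>. If the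
  integrals of \<open>a\<^sup>2\<close> and \<open>b\<^sup>2\<close> are at most
  \<open>A\<^sup>2\<close> and \<open>B\<^sup>2\<close>, integration bounds the right side by
  \<open>(A + B + e)\<^sup>2\<close>, as Minkowski's inequality would.\<close>

lemma three_squares:
  fixes a b e A B :: real
  assumes "A > 0" "B > 0" "e > 0"
  shows "(a + e + b)\<^sup>2 \<le> (A + B + e) * (a\<^sup>2 / A + b\<^sup>2 / B + e)"
proof -
  have "(A + B + e) * (a\<^sup>2 / A + b\<^sup>2 / B + e) - (a + e + b)\<^sup>2
      = (B * a - A * b)\<^sup>2 / (A * B) + e / A * (a - A)\<^sup>2 + e / B * (b - B)\<^sup>2"
    using assms by (simp add: field_simps power2_eq_square)
  also have "\<dots> \<ge> 0" using assms by simp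
  finally show ?thesis by simp
qed

text \<open>Gluing without disintegration: the middle points are only required to lie in the same small cell.\<close>

lemma approximate_gluing:
  fixes \<mu> \<nu> \<rho> :: "'a::{metric_space, second_countable_topology} measure"
  assumes sets: "sets \<mu> = sets borel" "sets \<nu> = sets borel" "sets \<rho> = sets borel"
    and prob: "prob_space \<nu>"
    and \<theta>1: "\<theta>1 \<in> couplings \<mu> \<nu>" "quad_cost dist \<theta>1 \<le> ennreal (A\<^sup>2)"
    and \<theta>2: "\<theta>2 \<in> couplings \<nu> \<rho>" "quad_cost dist \<theta>2 \<le> ennreal (B\<^sup>2)"
    and pos: "A > 0" "B > 0" "e > 0"
  obtains \<theta> where "\<theta> \<in> couplings \<mu> \<rho>" "quad_cost dist \<theta> \<le> ennreal ((A + B + e)\<^sup>2)"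
proof -
  interpret \<nu>: prob_space \<nu> by fact
  interpret \<theta>1: prob_space \<theta>1 using couplingsD(1)[OF \<theta>1(1)] .
  interpret \<theta>2: prob_space \<theta>2 using couplingsD(1)[OF \<theta>2(1)] .
  have sets\<theta>: "sets \<theta>1 = sets (borel \<Otimes>\<^sub>M borel)" "sets \<theta>2 = sets (borel \<Otimes>\<^sub>M borel)"
    using couplingsD(2)[OF \<theta>1(1)] couplingsD(2)[OF \<theta>2(1)] sets_pair_measure_cong[OF sets(1,2)] sets_pair_measure_cong[OF sets(2,3)] by auto
  note [measurable_cong] = sets sets\<theta>
  obtain C where "small_cells (borel :: 'a measure) dist C" by (rule ex_small_cells)
  then interpret C: small_cells "borel :: 'a measure" dist C .
  obtain m where m: "(1/2) ^ m < e" using real_arch_pow_inv[OF pos(3), of "1/2"] by auto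
  let ?i = "C.idx m"
  have [measurable]: "?i \<in> borel \<rightarrow>\<^sub>M count_space UNIV" by (rule C.measurable_idx)
  have idx_iff: "?i y = k \<longleftrightarrow> y \<in> C m k" for y k
    by (metis C.idx C.idx_unique UNIV_I space_borel)
  \<comment> \<open>Given the cell of the middle points, the two pairs are taken independently:
    relative to \<open>\<theta>1 \<Otimes>\<^sub>M \<theta>2\<close> the density is the reciprocal
    of the \<nu>-mass of the cell if both middle points lie in it, and 0 if their cells
    differ.\<close>
  define F where "F k l = (if k = l then 1 / emeasure \<nu> (C m k) else 0)" for k l
  define g where "g = (\<lambda>z::('a \<times> 'a) \<times> ('a \<times> 'a). F (?i (snd (fst z))) (?i (fst (snd z))))"
  have g: "g \<in> borel_measurable (\<theta>1 \<Otimes>\<^sub>M \<theta>2)"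
  proof -
    have "(\<lambda>z. ?i (snd (fst z))) \<in> \<theta>1 \<Otimes>\<^sub>M \<theta>2 \<rightarrow>\<^sub>M count_space UNIV"
      "(\<lambda>z. ?i (fst (snd z))) \<in> \<theta>1 \<Otimes>\<^sub>M \<theta>2 \<rightarrow>\<^sub>M count_space UNIV"
      by measurable
    from measurable_fun2_nat[OF this, of F borel] show ?thesis unfolding g_def by simp
  qed
  have i\<nu>: "?i \<in> \<nu> \<rightarrow>\<^sub>M count_space UNIV" by measurable
  have F\<nu>: "(\<lambda>y. F k (?i y)) \<in> borel_measurable \<nu>" "(\<lambda>y. F (?i y) k) \<in> borel_measurable \<nu>" for k
    using measurable_fun2_nat[OF measurable_const i\<nu>, of k F borel] measurable_fun2_nat[OF i\<nu> measurable_const, of k F borel]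
    by auto
  \<comment> \<open>Cells without mass make the reciprocal infinite; almost no middle point lies in
    one.\<close>
  have AE\<nu>: "AE y in \<nu>. emeasure \<nu> (C m (?i y)) \<noteq> 0"
  proof -
    have "AE y in \<nu>. y \<in> C m k \<longrightarrow> emeasure \<nu> (C m k) \<noteq> 0" for k
    proof (cases "emeasure \<nu> (C m k) = 0")
      case True
      then have "C m k \<in> null_sets \<nu>" by (intro null_setsI) (simp_all add: sets)
      from AE_not_in[OF this] show ?thesis by eventually_elim simp
    qed simp
    then have "AE y in \<nu>. \<forall>k. y \<in> C m k \<longrightarrow> emeasure \<nu> (C m k) \<noteq> 0" by (simp add: AE_all_countable)
    then show ?thesis by eventually_elim (use idx_iff in blast)
  qed
  have int1: "(\<integral>\<^sup>+y. F k (?i y) \<partial>\<nu>) = 1" and int2: "(\<integral>\<^sup>+y. F (?i y) k \<partial>\<nu>) = 1"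
    if "emeasure \<nu> (C m k) \<noteq> 0" for k
  proof -
    have F: "F k (?i y) = 1 / emeasure \<nu> (C m k) * indicator (C m k) y"
      "F (?i y) k = 1 / emeasure \<nu> (C m k) * indicator (C m k) y" for y
      using idx_iff[of y k] by (auto simp: F_def split: split_indicator)
    have "(\<integral>\<^sup>+y. 1 / emeasure \<nu> (C m k) * indicator (C m k) y \<partial>\<nu>) = 1 / emeasure \<nu> (C m k) * emeasure \<nu> (C m k)"
      by (rule nn_integral_cmult_indicator) (simp add: sets)
    also have "\<dots> = 1"
      using that by (subst mult.commute) (simp add: ennreal_times_divide ennreal_divide_self less_top[symmetric])
    finally show "(\<integral>\<^sup>+y. F k (?i y) \<partial>\<nu>) = 1" "(\<integral>\<^sup>+y. F (?i y) k \<partial>\<nu>) = 1"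
      by (simp_all only: F)
  qed
  have \<eta>: "density (\<theta>1 \<Otimes>\<^sub>M \<theta>2) g \<in> couplings \<theta>1 \<theta>2" (is "?\<eta> \<in> _")
  proof (rule density_couplings[OF \<theta>1.prob_space_axioms \<theta>2.prob_space_axioms g])
    have "AE z in distr \<theta>1 \<nu> snd. emeasure \<nu> (C m (?i z)) \<noteq> 0"
      unfolding couplingsD(4)[OF \<theta>1(1)] by (rule AE\<nu>)
    then have "AE z in \<theta>1. emeasure \<nu> (C m (?i (snd z))) \<noteq> 0"
      by (rule AE_distrD[rotated]) measurable
    then show "AE z in \<theta>1. (\<integral>\<^sup>+z'. g (z, z') \<partial>\<theta>2) = 1"
      by eventually_elim (simp add: g_def coupling_nn_integral_fst[OF \<theta>2(1) F\<nu>(1)] int1)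
    have "AE z in distr \<theta>2 \<nu> fst. emeasure \<nu> (C m (?i z)) \<noteq> 0"
      unfolding couplingsD(3)[OF \<theta>2(1)] by (rule AE\<nu>)
    then have "AE z in \<theta>2. emeasure \<nu> (C m (?i (fst z))) \<noteq> 0"
      by (rule AE_distrD[rotated]) measurable
    then show "AE z' in \<theta>2. (\<integral>\<^sup>+z. g (z, z') \<partial>\<theta>1) = 1"
      by eventually_elim (simp add: g_def coupling_nn_integral_snd[OF \<theta>1(1) F\<nu>(2)] int2)
  qed
  note c\<eta> = couplingsD[OF \<eta>]
  note [measurable_cong] = c\<eta>(2)
  let ?f = "\<lambda>z::('a \<times> 'a) \<times> ('a \<times> 'a). (fst (fst z), snd (snd z))"
  have f: "?f \<in> ?\<eta> \<rightarrow>\<^sub>M \<mu> \<Otimes>\<^sub>M \<rho>" by measurable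
  define \<theta> where "\<theta> = distr ?\<eta> (\<mu> \<Otimes>\<^sub>M \<rho>) ?f"
  have "distr \<theta> \<mu> fst = distr (distr ?\<eta> \<theta>1 fst) \<mu> fst"
    unfolding \<theta>_def by (subst distr_distr[OF _ f], measurable, subst distr_distr) (measurable, simp add: o_def)
  then have "distr \<theta> \<mu> fst = \<mu>" using c\<eta>(3) couplingsD(3)[OF \<theta>1(1)] by simp
  moreover have "distr \<theta> \<rho> snd = distr (distr ?\<eta> \<theta>2 snd) \<rho> snd"
    unfolding \<theta>_def by (subst distr_distr[OF _ f], measurable, subst distr_distr) (measurable, simp add: o_def)
  then have "distr \<theta> \<rho> snd = \<rho>" using c\<eta>(4) couplingsD(4)[OF \<theta>2(1)] by simp
  ultimately have \<theta>: "\<theta> \<in> couplings \<mu> \<rho>"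
    using prob_space.prob_space_distr[OF c\<eta>(1) f] by (simp add: couplings_def \<theta>_def)
  have AE\<eta>: "AE z in ?\<eta>. dist (snd (fst z)) (fst (snd z)) \<le> e"
  proof (subst AE_density[OF g], rule AE_I2, rule impI)
    fix z assume "0 < g z"
    then have "?i (snd (fst z)) = ?i (fst (snd z))" by (auto simp: g_def F_def split: if_splits)
    then have "dist (snd (fst z)) (fst (snd z)) \<le> (1/2) ^ m"
      using idx_iff by (intro C.C_small) blast+
    then show "dist (snd (fst z)) (fst (snd z)) \<le> e" using m by simp
  qed
  have cost1: "(\<integral>\<^sup>+z. ennreal ((dist (fst (fst z)) (snd (fst z)))\<^sup>2) \<partial>?\<eta>) = quad_cost dist \<theta>1"
    using coupling_nn_integral_fst[OF \<eta>, of "\<lambda>z. ennreal ((dist (fst z) (snd z))\<^sup>2)"]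
    by (simp add: quad_cost_eq)
  have cost2: "(\<integral>\<^sup>+z. ennreal ((dist (fst (snd z)) (snd (snd z)))\<^sup>2) \<partial>?\<eta>) = quad_cost dist \<theta>2"
    using coupling_nn_integral_snd[OF \<eta>, of "\<lambda>z. ennreal ((dist (fst z) (snd z))\<^sup>2)"]
    by (simp add: quad_cost_eq)
  have m: "(\<lambda>z. ennreal ((dist (fst z) (snd z))\<^sup>2)) \<in> borel_measurable (\<mu> \<Otimes>\<^sub>M \<rho>)" by measurable
  have "quad_cost dist \<theta> = (\<integral>\<^sup>+z. ennreal ((dist (fst (fst z)) (snd (snd z)))\<^sup>2) \<partial>?\<eta>)"
    unfolding quad_cost_eq \<theta>_def by (subst nn_integral_distr[OF f]) (simp_all add: m)
  also have "\<dots> \<le> (\<integral>\<^sup>+z. ennreal (A + B + e) * (ennreal (1 / A) * ennreal ((dist (fst (fst z)) (snd (fst z)))\<^sup>2)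
      + ennreal (1 / B) * ennreal ((dist (fst (snd z)) (snd (snd z)))\<^sup>2) + ennreal e) \<partial>?\<eta>)"
  proof (rule nn_integral_mono_AE)
    show "AE z in ?\<eta>. ennreal ((dist (fst (fst z)) (snd (snd z)))\<^sup>2) \<le> ennreal (A + B + e) * (ennreal (1 / A) * ennreal ((dist (fst (fst z)) (snd (fst z)))\<^sup>2)
      + ennreal (1 / B) * ennreal ((dist (fst (snd z)) (snd (snd z)))\<^sup>2) + ennreal e)"
      using AE\<eta>
    proof eventually_elim
      fix z :: "('a \<times> 'a) \<times> ('a \<times> 'a)" assume z: "dist (snd (fst z)) (fst (snd z)) \<le> e"
      let ?a = "dist (fst (fst z)) (snd (fst z))" and ?b = "dist (fst (snd z)) (snd (snd z))"
      have "dist (fst (fst z)) (snd (snd z)) \<le> ?a + e + ?b"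
        using dist_triangle[of "fst (fst z)" "snd (snd z)" "snd (fst z)"]
          dist_triangle[of "snd (fst z)" "snd (snd z)" "fst (snd z)"] z by linarith
      then have "(dist (fst (fst z)) (snd (snd z)))\<^sup>2 \<le> (?a + e + ?b)\<^sup>2"
        by (intro power_mono) auto
      also have "\<dots> \<le> (A + B + e) * (?a\<^sup>2 / A + ?b\<^sup>2 / B + e)" by (rule three_squares[OF pos])
      finally have "ennreal ((dist (fst (fst z)) (snd (snd z)))\<^sup>2) \<le> ennreal ((A + B + e) * (1 / A * ?a\<^sup>2 + 1 / B * ?b\<^sup>2 + e))"
        by (intro ennreal_leI) simp
      also have "\<dots> = ennreal (A + B + e) * (ennreal (1 / A) * ennreal (?a\<^sup>2) + ennreal (1 / B) * ennreal (?b\<^sup>2) + ennreal e)"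
        using pos by (simp add: ennreal_mult[symmetric] ennreal_plus[symmetric] del: ennreal_plus)
      finally show "ennreal ((dist (fst (fst z)) (snd (snd z)))\<^sup>2) \<le> \<dots>" .
    qed
  qed
  also have "\<dots> = ennreal (A + B + e) * (ennreal (1 / A) * quad_cost dist \<theta>1 + ennreal (1 / B) * quad_cost dist \<theta>2 + ennreal e)"
    by (simp add: nn_integral_cmult nn_integral_add cost1 cost2 prob_space.emeasure_space_1[OF c\<eta>(1)] del: space_density emeasure_density)
  also have "\<dots> \<le> ennreal (A + B + e) * (ennreal (1 / A) * ennreal (A\<^sup>2) + ennreal (1 / B) * ennreal (B\<^sup>2) + ennreal e)"
    by (intro mult_left_mono add_mono \<theta>1 \<theta>2) auto
  also have "\<dots> = ennreal ((A + B + e)\<^sup>2)"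
    using pos by (simp add: ennreal_mult[symmetric] ennreal_plus[symmetric] power2_eq_square del: ennreal_plus)
  finally show ?thesis using \<theta> that by blast
qed

section \<open>Finite second moments and the metric axioms for \<open>w2\<close>\<close>

abbreviation moment :: "'a::metric_space \<Rightarrow> 'a measure \<Rightarrow> ennreal" where
  "moment x0 \<mu> \<equiv> \<integral>\<^sup>+x. ennreal ((dist x0 x)\<^sup>2) \<partial>\<mu>"

text \<open>The definition offers a finite moment about some point only; the inequality
  \<open>(a + b)\<^sup>2 \<le> 2 * a\<^sup>2 + 2 * b\<^sup>2\<close> moves it to any other.\<close>

lemma prob2D:
  fixes \<mu> :: "'a::{metric_space, second_countable_topology} measure"
  assumes "\<mu> \<in> prob2"
  shows "prob_space \<mu>" "sets \<mu> = sets borel" "moment x0 \<mu> < \<infinity>"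
    "\<mu> \<in> space (prob_algebra borel)" "space \<mu> = UNIV"
proof -
  show ps: "prob_space \<mu>" and s: "sets \<mu> = sets borel"
    using assms by (auto simp: P2_def metric_borel_UNIV_dist)
  note [measurable_cong] = s
  interpret prob_space \<mu> by fact
  obtain y where y: "moment y \<mu> < \<infinity>" using assms by (auto simp: P2_def)
  have "moment x0 \<mu> \<le> (\<integral>\<^sup>+x. ennreal (2 * (dist x0 y)\<^sup>2) + 2 * ennreal ((dist y x)\<^sup>2) \<partial>\<mu>)"
  proof (rule nn_integral_mono)
    fix x
    have "(dist x0 x)\<^sup>2 \<le> (dist x0 y + dist y x)\<^sup>2"
      by (intro power_mono dist_triangle) simp
    also have "\<dots> \<le> 2 * (dist x0 y)\<^sup>2 + 2 * (dist y x)\<^sup>2"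
      using zero_le_power2[of "dist x0 y - dist y x"] by (simp add: power2_eq_square algebra_simps)
    finally have "ennreal ((dist x0 x)\<^sup>2) \<le> ennreal (2 * (dist x0 y)\<^sup>2 + 2 * (dist y x)\<^sup>2)"
      by (rule ennreal_leI)
    then show "ennreal ((dist x0 x)\<^sup>2) \<le> ennreal (2 * (dist x0 y)\<^sup>2) + 2 * ennreal ((dist y x)\<^sup>2)"
      by (simp add: ennreal_plus ennreal_mult)
  qed
  also have "\<dots> = ennreal (2 * (dist x0 y)\<^sup>2) + 2 * moment y \<mu>"
    by (simp add: nn_integral_add nn_integral_cmult emeasure_space_1)
  also have "\<dots> < \<infinity>" using y by (simp add: ennreal_mult_eq_top_iff less_top[symmetric])
  finally show "moment x0 \<mu> < \<infinity>" .
  show "\<mu> \<in> space (prob_algebra borel)" using ps s by (simp add: space_prob_algebra)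
  show "space \<mu> = UNIV" using sets_eq_imp_space_eq[OF s] by simp
qed

lemma prob2I:
  assumes "prob_space \<mu>" "sets \<mu> = sets borel" "moment x0 \<mu> < \<infinity>"
  shows "\<mu> \<in> prob2"
  using assms by (auto simp: P2_def metric_borel_UNIV_dist)

lemma ennreal_dist_sq_le:
  "ennreal ((dist x z)\<^sup>2) \<le> 2 * ennreal ((dist y x)\<^sup>2) + 2 * ennreal ((dist y z)\<^sup>2)"
proof -
  have "(dist x z)\<^sup>2 \<le> (dist y x + dist y z)\<^sup>2"
    by (intro power_mono dist_triangle3) simp
  also have "\<dots> \<le> 2 * (dist y x)\<^sup>2 + 2 * (dist y z)\<^sup>2"
    using zero_le_power2[of "dist y x - dist y z"] by (simp add: power2_eq_square algebra_simps)
  finally have "ennreal ((dist x z)\<^sup>2) \<le> ennreal (2 * (dist y x)\<^sup>2 + 2 * (dist y z)\<^sup>2)"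
    by (rule ennreal_leI)
  then show ?thesis by (simp add: ennreal_plus ennreal_mult)
qed

lemma couplings_borelD:
  fixes \<mu> \<nu> :: "'a::{metric_space, second_countable_topology} measure"
  assumes "\<theta> \<in> couplings \<mu> \<nu>" "sets \<mu> = sets borel" "sets \<nu> = sets borel"
  shows "sets \<theta> = sets (borel \<Otimes>\<^sub>M borel)" "sets \<theta> = sets borel"
proof -
  show 1: "sets \<theta> = sets (borel \<Otimes>\<^sub>M borel)"
    using couplingsD(2)[OF assms(1)] sets_pair_measure_cong[OF assms(2,3)] by simp
  show "sets \<theta> = sets borel" using 1 unfolding borel_prod .
qed

lemma quad_cost_le_moments:
  fixes \<mu> \<nu> :: "'a::{metric_space, second_countable_topology} measure"
  assumes \<theta>: "\<theta> \<in> couplings \<mu> \<nu>" and s: "sets \<mu> = sets borel" "sets \<nu> = sets borel"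
  shows "quad_cost dist \<theta> \<le> 2 * moment x0 \<mu> + 2 * moment x0 \<nu>"
proof -
  note [measurable_cong] = s couplings_borelD(1)[OF \<theta> s]
  have "quad_cost dist \<theta> \<le> (\<integral>\<^sup>+z. 2 * ennreal ((dist x0 (fst z))\<^sup>2) + 2 * ennreal ((dist x0 (snd z))\<^sup>2) \<partial>\<theta>)"
    unfolding quad_cost_eq by (intro nn_integral_mono ennreal_dist_sq_le)
  also have "\<dots> = 2 * (\<integral>\<^sup>+z. ennreal ((dist x0 (fst z))\<^sup>2) \<partial>\<theta>) + 2 * (\<integral>\<^sup>+z. ennreal ((dist x0 (snd z))\<^sup>2) \<partial>\<theta>)"
    by (simp add: nn_integral_add nn_integral_cmult)
  also have "(\<integral>\<^sup>+z. ennreal ((dist x0 (fst z))\<^sup>2) \<partial>\<theta>) = moment x0 \<mu>"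
    by (rule coupling_nn_integral_fst[OF \<theta>]) measurable
  also have "(\<integral>\<^sup>+z. ennreal ((dist x0 (snd z))\<^sup>2) \<partial>\<theta>) = moment x0 \<nu>"
    by (rule coupling_nn_integral_snd[OF \<theta>]) measurable
  finally show ?thesis .
qed

lemma moment_le_quad_cost:
  fixes \<mu> \<nu> :: "'a::{metric_space, second_countable_topology} measure"
  assumes \<theta>: "\<theta> \<in> couplings \<mu> \<nu>" and s: "sets \<mu> = sets borel" "sets \<nu> = sets borel"
  shows "moment x0 \<nu> \<le> 2 * moment x0 \<mu> + 2 * quad_cost dist \<theta>"
proof -
  note [measurable_cong] = s couplings_borelD(1)[OF \<theta> s]
  have "moment x0 \<nu> = (\<integral>\<^sup>+z. ennreal ((dist x0 (snd z))\<^sup>2) \<partial>\<theta>)"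
    by (rule coupling_nn_integral_snd[OF \<theta>, symmetric]) measurable
  also have "\<dots> \<le> (\<integral>\<^sup>+z. 2 * ennreal ((dist x0 (fst z))\<^sup>2) + 2 * ennreal ((dist (fst z) (snd z))\<^sup>2) \<partial>\<theta>)"
    using ennreal_dist_sq_le[of x0 "snd z" "fst z" for z :: "'a \<times> 'a"]
    by (intro nn_integral_mono) (simp add: dist_commute)
  also have "\<dots> = 2 * (\<integral>\<^sup>+z. ennreal ((dist x0 (fst z))\<^sup>2) \<partial>\<theta>) + 2 * quad_cost dist \<theta>"
    unfolding quad_cost_eq by (simp add: nn_integral_add nn_integral_cmult)
  also have "(\<integral>\<^sup>+z. ennreal ((dist x0 (fst z))\<^sup>2) \<partial>\<theta>) = moment x0 \<mu>"
    by (rule coupling_nn_integral_fst[OF \<theta>]) measurable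
  finally show ?thesis .
qed

context
  fixes \<mu> \<nu> :: "'a::{metric_space, second_countable_topology} measure"
  assumes \<mu>: "\<mu> \<in> prob2" and \<nu>: "\<nu> \<in> prob2"
begin

lemma INF_quad_cost_finite: "opt_cost dist \<mu> \<nu> < \<infinity>"
proof -
  have c: "\<mu> \<Otimes>\<^sub>M \<nu> \<in> couplings \<mu> \<nu>" by (intro pair_measure_couplings prob2D \<mu> \<nu>)
  have "quad_cost dist (\<mu> \<Otimes>\<^sub>M \<nu>) < \<infinity>"
    using quad_cost_le_moments[OF c prob2D(2)[OF \<mu>] prob2D(2)[OF \<nu>], of undefined]
      prob2D(3)[OF \<mu>, of undefined] prob2D(3)[OF \<nu>, of undefined]
    by (auto simp: less_top[symmetric] ennreal_add_eq_top ennreal_mult_eq_top_iff top_unique)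
  then show ?thesis using c by (auto intro: INF_lower le_less_trans)
qed

lemma w2_sq: "ennreal ((w2 \<mu> \<nu>)\<^sup>2) = opt_cost dist \<mu> \<nu>"
  by (rule wasserstein2_sq[OF INF_quad_cost_finite])

lemma w2_sq_le: "\<theta> \<in> couplings \<mu> \<nu> \<Longrightarrow> ennreal ((w2 \<mu> \<nu>)\<^sup>2) \<le> quad_cost dist \<theta>"
  unfolding w2_sq by (rule INF_lower)

text \<open>A coupling of cost below \<open>(w2 \<mu> \<nu> + e)\<^sup>2\<close> gives the bound
  with an extra \<open>e\<close>, which then tends to 0 from the right. It lets moments be estimated
  by the distance to one reference measure.\<close>

lemma moment_le_w2:
  "moment x0 \<nu> \<le> 2 * moment x0 \<mu> + 2 * ennreal ((w2 \<mu> \<nu>)\<^sup>2)"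
proof -
  have "moment x0 \<nu>
      \<le> 2 * moment x0 \<mu> + 2 * ennreal ((w2 \<mu> \<nu> + e)\<^sup>2)" if e: "e > 0" for e
  proof -
    obtain \<theta> where \<theta>: "\<theta> \<in> couplings \<mu> \<nu>" "quad_cost dist \<theta> < ennreal ((w2 \<mu> \<nu> + e)\<^sup>2)"
      using wasserstein2_less[OF INF_quad_cost_finite, of "w2 \<mu> \<nu> + e"] e by auto
    have "moment x0 \<nu> \<le> 2 * moment x0 \<mu> + 2 * quad_cost dist \<theta>"
      by (rule moment_le_quad_cost[OF \<theta>(1) prob2D(2)[OF \<mu>] prob2D(2)[OF \<nu>]])
    also have "\<dots> \<le> 2 * moment x0 \<mu> + 2 * ennreal ((w2 \<mu> \<nu> + e)\<^sup>2)"
      using \<theta>(2) by (intro add_left_mono mult_left_mono) auto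
    finally show ?thesis .
  qed
  moreover have "((\<lambda>e. 2 * moment x0 \<mu> + 2 * ennreal ((w2 \<mu> \<nu> + e)\<^sup>2)) \<longlongrightarrow>
      2 * moment x0 \<mu> + 2 * ennreal ((w2 \<mu> \<nu> + 0)\<^sup>2)) (at_right 0)"
    by (intro tendsto_add tendsto_const ennreal_tendsto_cmult tendsto_ennrealI tendsto_power tendsto_ident_at) simp
  ultimately show ?thesis
    by (intro tendsto_lowerbound[of _ _ "at_right 0"]) (auto simp: eventually_at_right_less intro!: eventually_at_rightI[of 0 1])
qed

end

lemma w2_commute: 
  fixes \<mu> \<nu> :: "'a::{metric_space, second_countable_topology} measure"
  assumes "sets \<mu> = sets borel" "sets \<nu> = sets borel"
  shows "w2 \<mu> \<nu> = w2 \<nu> \<mu>"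
proof -
  have "opt_cost dist \<mu> \<nu> \<le> opt_cost dist \<nu> \<mu>"
    if s: "sets \<mu> = sets borel" "sets \<nu> = sets borel" for \<mu> \<nu> :: "'a measure"
  proof (rule INF_greatest)
    fix \<theta> assume \<theta>: "\<theta> \<in> couplings \<nu> \<mu>"
    note [measurable_cong] = s couplings_borelD(1)[OF \<theta> s(2,1)]
    have [measurable]: "prod.swap \<in> \<theta> \<rightarrow>\<^sub>M \<mu> \<Otimes>\<^sub>M \<nu>"
      unfolding prod.swap_def by measurable
    have "quad_cost dist (distr \<theta> (\<mu> \<Otimes>\<^sub>M \<nu>) prod.swap) = quad_cost dist \<theta>"
      unfolding quad_cost_eq by (subst nn_integral_distr) (measurable, simp add: dist_commute)
    then show "opt_cost dist \<mu> \<nu> \<le> quad_cost dist \<theta>"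
      using coupling_swap[OF \<theta>] by (metis INF_lower)
  qed
  then show ?thesis using assms unfolding wasserstein2_def by (metis antisym)
qed

text \<open>Of the three parts of \<open>e\<close>, two enlarge the distances to positive radii that
  near-optimal couplings undercut; the third pays for the gluing, in which the middle points agree
  only up to a small cell.\<close>

lemma w2_triangle:
  fixes \<mu> \<nu> \<rho> :: "'a::{metric_space, second_countable_topology} measure"
  assumes \<mu>: "\<mu> \<in> prob2" and \<nu>: "\<nu> \<in> prob2" and \<rho>: "\<rho> \<in> prob2"
  shows "w2 \<mu> \<rho> \<le> w2 \<mu> \<nu> + w2 \<nu> \<rho>"
proof (rule field_le_epsilon)
  fix e :: real assume e: "e > 0"
  let ?A = "w2 \<mu> \<nu> + e / 3" and ?B = "w2 \<nu> \<rho> + e / 3"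
  have pos: "?A > 0" "?B > 0" "e / 3 > 0" using e wasserstein2_nonneg[of dist \<mu> \<nu>] wasserstein2_nonneg[of dist \<nu> \<rho>] by linarith+
  obtain \<theta>1 where 1: "\<theta>1 \<in> couplings \<mu> \<nu>" "quad_cost dist \<theta>1 < ennreal (?A\<^sup>2)"
    using wasserstein2_less[OF INF_quad_cost_finite[OF \<mu> \<nu>], of ?A] e by auto
  obtain \<theta>2 where 2: "\<theta>2 \<in> couplings \<nu> \<rho>" "quad_cost dist \<theta>2 < ennreal (?B\<^sup>2)"
    using wasserstein2_less[OF INF_quad_cost_finite[OF \<nu> \<rho>], of ?B] e by auto
  obtain \<theta> where \<theta>: "\<theta> \<in> couplings \<mu> \<rho>" "quad_cost dist \<theta> \<le> ennreal ((?A + ?B + e / 3)\<^sup>2)"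
    by (rule approximate_gluing[OF prob2D(2)[OF \<mu>] prob2D(2)[OF \<nu>] prob2D(2)[OF \<rho>] prob2D(1)[OF \<nu>]
          1(1) less_imp_le[OF 1(2)] 2(1) less_imp_le[OF 2(2)] pos])
  have "w2 \<mu> \<rho> \<le> ?A + ?B + e / 3" using pos by (intro wasserstein2_le[OF \<theta>]) linarith
  then show "w2 \<mu> \<rho> \<le> w2 \<mu> \<nu> + w2 \<nu> \<rho> + e" by simp
qed

section \<open>Plans with rational weights\<close>

text \<open>A list of rationals stands for a finite matrix, indexed through \<open>prod_decode\<close>: its \<open>i\<close>-th entry is the
  mass to be moved from the cell \<open>A (ci i)\<close> to the cell \<open>A (cj i)\<close>. The plan spreads every entry
  proportionally to the product measure and couples the remaining mass \<open>slack\<close> independently.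
  Admissibility forces the entries of null cells to vanish, so divisions by zero are harmless.\<close>

definition ci :: "nat \<Rightarrow> nat" where "ci i = fst (prod_decode i)"
definition cj :: "nat \<Rightarrow> nat" where "cj i = snd (prod_decode i)"

definition wt :: "rat list \<Rightarrow> nat \<Rightarrow> real" where "wt xs i = real_of_rat (xs ! i)"

definition slack :: "rat list \<Rightarrow> real" where "slack xs = 1 - (\<Sum>i<length xs. wt xs i)"

text \<open>The fraction of the mass at \<open>x\<close> that the matrix leaves unassigned; for
  admissible weights its integral is \<open>slack xs\<close>.\<close>

definition resid :: "(nat \<Rightarrow> 'a set) \<Rightarrow> (nat \<Rightarrow> nat) \<Rightarrow> rat list \<Rightarrow> 'a measure \<Rightarrow> 'a \<Rightarrow> real" where
  "resid A c xs \<mu> x = 1 - (\<Sum>i<length xs. wt xs i / measure \<mu> (A (c i)) * indicator (A (c i)) x)"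

text \<open>With \<open>c = ci\<close> a condition on row sums, with \<open>c = cj\<close> on column
  sums. The measure enters through its masses of cells only, which makes this a measurable condition
  on the measure.\<close>

definition admissible :: "(nat \<Rightarrow> 'a set) \<Rightarrow> (nat \<Rightarrow> nat) \<Rightarrow> rat list \<Rightarrow> 'a measure \<Rightarrow> bool" where
  "admissible A c xs \<mu> \<longleftrightarrow> (\<forall>k. (\<Sum>i<length xs. if c i = k then wt xs i else 0) \<le> measure \<mu> (A k))"

text \<open>In \<open>plan_density\<close> the product of the two residuals, each of total mass
  \<open>slack xs\<close>, is divided by the slack, which is therefore kept strictly
  positive.\<close>

definition plan_weights :: "rat list \<Rightarrow> bool" where
  "plan_weights xs \<longleftrightarrow> (\<forall>i<length xs. 0 \<le> xs ! i) \<and> 0 < slack xs"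

definition plan_density :: "(nat \<Rightarrow> 'a set) \<Rightarrow> rat list \<Rightarrow> 'a measure \<Rightarrow> 'a measure \<Rightarrow> 'a \<times> 'a \<Rightarrow> real" where
  "plan_density A xs \<mu> \<nu> z =
     (\<Sum>i<length xs. wt xs i / (measure \<mu> (A (ci i)) * measure \<nu> (A (cj i)))
        * indicator (A (ci i)) (fst z) * indicator (A (cj i)) (snd z))
     + resid A ci xs \<mu> (fst z) * resid A cj xs \<nu> (snd z) / slack xs"

abbreviation plan_measure :: "(nat \<Rightarrow> 'a set) \<Rightarrow> rat list \<Rightarrow> 'a measure \<Rightarrow> 'a measure \<Rightarrow> ('a \<times> 'a) measure" where
  "plan_measure A xs \<mu> \<nu> \<equiv> density (\<mu> \<Otimes>\<^sub>M \<nu>) (\<lambda>z. ennreal (plan_density A xs \<mu> \<nu> z))"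

lemma wt_nonneg: "plan_weights xs \<Longrightarrow> i < length xs \<Longrightarrow> 0 \<le> wt xs i"
  by (simp add: plan_weights_def wt_def)

locale cell_weights =
  fixes A :: "nat \<Rightarrow> 'a set" and xs :: "rat list"
  assumes disj: "disjoint_family A" and xs: "plan_weights xs"

locale admissible_weights = cell_weights A xs + prob_space \<mu>
  for A :: "nat \<Rightarrow> 'a set" and xs and \<mu> :: "'a measure" +
  fixes c :: "nat \<Rightarrow> nat"
  assumes A_sets: "A k \<in> sets \<mu>" and adm: "admissible A c xs \<mu>"
begin

lemma wt_le: "i < length xs \<Longrightarrow> wt xs i \<le> measure \<mu> (A (c i))"
proof -
  assume i: "i < length xs"
  have "wt xs i = (if c i = c i then wt xs i else 0)" by simp
  also have "\<dots> \<le> (\<Sum>j<length xs. if c j = c i then wt xs j else 0)"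
    using i wt_nonneg[OF xs] by (intro member_le_sum) auto
  also have "\<dots> \<le> measure \<mu> (A (c i))" using adm by (simp add: admissible_def)
  finally show ?thesis .
qed

lemma wt_cancel: "i < length xs \<Longrightarrow> wt xs i / measure \<mu> (A (c i)) * measure \<mu> (A (c i)) = wt xs i"
  using wt_le[of i] wt_nonneg[OF xs, of i] by auto

lemma resid_bounds: "0 \<le> resid A c xs \<mu> x" "resid A c xs \<mu> x \<le> 1"
proof -
  have "0 \<le> (\<Sum>i<length xs. wt xs i / measure \<mu> (A (c i)) * indicator (A (c i)) x)"
    using wt_nonneg[OF xs] by (intro sum_nonneg) auto
  then show "resid A c xs \<mu> x \<le> 1" by (simp add: resid_def)
  have "(\<Sum>i<length xs. wt xs i / measure \<mu> (A (c i)) * indicator (A (c i)) x) \<le> 1"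
  proof (cases "\<exists>k. x \<in> A k")
    case True
    then obtain k where k: "x \<in> A k" by blast
    then have "x \<in> A j \<longleftrightarrow> j = k" for j using disj by (auto simp: disjoint_family_on_def)
    then have "(\<Sum>i<length xs. wt xs i / measure \<mu> (A (c i)) * indicator (A (c i)) x)
        = (\<Sum>i<length xs. (if c i = k then wt xs i else 0) / measure \<mu> (A k))"
      by (intro sum.cong) auto
    also have "\<dots> = (\<Sum>i<length xs. if c i = k then wt xs i else 0) / measure \<mu> (A k)"
      by (rule sum_divide_distrib[symmetric])
    also have "\<dots> \<le> 1"
    proof (cases "measure \<mu> (A k) = 0")
      case False
      then have "0 < measure \<mu> (A k)" by (simp add: zero_less_measure_iff)
      then show ?thesis using adm by (simp add: admissible_def)
    qed simp
    finally show ?thesis .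
  next
    case False
    then show ?thesis by simp
  qed
  then show "0 \<le> resid A c xs \<mu> x" by (simp add: resid_def)
qed

lemma resid_measurable: "resid A c xs \<mu> \<in> borel_measurable \<mu>"
  unfolding resid_def
  by (intro borel_measurable_diff borel_measurable_const borel_measurable_sum borel_measurable_times borel_measurable_indicator A_sets)

lemma integrable_resid: "integrable \<mu> (resid A c xs \<mu>)"
  using resid_bounds resid_measurable by (intro integrable_const_bound[where B = 1]) auto

lemma integral_resid: "integral\<^sup>L \<mu> (resid A c xs \<mu>) = slack xs"
proof -
  have i: "integrable \<mu> (indicator (A k) :: 'a \<Rightarrow> real)" for k
    using A_sets by (intro integrable_real_indicator) (auto simp: less_top[symmetric])
  have "integral\<^sup>L \<mu> (resid A c xs \<mu>) = 1 - (\<Sum>i<length xs. wt xs i / measure \<mu> (A (c i)) * measure \<mu> (A (c i)))"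
    unfolding resid_def using A_sets
    by (subst Bochner_Integration.integral_diff) (auto simp: prob_space Bochner_Integration.integral_sum i sets.Int_space_eq2)
  also have "\<dots> = slack xs" unfolding slack_def using wt_cancel by simp
  finally show ?thesis .
qed

lemma nn_integral_resid: "(\<integral>\<^sup>+x. ennreal (resid A c xs \<mu> x) \<partial>\<mu>) = ennreal (slack xs)"
  using resid_bounds by (subst nn_integral_eq_integral[OF integrable_resid]) (auto simp: integral_resid)

text \<open>Where \<open>f\<close> exceeds \<open>K\<close> the residual is bounded by 1, elsewhere
  \<open>f\<close> is bounded by \<open>K\<close>. For the squared distance this makes the cost of
  the independently coupled rest small once the tail and then the slack are small.\<close>

lemma nn_integral_resid_mult:
  assumes f: "f \<in> borel_measurable \<mu>"
  shows "(\<integral>\<^sup>+x. ennreal (resid A c xs \<mu> x) * f x \<partial>\<mu>)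
    \<le> (\<integral>\<^sup>+x. f x * indicator {x. ennreal K < f x} x \<partial>\<mu>) + ennreal K * ennreal (slack xs)"
proof -
  have m: "(\<lambda>x. f x * indicator {x. ennreal K < f x} x) \<in> borel_measurable \<mu>"
  proof -
    have "(\<lambda>x. if ennreal K < f x then f x else 0) \<in> borel_measurable \<mu>"
      using f by measurable
    moreover have "(\<lambda>x. f x * indicator {x. ennreal K < f x} x) = (\<lambda>x. if ennreal K < f x then f x else 0)"
      by (auto split: split_indicator)
    ultimately show ?thesis by (simp only:)
  qed
  have "(\<integral>\<^sup>+x. ennreal (resid A c xs \<mu> x) * f x \<partial>\<mu>)
    \<le> (\<integral>\<^sup>+x. f x * indicator {x. ennreal K < f x} x + ennreal K * ennreal (resid A c xs \<mu> x) \<partial>\<mu>)"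
  proof (rule nn_integral_mono)
    fix x
    have r: "ennreal (resid A c xs \<mu> x) \<le> 1"
      using ennreal_leI[OF resid_bounds(2)[of x]] by simp
    show "ennreal (resid A c xs \<mu> x) * f x \<le> f x * indicator {x. ennreal K < f x} x + ennreal K * ennreal (resid A c xs \<mu> x)"
    proof (cases "ennreal K < f x")
      case True
      have "ennreal (resid A c xs \<mu> x) * f x \<le> 1 * f x" by (intro mult_right_mono r) simp
      then show ?thesis using True by (simp add: add_increasing2)
    next
      case False
      then have "ennreal (resid A c xs \<mu> x) * f x \<le> ennreal (resid A c xs \<mu> x) * ennreal K"
        by (intro mult_left_mono) auto
      then show ?thesis using False by (simp add: mult.commute)
    qed
  qed
  also have "\<dots> = (\<integral>\<^sup>+x. f x * indicator {x. ennreal K < f x} x \<partial>\<mu>) + ennreal K * ennreal (slack xs)"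
    using m resid_measurable by (subst nn_integral_add) (auto simp: nn_integral_cmult nn_integral_resid)
  finally show ?thesis .
qed

end

locale admissible_plan = \<mu>: admissible_weights A xs \<mu> ci + \<nu>: admissible_weights A xs \<nu> cj
  for A :: "nat \<Rightarrow> 'a set" and xs \<mu> \<nu>
begin

abbreviation "f \<equiv> plan_density A xs \<mu> \<nu>"
abbreviation "u \<equiv> resid A ci xs \<mu>"
abbreviation "v \<equiv> resid A cj xs \<nu>"

lemma slack_pos: "0 < slack xs" using \<mu>.xs by (simp add: plan_weights_def)

lemma coeff_nonneg:
  "i < length xs \<Longrightarrow> 0 \<le> wt xs i / (measure \<mu> (A (ci i)) * measure \<nu> (A (cj i)))"
  using wt_nonneg[OF \<mu>.xs] by simp

lemma plan_density_nonneg: "0 \<le> f z"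
proof -
  have "0 \<le> (\<Sum>i<length xs. wt xs i / (measure \<mu> (A (ci i)) * measure \<nu> (A (cj i)))
        * indicator (A (ci i)) (fst z) * indicator (A (cj i)) (snd z))"
    by (intro sum_nonneg mult_nonneg_nonneg[OF mult_nonneg_nonneg[OF coeff_nonneg]]) auto
  moreover have "0 \<le> u (fst z) * v (snd z) / slack xs"
    by (intro divide_nonneg_pos mult_nonneg_nonneg \<mu>.resid_bounds \<nu>.resid_bounds slack_pos)
  ultimately show ?thesis unfolding plan_density_def by simp
qed

lemma measurable_u: "(\<lambda>z. u (fst z)) \<in> borel_measurable (\<mu> \<Otimes>\<^sub>M \<nu>)"
  by (rule measurable_compose[OF measurable_fst \<mu>.resid_measurable])

lemma measurable_v: "(\<lambda>z. v (snd z)) \<in> borel_measurable (\<mu> \<Otimes>\<^sub>M \<nu>)"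
  by (rule measurable_compose[OF measurable_snd \<nu>.resid_measurable])

lemma measurable_ind_fst: "(\<lambda>z. indicator (A k) (fst z) :: real) \<in> borel_measurable (\<mu> \<Otimes>\<^sub>M \<nu>)"
  by (rule measurable_compose[OF measurable_fst borel_measurable_indicator[OF \<mu>.A_sets]])

lemma measurable_ind_snd: "(\<lambda>z. indicator (A k) (snd z) :: real) \<in> borel_measurable (\<mu> \<Otimes>\<^sub>M \<nu>)"
  by (rule measurable_compose[OF measurable_snd borel_measurable_indicator[OF \<nu>.A_sets]])

lemma measurable_plan_density: "f \<in> borel_measurable (\<mu> \<Otimes>\<^sub>M \<nu>)"
  unfolding plan_density_def
  by (intro borel_measurable_add borel_measurable_sum borel_measurable_times borel_measurable_divide borel_measurable_const
      measurable_u measurable_v measurable_ind_fst measurable_ind_snd)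

text \<open>Integrating out \<open>y\<close> leaves the assigned fraction at \<open>x\<close> plus
  the residual, and \<open>resid\<close> is defined so that these add up to 1. In the last summand
  of the density the slack cancels.\<close>

lemma integral_snd: "(\<integral>\<^sup>+y. ennreal (f (x, y)) \<partial>\<nu>) = 1"
proof -
  have i: "integrable \<nu> (indicator (A k) :: 'a \<Rightarrow> real)" for k
    using \<nu>.A_sets by (intro integrable_real_indicator) (auto simp: less_top[symmetric])
  let ?c = "\<lambda>i. wt xs i / (measure \<mu> (A (ci i)) * measure \<nu> (A (cj i))) * indicator (A (ci i)) x"
  have int: "integrable \<nu> (\<lambda>y. \<Sum>i<length xs. ?c i * indicator (A (cj i)) y)"
    by (intro Bochner_Integration.integrable_sum integrable_mult_right i)
  have int': "integrable \<nu> (\<lambda>y. u x * v y / slack xs)"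
    by (intro integrable_divide integrable_mult_right \<nu>.integrable_resid)
  have "(\<integral>y. f (x, y) \<partial>\<nu>) = (\<Sum>i<length xs. ?c i * measure \<nu> (A (cj i))) + u x * slack xs / slack xs"
    unfolding plan_density_def fst_conv snd_conv
    by (subst Bochner_Integration.integral_add[OF int int'])
       (simp add: Bochner_Integration.integral_sum i \<nu>.integral_resid sets.Int_space_eq2 \<nu>.A_sets)
  also have "\<dots> = (\<Sum>i<length xs. wt xs i / measure \<mu> (A (ci i)) * indicator (A (ci i)) x) + u x"
  proof -
    have "?c i * measure \<nu> (A (cj i)) = wt xs i / measure \<mu> (A (ci i)) * indicator (A (ci i)) x" if "i < length xs" for i
    proof -
      have "?c i * measure \<nu> (A (cj i)) = wt xs i / measure \<nu> (A (cj i)) * measure \<nu> (A (cj i)) / measure \<mu> (A (ci i)) * indicator (A (ci i)) x"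
        by (simp add: field_simps)
      then show ?thesis by (simp only: \<nu>.wt_cancel[OF that])
    qed
    then show ?thesis using slack_pos by simp
  qed
  also have "\<dots> = 1" by (simp add: resid_def)
  finally have eq: "(\<integral>y. f (x, y) \<partial>\<nu>) = 1" .
  have "integrable \<nu> (\<lambda>y. f (x, y))"
    unfolding plan_density_def fst_conv snd_conv by (rule Bochner_Integration.integrable_add[OF int int'])
  from nn_integral_eq_integral[OF this] show ?thesis using plan_density_nonneg by (simp add: eq)
qed

lemma integral_fst: "(\<integral>\<^sup>+x. ennreal (f (x, y)) \<partial>\<mu>) = 1"
proof -
  have i: "integrable \<mu> (indicator (A k) :: 'a \<Rightarrow> real)" for k
    using \<mu>.A_sets by (intro integrable_real_indicator) (auto simp: less_top[symmetric])
  let ?c = "\<lambda>i. wt xs i / (measure \<mu> (A (ci i)) * measure \<nu> (A (cj i))) * indicator (A (cj i)) y"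
  have f_eq: "f (x, y) = (\<Sum>i<length xs. ?c i * indicator (A (ci i)) x) + u x * v y / slack xs" for x
    unfolding plan_density_def fst_conv snd_conv by (simp only: mult.commute mult.left_commute)
  have int: "integrable \<mu> (\<lambda>x. \<Sum>i<length xs. ?c i * indicator (A (ci i)) x)"
    by (intro Bochner_Integration.integrable_sum integrable_mult_right i)
  have int': "integrable \<mu> (\<lambda>x. u x * v y / slack xs)"
    by (intro integrable_divide integrable_mult_left \<mu>.integrable_resid)
  have "(\<integral>x. f (x, y) \<partial>\<mu>) = (\<Sum>i<length xs. ?c i * measure \<mu> (A (ci i))) + slack xs * v y / slack xs"
    unfolding f_eq
    by (subst Bochner_Integration.integral_add[OF int int'])
       (simp add: Bochner_Integration.integral_sum i \<mu>.integral_resid sets.Int_space_eq2 \<mu>.A_sets)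
  also have "\<dots> = (\<Sum>i<length xs. wt xs i / measure \<nu> (A (cj i)) * indicator (A (cj i)) y) + v y"
  proof -
    have "?c i * measure \<mu> (A (ci i)) = wt xs i / measure \<nu> (A (cj i)) * indicator (A (cj i)) y" if "i < length xs" for i
    proof -
      have "?c i * measure \<mu> (A (ci i)) = wt xs i / measure \<mu> (A (ci i)) * measure \<mu> (A (ci i)) / measure \<nu> (A (cj i)) * indicator (A (cj i)) y"
        by (simp add: field_simps)
      then show ?thesis by (simp only: \<mu>.wt_cancel[OF that])
    qed
    then show ?thesis using slack_pos by simp
  qed
  also have "\<dots> = 1" by (simp add: resid_def)
  finally have eq: "(\<integral>x. f (x, y) \<partial>\<mu>) = 1" .
  have "integrable \<mu> (\<lambda>x. f (x, y))"
    unfolding f_eq by (rule Bochner_Integration.integrable_add[OF int int'])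
  from nn_integral_eq_integral[OF this] show ?thesis using plan_density_nonneg by (simp add: eq)
qed

lemma plan_coupling: "density (\<mu> \<Otimes>\<^sub>M \<nu>) (\<lambda>z. ennreal (f z)) \<in> couplings \<mu> \<nu>"
  by (intro density_couplings \<mu>.prob_space_axioms \<nu>.prob_space_axioms measurable_compose[OF measurable_plan_density measurable_ennreal])
     (simp_all add: integral_fst integral_snd)

lemma product_integral:
  assumes F: "F \<in> borel_measurable \<mu>" and G: "G \<in> borel_measurable \<nu>"
  shows "(\<integral>\<^sup>+z. F (fst z) * G (snd z) \<partial>(\<mu> \<Otimes>\<^sub>M \<nu>)) = (\<integral>\<^sup>+x. F x \<partial>\<mu>) * (\<integral>\<^sup>+y. G y \<partial>\<nu>)"
proof -
  have "(\<lambda>z. F (fst z) * G (snd z)) \<in> borel_measurable (\<mu> \<Otimes>\<^sub>M \<nu>)"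
    by (intro borel_measurable_times_ennreal measurable_compose[OF measurable_fst F] measurable_compose[OF measurable_snd G])
  from \<nu>.nn_integral_fst[OF this, symmetric] show ?thesis
    unfolding fst_conv snd_conv using F G by (simp add: nn_integral_cmult nn_integral_multc)
qed

lemma product_integral_fst:
  assumes h: "h \<in> borel_measurable \<mu>"
  shows "(\<integral>\<^sup>+z. ennreal (u (fst z)) * ennreal (v (snd z)) * h (fst z) \<partial>(\<mu> \<Otimes>\<^sub>M \<nu>))
    = (\<integral>\<^sup>+x. ennreal (u x) * h x \<partial>\<mu>) * ennreal (slack xs)"
  using product_integral[of "\<lambda>x. ennreal (u x) * h x" "\<lambda>y. ennreal (v y)"] h
    measurable_compose[OF \<mu>.resid_measurable measurable_ennreal] measurable_compose[OF \<nu>.resid_measurable measurable_ennreal]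
  by (simp add: \<nu>.nn_integral_resid mult.assoc mult.commute[of "h _"])

lemma product_integral_snd:
  assumes h: "h \<in> borel_measurable \<nu>"
  shows "(\<integral>\<^sup>+z. ennreal (u (fst z)) * ennreal (v (snd z)) * h (snd z) \<partial>(\<mu> \<Otimes>\<^sub>M \<nu>))
    = ennreal (slack xs) * (\<integral>\<^sup>+y. ennreal (v y) * h y \<partial>\<nu>)"
  using product_integral[of "\<lambda>x. ennreal (u x)" "\<lambda>y. ennreal (v y) * h y"] h
    measurable_compose[OF \<mu>.resid_measurable measurable_ennreal] measurable_compose[OF \<nu>.resid_measurable measurable_ennreal]
  by (simp add: \<mu>.nn_integral_resid mult.assoc)

end

text \<open>On the rectangles the squared distance is at most \<open>cc\<close>. On the independent
  part it is bounded through the base point \<open>x0\<close>, and the factor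
  \<open>1 / slack xs\<close> is cancelled by integrating the residual of the other side.\<close>

lemma plan_cost:
  fixes \<mu> \<nu> :: "'a::{metric_space, second_countable_topology} measure"
  assumes "admissible_plan A xs \<mu> \<nu>" and s: "sets \<mu> = sets borel" "sets \<nu> = sets borel"
    and cc: "\<And>i x y. i < length xs \<Longrightarrow> x \<in> A (ci i) \<Longrightarrow> y \<in> A (cj i) \<Longrightarrow> (dist x y)\<^sup>2 \<le> cc i"
    and cc0: "\<And>i. 0 \<le> cc i"
  shows "quad_cost dist (plan_measure A xs \<mu> \<nu>)
    \<le> ennreal (\<Sum>i<length xs. wt xs i * cc i)
      + (2 * (\<integral>\<^sup>+x. ennreal (resid A ci xs \<mu> x) * ennreal ((dist x0 x)\<^sup>2) \<partial>\<mu>)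
        + 2 * (\<integral>\<^sup>+y. ennreal (resid A cj xs \<nu> y) * ennreal ((dist x0 y)\<^sup>2) \<partial>\<nu>))"
proof -
  interpret admissible_plan A xs \<mu> \<nu> by fact
  note [measurable_cong] = s
  let ?k = "\<lambda>i. wt xs i / (measure \<mu> (A (ci i)) * measure \<nu> (A (cj i)))"
  let ?R = "\<lambda>i. A (ci i) \<times> A (cj i)"
  let ?h = "\<lambda>x. ennreal ((dist x0 x)\<^sup>2)"
  let ?U = "\<lambda>z. ennreal (u (fst z)) * ennreal (v (snd z)) * ?h (fst z)"
  let ?V = "\<lambda>z. ennreal (u (fst z)) * ennreal (v (snd z)) * ?h (snd z)"
  have h: "?h \<in> borel_measurable \<mu>" "?h \<in> borel_measurable \<nu>" by measurable
  have d: "(\<lambda>z. ennreal ((dist (fst z) (snd z))\<^sup>2)) \<in> borel_measurable (\<mu> \<Otimes>\<^sub>M \<nu>)" by measurable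
  have fm: "(\<lambda>z. ennreal (f z)) \<in> borel_measurable (\<mu> \<Otimes>\<^sub>M \<nu>)"
    by (rule measurable_compose[OF measurable_plan_density measurable_ennreal])
  have um: "(\<lambda>z. ennreal (u (fst z))) \<in> borel_measurable (\<mu> \<Otimes>\<^sub>M \<nu>)" and vm: "(\<lambda>z. ennreal (v (snd z))) \<in> borel_measurable (\<mu> \<Otimes>\<^sub>M \<nu>)"
    by (rule measurable_compose[OF measurable_u measurable_ennreal] measurable_compose[OF measurable_v measurable_ennreal])+
  have Um: "?U \<in> borel_measurable (\<mu> \<Otimes>\<^sub>M \<nu>)" and Vm: "?V \<in> borel_measurable (\<mu> \<Otimes>\<^sub>M \<nu>)"
    by (intro borel_measurable_times_ennreal um vm measurable_compose[OF measurable_fst h(1)] measurable_compose[OF measurable_snd h(2)])+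
  have R: "?R i \<in> sets (\<mu> \<Otimes>\<^sub>M \<nu>)" for i using \<mu>.A_sets \<nu>.A_sets by simp
  have UVm: "(\<lambda>z. ennreal (1 / slack xs) * (2 * ?U z + 2 * ?V z)) \<in> borel_measurable (\<mu> \<Otimes>\<^sub>M \<nu>)"
    by (rule borel_measurable_times_ennreal[OF borel_measurable_const borel_measurable_add[OF
          borel_measurable_times_ennreal[OF borel_measurable_const Um] borel_measurable_times_ennreal[OF borel_measurable_const Vm]]])
  have SM: "(\<lambda>z. \<Sum>i<length xs. ennreal (?k i * cc i) * indicator (?R i) z) \<in> borel_measurable (\<mu> \<Otimes>\<^sub>M \<nu>)"
    by (rule borel_measurable_sum, rule borel_measurable_times_ennreal[OF borel_measurable_const borel_measurable_indicator[OF R]])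
  have pointwise: "ennreal (f z) * ennreal ((dist (fst z) (snd z))\<^sup>2)
      \<le> (\<Sum>i<length xs. ennreal (?k i * cc i) * indicator (?R i) z) + ennreal (1 / slack xs) * (2 * ?U z + 2 * ?V z)" for z
  proof -
    obtain x y where z: "z = (x, y)" by (cases z)
    let ?a = "(dist x0 x)\<^sup>2" and ?b = "(dist x0 y)\<^sup>2"
    have dab: "(dist x y)\<^sup>2 \<le> 2 * ?a + 2 * ?b"
    proof -
      have "(dist x y)\<^sup>2 \<le> (dist x0 x + dist x0 y)\<^sup>2" by (intro power_mono dist_triangle3) simp
      also have "\<dots> \<le> 2 * ?a + 2 * ?b"
        using zero_le_power2[of "dist x0 x - dist x0 y"] by (simp add: power2_eq_square algebra_simps)
      finally show ?thesis .
    qed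
    have coeff': "0 \<le> ?k i * (indicator (?R i) z * cc i)" if "i \<in> {..<length xs}" for i
      using that by (intro mult_nonneg_nonneg[OF coeff_nonneg] mult_nonneg_nonneg cc0) auto
    have S: "(\<Sum>i<length xs. ennreal (?k i * (indicator (?R i) z * cc i))) = ennreal (\<Sum>i<length xs. ?k i * (indicator (?R i) z * cc i))"
      by (rule sum_ennreal) (rule coeff')
    have uv: "0 \<le> u x * v y" by (intro mult_nonneg_nonneg \<mu>.resid_bounds \<nu>.resid_bounds)
    have "f z * (dist x y)\<^sup>2 = (\<Sum>i<length xs. ?k i * (indicator (?R i) z * (dist x y)\<^sup>2)) + 1 / slack xs * ((u x * v y) * (dist x y)\<^sup>2)"
      by (simp add: z plan_density_def distrib_right sum_distrib_right indicator_times mult.assoc)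
    also have "\<dots> \<le> (\<Sum>i<length xs. ?k i * (indicator (?R i) z * cc i)) + 1 / slack xs * ((u x * v y) * (2 * ?a + 2 * ?b))"
    proof (rule add_mono)
      have "indicator (?R i) z * (dist x y)\<^sup>2 \<le> indicator (?R i) z * cc i" if "i < length xs" for i
        using cc[OF that, of x y] by (auto simp: z split: split_indicator)
      then show "(\<Sum>i<length xs. ?k i * (indicator (?R i) z * (dist x y)\<^sup>2)) \<le> (\<Sum>i<length xs. ?k i * (indicator (?R i) z * cc i))"
        using coeff_nonneg by (intro sum_mono mult_left_mono[of "indicator (?R _) z * (dist x y)\<^sup>2"]) auto
      show "1 / slack xs * ((u x * v y) * (dist x y)\<^sup>2) \<le> 1 / slack xs * ((u x * v y) * (2 * ?a + 2 * ?b))"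
        using slack_pos by (intro mult_left_mono dab uv) auto
    qed
    finally have "ennreal (f z * (dist x y)\<^sup>2) \<le> ennreal ((\<Sum>i<length xs. ?k i * (indicator (?R i) z * cc i)) + 1 / slack xs * ((u x * v y) * (2 * ?a + 2 * ?b)))"
      by (rule ennreal_leI)
    also have "\<dots> = (\<Sum>i<length xs. ennreal (?k i * (indicator (?R i) z * cc i))) + ennreal (1 / slack xs * ((u x * v y) * (2 * ?a + 2 * ?b)))"
    proof (subst ennreal_plus)
      show "0 \<le> (\<Sum>i<length xs. ?k i * (indicator (?R i) z * cc i))"
        using coeff_nonneg cc0 by (intro sum_nonneg mult_nonneg_nonneg) auto
      show "0 \<le> 1 / slack xs * ((u x * v y) * (2 * ?a + 2 * ?b))"
        using slack_pos uv by (intro mult_nonneg_nonneg[OF _ mult_nonneg_nonneg[OF uv]]) auto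
      show "ennreal (\<Sum>i<length xs. ?k i * (indicator (?R i) z * cc i)) + ennreal (1 / slack xs * ((u x * v y) * (2 * ?a + 2 * ?b)))
        = (\<Sum>i<length xs. ennreal (?k i * (indicator (?R i) z * cc i))) + ennreal (1 / slack xs * ((u x * v y) * (2 * ?a + 2 * ?b)))"
        unfolding S ..
    qed
    also have "(\<Sum>i<length xs. ennreal (?k i * (indicator (?R i) z * cc i))) = (\<Sum>i<length xs. ennreal (?k i * cc i) * indicator (?R i) z)"
      by (intro sum.cong) (auto split: split_indicator)
    also have "ennreal (1 / slack xs * ((u x * v y) * (2 * ?a + 2 * ?b))) = ennreal (1 / slack xs) * (2 * ?U z + 2 * ?V z)"
    proof -
      have "ennreal ((u x * v y) * (2 * ?a + 2 * ?b)) = ennreal (u x) * ennreal (v y) * (2 * ennreal ?a + 2 * ennreal ?b)"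
        using \<mu>.resid_bounds \<nu>.resid_bounds by (simp add: ennreal_mult ennreal_plus)
      also have "\<dots> = 2 * ?U z + 2 * ?V z"
        by (simp add: z distrib_left mult.assoc mult.left_commute)
      finally show ?thesis using slack_pos uv by (subst ennreal_mult) auto
    qed
    finally show ?thesis
      using plan_density_nonneg by (simp add: z ennreal_mult)
  qed
  have "quad_cost dist (density (\<mu> \<Otimes>\<^sub>M \<nu>) (\<lambda>z. ennreal (f z))) = (\<integral>\<^sup>+z. ennreal (f z) * ennreal ((dist (fst z) (snd z))\<^sup>2) \<partial>(\<mu> \<Otimes>\<^sub>M \<nu>))"
    unfolding quad_cost_eq by (rule nn_integral_density[OF fm d])
  also have "\<dots> \<le> (\<integral>\<^sup>+z. (\<Sum>i<length xs. ennreal (?k i * cc i) * indicator (?R i) z) + ennreal (1 / slack xs) * (2 * ?U z + 2 * ?V z) \<partial>(\<mu> \<Otimes>\<^sub>M \<nu>))"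
    by (intro nn_integral_mono pointwise)
  also have "\<dots> = (\<integral>\<^sup>+z. (\<Sum>i<length xs. ennreal (?k i * cc i) * indicator (?R i) z) \<partial>(\<mu> \<Otimes>\<^sub>M \<nu>))
      + (\<integral>\<^sup>+z. ennreal (1 / slack xs) * (2 * ?U z + 2 * ?V z) \<partial>(\<mu> \<Otimes>\<^sub>M \<nu>))"
    by (rule nn_integral_add[OF SM UVm])
  also have "(\<integral>\<^sup>+z. (\<Sum>i<length xs. ennreal (?k i * cc i) * indicator (?R i) z) \<partial>(\<mu> \<Otimes>\<^sub>M \<nu>)) = ennreal (\<Sum>i<length xs. wt xs i * cc i)"
  proof -
    have "(\<integral>\<^sup>+z. (\<Sum>i<length xs. ennreal (?k i * cc i) * indicator (?R i) z) \<partial>(\<mu> \<Otimes>\<^sub>M \<nu>)) = (\<Sum>i<length xs. \<integral>\<^sup>+z. ennreal (?k i * cc i) * indicator (?R i) z \<partial>(\<mu> \<Otimes>\<^sub>M \<nu>))"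
      by (intro nn_integral_sum borel_measurable_times_ennreal borel_measurable_const borel_measurable_indicator R)
    also have "\<dots> = (\<Sum>i<length xs. ennreal (wt xs i * cc i))"
    proof (intro sum.cong refl)
      fix i assume i: "i \<in> {..<length xs}"
      have kc: "0 \<le> ?k i * cc i"
        using i by (intro mult_nonneg_nonneg[OF coeff_nonneg cc0]) simp
      have "(\<integral>\<^sup>+z. ennreal (?k i * cc i) * indicator (?R i) z \<partial>(\<mu> \<Otimes>\<^sub>M \<nu>)) = ennreal (?k i * cc i) * (ennreal (measure \<mu> (A (ci i))) * ennreal (measure \<nu> (A (cj i))))"
        by (subst nn_integral_cmult_indicator[OF R])
           (simp add: \<nu>.emeasure_pair_measure_Times \<mu>.A_sets \<nu>.A_sets \<mu>.emeasure_eq_measure \<nu>.emeasure_eq_measure)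
      also have "\<dots> = ennreal (?k i * cc i * (measure \<mu> (A (ci i)) * measure \<nu> (A (cj i))))"
        by (simp only: ennreal_mult[symmetric] measure_nonneg mult_nonneg_nonneg[OF measure_nonneg measure_nonneg] kc)
      \<comment> \<open>If a cell has no mass then the weight vanishes as well, so both sides are
        0.\<close>
      also have "?k i * cc i * (measure \<mu> (A (ci i)) * measure \<nu> (A (cj i))) = wt xs i * cc i"
        using \<mu>.wt_cancel[of i] \<nu>.wt_cancel[of i] i by (cases "measure \<mu> (A (ci i)) = 0"; cases "measure \<nu> (A (cj i)) = 0") auto
      finally show "(\<integral>\<^sup>+z. ennreal (?k i * cc i) * indicator (?R i) z \<partial>(\<mu> \<Otimes>\<^sub>M \<nu>)) = ennreal (wt xs i * cc i)" .
    qed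
    also have "\<dots> = ennreal (\<Sum>i<length xs. wt xs i * cc i)"
      using wt_nonneg[OF \<mu>.xs] cc0 by (intro sum_ennreal) auto
    finally show ?thesis .
  qed
  also have "(\<integral>\<^sup>+z. ennreal (1 / slack xs) * (2 * ?U z + 2 * ?V z) \<partial>(\<mu> \<Otimes>\<^sub>M \<nu>))
      = ennreal (1 / slack xs) * (2 * (\<integral>\<^sup>+z. ?U z \<partial>(\<mu> \<Otimes>\<^sub>M \<nu>)) + 2 * (\<integral>\<^sup>+z. ?V z \<partial>(\<mu> \<Otimes>\<^sub>M \<nu>)))"
    using Um Vm by (simp add: nn_integral_cmult nn_integral_add)
  also have "\<dots> = ennreal (1 / slack xs) * ennreal (slack xs) * (2 * (\<integral>\<^sup>+x. ennreal (u x) * ?h x \<partial>\<mu>) + 2 * (\<integral>\<^sup>+y. ennreal (v y) * ?h y \<partial>\<nu>))"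
    unfolding product_integral_fst[OF h(1)] product_integral_snd[OF h(2)]
    by (simp add: distrib_left mult.assoc mult.left_commute mult.commute)
  also have "ennreal (1 / slack xs) * ennreal (slack xs) = 1"
    using slack_pos by (simp add: ennreal_mult[symmetric])
  finally show ?thesis by simp
qed

text \<open>The part of the second moment outside the ball of radius \<open>sqrt K\<close> about
  \<open>x0\<close>; a natural number \<open>K\<close> keeps the set of parameters
  countable.\<close>

definition tail :: "'a::metric_space \<Rightarrow> nat \<Rightarrow> 'a measure \<Rightarrow> ennreal" where
  "tail x0 K \<mu> = (\<integral>\<^sup>+x. ennreal ((dist x0 x)\<^sup>2) * indicator {x. ennreal (real K) < ennreal ((dist x0 x)\<^sup>2)} x \<partial>\<mu>)"

lemma tail_integrand_measurable:
  "(\<lambda>x::'a::{metric_space, second_countable_topology}. ennreal ((dist x0 x)\<^sup>2) * indicator {x. ennreal (real K) < ennreal ((dist x0 x)\<^sup>2)} x) \<in> borel_measurable borel"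
proof -
  have "{x::'a. ennreal (real K) < ennreal ((dist x0 x)\<^sup>2)} \<in> sets borel" by measurable
  then show ?thesis by (intro borel_measurable_times_ennreal borel_measurable_indicator) measurable
qed

lemma tail_tendsto:
  fixes \<mu> :: "'a::{metric_space, second_countable_topology} measure"
  assumes "\<mu> \<in> prob2"
  shows "(\<lambda>K. tail x0 K \<mu>) \<longlonglongrightarrow> 0"
proof -
  note [measurable_cong] = prob2D(2)[OF assms]
  let ?h = "\<lambda>x. ennreal ((dist x0 x)\<^sup>2)"
  have "(\<lambda>K. \<integral>\<^sup>+x. ?h x * indicator {x. ennreal (real K) < ?h x} x \<partial>\<mu>) \<longlonglongrightarrow> (\<integral>\<^sup>+x. 0 \<partial>\<mu>)"
  proof (rule nn_integral_dominated_convergence[where w = ?h])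
    show "(\<lambda>x. ?h x * indicator {x. ennreal (real K) < ?h x} x) \<in> borel_measurable \<mu>" for K
      using tail_integrand_measurable by measurable
    show "(\<integral>\<^sup>+x. ?h x \<partial>\<mu>) < \<infinity>" by (rule prob2D(3)[OF assms])
    show "AE x in \<mu>. (\<lambda>K. ?h x * indicator {x. ennreal (real K) < ?h x} x) \<longlonglongrightarrow> 0"
    proof (rule AE_I2, rule tendsto_eventually)
      fix x
      obtain K0 :: nat where "(dist x0 x)\<^sup>2 \<le> real K0" using real_arch_simple by blast
      then have "?h x * indicator {x. ennreal (real K) < ?h x} x = 0" if "K \<ge> K0" for K
        using that by (auto simp: ennreal_less_iff split: split_indicator)
      then show "\<forall>\<^sub>F K in sequentially. ?h x * indicator {x. ennreal (real K) < ?h x} x = 0"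
        by (auto simp: eventually_sequentially)
    qed
  qed (auto split: split_indicator)
  then show ?thesis by (simp add: tail_def)
qed

text \<open>Each residual second moment is at most a tail plus \<open>K * slack xs\<close>, hence at
  most \<open>2 * \<delta>\<close>; both occur with factor 2 in \<open>plan_cost\<close>, which
  gives \<open>8 * \<delta>\<close>.\<close>

lemma plan_cost_tail:
  fixes \<mu> \<nu> :: "'a::{metric_space, second_countable_topology} measure"
  assumes plan: "admissible_plan A xs \<mu> \<nu>" and s: "sets \<mu> = sets borel" "sets \<nu> = sets borel"
    and cc: "\<And>i x y. i < length xs \<Longrightarrow> x \<in> A (ci i) \<Longrightarrow> y \<in> A (cj i) \<Longrightarrow> (dist x y)\<^sup>2 \<le> cc i"
      "\<And>i. 0 \<le> cc i"
    and E: "(\<Sum>i<length xs. wt xs i * cc i) \<le> E" and \<delta>: "0 \<le> \<delta>" "real K * slack xs \<le> \<delta>"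
    and t: "tail x0 K \<mu> \<le> ennreal \<delta>" "tail x0 K \<nu> \<le> ennreal \<delta>"
  shows "quad_cost dist (plan_measure A xs \<mu> \<nu>) \<le> ennreal (E + 8 * \<delta>)"
proof -
  interpret admissible_plan A xs \<mu> \<nu> by fact
  note [measurable_cong] = s
  let ?h = "\<lambda>x. ennreal ((dist x0 x)\<^sup>2)"
  have h: "?h \<in> borel_measurable \<mu>" "?h \<in> borel_measurable \<nu>" by measurable
  have Ks: "ennreal (real K) * ennreal (slack xs) \<le> ennreal \<delta>"
    using \<delta> slack_pos by (simp add: ennreal_mult[symmetric] ennreal_leI)
  have dd: "ennreal \<delta> + ennreal \<delta> = ennreal (2 * \<delta>)" using \<delta> by (simp add: ennreal_plus[symmetric] del: ennreal_plus)
  have 1: "(\<integral>\<^sup>+x. ennreal (u x) * ?h x \<partial>\<mu>) \<le> ennreal (2 * \<delta>)"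
    using \<mu>.nn_integral_resid_mult[OF h(1), of "real K"] add_mono[OF t(1) Ks] unfolding dd tail_def by (rule order_trans)
  have 2: "(\<integral>\<^sup>+x. ennreal (v x) * ?h x \<partial>\<nu>) \<le> ennreal (2 * \<delta>)"
    using \<nu>.nn_integral_resid_mult[OF h(2), of "real K"] add_mono[OF t(2) Ks] unfolding dd tail_def by (rule order_trans)
  have E0: "0 \<le> E" using E wt_nonneg[OF \<mu>.xs] cc(2) by (intro order_trans[OF _ E] sum_nonneg mult_nonneg_nonneg) auto
  have "quad_cost dist (density (\<mu> \<Otimes>\<^sub>M \<nu>) (\<lambda>z. ennreal (f z)))
    \<le> ennreal (\<Sum>i<length xs. wt xs i * cc i) + (2 * (\<integral>\<^sup>+x. ennreal (u x) * ?h x \<partial>\<mu>) + 2 * (\<integral>\<^sup>+x. ennreal (v x) * ?h x \<partial>\<nu>))"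
    by (rule plan_cost[OF plan s cc])
  also have "\<dots> \<le> ennreal E + (2 * ennreal (2 * \<delta>) + 2 * ennreal (2 * \<delta>))"
    by (intro add_mono mult_left_mono ennreal_leI E 1 2) auto
  also have "\<dots> = ennreal (E + 8 * \<delta>)"
  proof -
    have "2 * ennreal (2 * \<delta>) = ennreal (4 * \<delta>)" using \<delta> ennreal_mult[of 2 "2 * \<delta>"] by simp
    then show ?thesis using \<delta> E0 by (simp add: ennreal_plus[symmetric] del: ennreal_plus)
  qed
  finally show ?thesis .
qed

lemma admissible_planI:
  assumes "disjoint_family A" "plan_weights xs" "prob_space \<mu>" "prob_space \<nu>"
    and "\<And>k. A k \<in> sets \<mu>" "\<And>k. A k \<in> sets \<nu>" "admissible A ci xs \<mu>" "admissible A cj xs \<nu>"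
  shows "admissible_plan A xs \<mu> \<nu>"
  using assms
  by (intro admissible_plan.intro admissible_weights.intro cell_weights.intro admissible_weights_axioms.intro)

text \<open>The analogue of \<open>three_squares\<close> with one integrated summand. It accounts
  for replacing the distance by an upper bound on a rectangle of cells that is off by at most
  \<open>e\<close>.\<close>

lemma two_squares:
  fixes a e B :: real
  assumes "B > 0" "e > 0"
  shows "(a + e)\<^sup>2 \<le> (B + e) * (a\<^sup>2 / B + e)"
proof -
  have "(B + e) * (a\<^sup>2 / B + e) - (a + e)\<^sup>2 = e / B * (a - B)\<^sup>2"
    using assms by (simp add: field_simps power2_eq_square)
  also have "\<dots> \<ge> 0" using assms by simp
  finally show ?thesis by simp
qed

lemma diag_coupling:
  assumes "prob_space \<mu>"
  shows "distr \<mu> (\<mu> \<Otimes>\<^sub>M \<mu>) (\<lambda>x. (x, x)) \<in> couplings \<mu> \<mu>"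
proof -
  have m: "(\<lambda>x. (x, x)) \<in> \<mu> \<rightarrow>\<^sub>M \<mu> \<Otimes>\<^sub>M \<mu>" by measurable
  have "distr (distr \<mu> (\<mu> \<Otimes>\<^sub>M \<mu>) (\<lambda>x. (x, x))) \<mu> fst = distr \<mu> \<mu> (\<lambda>x. x)"
    "distr (distr \<mu> (\<mu> \<Otimes>\<^sub>M \<mu>) (\<lambda>x. (x, x))) \<mu> snd = distr \<mu> \<mu> (\<lambda>x. x)"
    by (simp_all add: distr_distr[OF measurable_fst m] distr_distr[OF measurable_snd m] o_def)
  then show ?thesis
    using prob_space.prob_space_distr[OF assms m] by (simp add: couplings_def distr_id2)
qed

text \<open>Rounding down keeps row and column sums admissible; strictness for positive
  \<open>q\<close> keeps some mass unassigned even if finitely many rectangles carry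
  everything.\<close>

lemma ex_rat_below:
  fixes q \<delta> :: real
  assumes "0 \<le> q" "0 < \<delta>"
  obtains \<rho> where "0 \<le> \<rho>" "real_of_rat \<rho> \<le> q" "q - \<delta> \<le> real_of_rat \<rho>" "0 < q \<Longrightarrow> real_of_rat \<rho> < q"
proof (cases "q = 0")
  case True
  then show ?thesis using that[of 0] assms by simp
next
  case False
  then have "max 0 (q - \<delta>) < q" using assms by auto
  then obtain \<rho> where \<rho>: "max 0 (q - \<delta>) < real_of_rat \<rho>" "real_of_rat \<rho> < q"
    using of_rat_dense by blast
  then have "0 < real_of_rat \<rho>" by simp
  then have "0 < \<rho>" by simp
  then show ?thesis using \<rho> by (intro that[of \<rho>]) auto
qed

section \<open>Weights extracted from a coupling\<close>

locale metric_cells = small_cells "borel :: 'a::{metric_space, second_countable_topology} measure" dist C for C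
begin

text \<open>By \<open>lower_bounds\<close> an upper bound for the squared distance on the rectangle
  with index \<open>i\<close>, off by a controlled amount; it depends on the cells and not on the
  measures.\<close>

definition mcost :: "nat \<Rightarrow> nat \<Rightarrow> real" where
  "mcost m i = (lower m (ci i) (cj i) + 4 * (1/2) ^ m)\<^sup>2"

lemma mcost_nonneg: "0 \<le> mcost m i" by (simp add: mcost_def)

lemma dist_sq_le_mcost: "x \<in> C m (ci i) \<Longrightarrow> y \<in> C m (cj i) \<Longrightarrow> (dist x y)\<^sup>2 \<le> mcost m i"
  using lower_bounds(2)[of x m "ci i" y "cj i"] by (auto simp: mcost_def intro!: power_mono)

lemma mcost_le: "x \<in> C m (ci i) \<Longrightarrow> y \<in> C m (cj i) \<Longrightarrow> mcost m i \<le> (dist x y + 4 * (1/2) ^ m)\<^sup>2"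
  using lower_bounds(1,3)[of x m "ci i" y "cj i"] by (auto simp: mcost_def intro!: power_mono)

text \<open>The masses that the coupling gives to the rectangles of cells form an infinite matrix
  with the right marginals. Cutting it off after \<open>n\<close> entries and rounding down to
  rationals loses less than \<eta> of mass and can only decrease row sums, column sums and total
  cost. The term \<open>4 * (1/2) ^ m\<close> is the gap between the distance and the root of
  \<open>mcost\<close>.\<close>

lemma ex_weights:
  fixes \<mu> \<nu> :: "'a measure"
  assumes s: "sets \<mu> = sets borel" "sets \<nu> = sets borel"
    and \<theta>: "\<theta> \<in> couplings \<mu> \<nu>" "quad_cost dist \<theta> \<le> ennreal (B\<^sup>2)" and B: "B > 0" and \<eta>: "\<eta> > 0"
  obtains xs where "plan_weights xs" "admissible (C m) ci xs \<mu>" "admissible (C m) cj xs \<nu>" "slack xs < \<eta>"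
    "(\<Sum>i<length xs. wt xs i * mcost m i) \<le> (B + 4 * (1/2) ^ m)\<^sup>2"
proof -
  interpret \<theta>: prob_space \<theta> by (rule couplingsD(1)[OF \<theta>(1)])
  have s\<theta>: "sets \<theta> = sets (borel \<Otimes>\<^sub>M borel)" by (rule couplings_borelD(1)[OF \<theta>(1) s])
  note [measurable_cong] = s\<theta>
  have sp: "space \<mu> = UNIV" "space \<nu> = UNIV" using s by (auto dest: sets_eq_imp_space_eq)
  define R where "R i = C m (ci i) \<times> C m (cj i)" for i
  define q where "q i = measure \<theta> (R i)" for i
  have Rs: "R i \<in> sets \<theta>" for i unfolding R_def s\<theta> by (intro pair_measureI C_sets)
  have R_iff: "(x, y) \<in> R i \<longleftrightarrow> i = prod_encode (idx m x, idx m y)" for x y i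
  proof
    assume "(x, y) \<in> R i"
    then have "idx m x = ci i" "idx m y = cj i" using idx_unique by (auto simp: R_def)
    then show "i = prod_encode (idx m x, idx m y)" by (simp add: ci_def cj_def)
  next
    assume i: "i = prod_encode (idx m x, idx m y)"
    have "x \<in> C m (idx m x)" "y \<in> C m (idx m y)" by (rule idx, simp)+
    then show "(x, y) \<in> R i" by (simp add: R_def i ci_def cj_def)
  qed
  have disjR: "disjoint_family R" using R_iff by (auto simp: disjoint_family_on_def)
  have "(\<Union>i. R i) = UNIV" using R_iff by auto
  moreover have "range R \<subseteq> sets \<theta>" using Rs by blast
  from \<theta>.finite_measure_UNION[OF this disjR] have "q sums measure \<theta> (\<Union>i. R i)"
    unfolding q_def .
  moreover have "measure \<theta> UNIV = 1"
    using \<theta>.prob_space sets_eq_imp_space_eq[OF s\<theta>] by (simp add: space_pair_measure)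
  ultimately have "q sums 1" by simp
  then have "(\<lambda>n. \<Sum>i<n. q i) \<longlonglongrightarrow> 1" by (simp add: sums_def)
  then have "\<forall>\<^sub>F n in sequentially. 1 - \<eta> / 2 < (\<Sum>i<n. q i)"
    using \<eta> by (intro order_tendstoD) auto
  then obtain n where n: "1 - \<eta> / 2 < (\<Sum>i<n. q i)" by (auto simp: eventually_sequentially)
  have q0: "0 \<le> q i" for i by (simp add: q_def)
  have sum_q: "(\<Sum>i\<in>I. q i) = measure \<theta> (\<Union>i\<in>I. R i)" if "finite I" for I
    unfolding q_def using that Rs disjR
    by (intro \<theta>.finite_measure_finite_Union[symmetric]) (auto simp: disjoint_family_on_def)
  have q1: "(\<Sum>i\<in>I. q i) \<le> 1" if "finite I" for I unfolding sum_q[OF that] by simp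
  \<comment> \<open>Half of \<eta> pays for the cut-off and half for \<open>n\<close> roundings;
    \<open>Suc n\<close> avoids a division by zero.\<close>
  define \<delta> where "\<delta> = \<eta> / (2 * real (Suc n))"
  have \<delta>: "\<delta> > 0" using \<eta> by (simp add: \<delta>_def)
  have "\<exists>\<rho>. 0 \<le> \<rho> \<and> real_of_rat \<rho> \<le> q i \<and> q i - \<delta> \<le> real_of_rat \<rho> \<and> (0 < q i \<longrightarrow> real_of_rat \<rho> < q i)" for i
    by (rule ex_rat_below[OF q0 \<delta>, of i]) blast
  then obtain \<rho> where \<rho>: "\<And>i. 0 \<le> \<rho> i" "\<And>i. real_of_rat (\<rho> i) \<le> q i" "\<And>i. q i - \<delta> \<le> real_of_rat (\<rho> i)"
      "\<And>i. 0 < q i \<Longrightarrow> real_of_rat (\<rho> i) < q i"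
    by metis
  define xs where "xs = map \<rho> [0..<n]"
  have len: "length xs = n" by (simp add: xs_def)
  have wt: "wt xs i = real_of_rat (\<rho> i)" if "i < n" for i using that by (simp add: wt_def xs_def)
  have wt_le: "wt xs i \<le> q i" if "i < n" for i using wt[OF that] \<rho>(2) by simp
  have "slack xs < \<eta>"
  proof -
    have "(\<Sum>i<n. q i) - real n * \<delta> = (\<Sum>i<n. q i - \<delta>)" by (simp add: sum_subtractf)
    also have "\<dots> \<le> (\<Sum>i<n. wt xs i)" using \<rho>(3) wt by (intro sum_mono) simp
    finally have "1 - \<eta> / 2 - real n * \<delta> < (\<Sum>i<n. wt xs i)" using n by simp
    moreover have "real n * \<delta> \<le> \<eta> / 2" using \<eta> by (simp add: \<delta>_def field_simps)
    ultimately show ?thesis by (simp add: slack_def len)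
  qed
  moreover have "plan_weights xs"
    unfolding plan_weights_def
  proof (intro conjI allI impI)
    show "0 \<le> xs ! i" if "i < length xs" for i using that \<rho>(1) by (simp add: xs_def)
    \<comment> \<open>The retained masses may already sum to 1, so the strict rounding of a positive
      entry is needed; if no entry is positive, the sum is at most 0.\<close>
    have "(\<Sum>i<n. wt xs i) < 1"
    proof (cases "\<exists>i<n. 0 < q i")
      case True
      then have "(\<Sum>i<n. wt xs i) < (\<Sum>i<n. q i)"
        using wt_le wt \<rho>(4) by (intro sum_strict_mono_ex1) auto
      then show ?thesis using q1[of "{..<n}"] by simp
    next
      case False
      then have "(\<Sum>i<n. wt xs i) \<le> (\<Sum>i<n. 0)"
        using wt_le by (intro sum_mono) (force intro: order_trans)
      then show ?thesis by simp
    qed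
    then show "0 < slack xs" by (simp add: slack_def len)
  qed
  moreover have "admissible (C m) ci xs \<mu>"
    unfolding admissible_def
  proof
    fix k
    have "(\<Sum>i<length xs. if ci i = k then wt xs i else 0) \<le> (\<Sum>i<n. if ci i = k then q i else 0)"
      unfolding len using wt_le by (intro sum_mono) auto
    also have "\<dots> = (\<Sum>i\<in>{i\<in>{..<n}. ci i = k}. q i)" by (rule sum.inter_filter[symmetric]) simp
    also have "\<dots> = measure \<theta> (\<Union>i\<in>{i\<in>{..<n}. ci i = k}. R i)" by (rule sum_q) simp
    also have "\<dots> \<le> measure \<theta> (C m k \<times> space \<nu>)"
      by (rule \<theta>.finite_measure_mono) (auto simp: R_def sp s\<theta> C_sets)
    also have "\<dots> = measure \<mu> (C m k)" by (rule coupling_measure_fst[OF \<theta>(1)]) (simp add: s C_sets)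
    finally show "(\<Sum>i<length xs. if ci i = k then wt xs i else 0) \<le> measure \<mu> (C m k)" .
  qed
  moreover have "admissible (C m) cj xs \<nu>"
    unfolding admissible_def
  proof
    fix k
    have "(\<Sum>i<length xs. if cj i = k then wt xs i else 0) \<le> (\<Sum>i<n. if cj i = k then q i else 0)"
      unfolding len using wt_le by (intro sum_mono) auto
    also have "\<dots> = (\<Sum>i\<in>{i\<in>{..<n}. cj i = k}. q i)" by (rule sum.inter_filter[symmetric]) simp
    also have "\<dots> = measure \<theta> (\<Union>i\<in>{i\<in>{..<n}. cj i = k}. R i)" by (rule sum_q) simp
    also have "\<dots> \<le> measure \<theta> (space \<mu> \<times> C m k)"
      by (rule \<theta>.finite_measure_mono) (auto simp: R_def sp s\<theta> C_sets)
    also have "\<dots> = measure \<nu> (C m k)" by (rule coupling_measure_snd[OF \<theta>(1)]) (simp add: s C_sets)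
    finally show "(\<Sum>i<length xs. if cj i = k then wt xs i else 0) \<le> measure \<nu> (C m k)" .
  qed
  moreover have "(\<Sum>i<length xs. wt xs i * mcost m i) \<le> (B + 4 * (1/2) ^ m)\<^sup>2"
  proof -
    let ?e = "4 * (1/2) ^ m :: real"
    have e: "?e > 0" by simp
    have "ennreal (\<Sum>i<n. q i * mcost m i) = (\<Sum>i<n. ennreal (mcost m i) * emeasure \<theta> (R i))"
      using q0 mcost_nonneg
      by (subst sum_ennreal[symmetric]) (auto simp: \<theta>.emeasure_eq_measure q_def ennreal_mult[symmetric] mult.commute)
    also have "\<dots> = (\<Sum>i<n. \<integral>\<^sup>+z. ennreal (mcost m i) * indicator (R i) z \<partial>\<theta>)"
      using Rs by (intro sum.cong) (auto simp: nn_integral_cmult_indicator)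
    also have "\<dots> = (\<integral>\<^sup>+z. (\<Sum>i<n. ennreal (mcost m i) * indicator (R i) z) \<partial>\<theta>)"
      by (intro nn_integral_sum[symmetric] borel_measurable_times_ennreal borel_measurable_const borel_measurable_indicator Rs)
    also have "\<dots> \<le> (\<integral>\<^sup>+z. ennreal (B + ?e) * (ennreal (1 / B) * ennreal ((dist (fst z) (snd z))\<^sup>2) + ennreal ?e) \<partial>\<theta>)"
    proof (rule nn_integral_mono)
      fix z :: "'a \<times> 'a"
      obtain x y where z: "z = (x, y)" by (cases z)
      let ?i = "prod_encode (idx m x, idx m y)"
      have "(\<Sum>i<n. ennreal (mcost m i) * indicator (R i) z) = (\<Sum>i<n. if i = ?i then ennreal (mcost m ?i) else 0)"
        by (intro sum.cong) (auto simp: z R_iff split: split_indicator)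
      also have "\<dots> \<le> ennreal (mcost m ?i)" by (simp add: sum.delta)
      also have "\<dots> \<le> ennreal ((B + ?e) * (1 / B * (dist x y)\<^sup>2 + ?e))"
      proof (rule ennreal_leI)
        have "(x, y) \<in> R ?i" by (simp add: R_iff)
        then have "mcost m ?i \<le> (dist x y + ?e)\<^sup>2" by (intro mcost_le) (auto simp: R_def)
        also have "\<dots> \<le> (B + ?e) * ((dist x y)\<^sup>2 / B + ?e)" by (rule two_squares[OF B e])
        finally show "mcost m ?i \<le> (B + ?e) * (1 / B * (dist x y)\<^sup>2 + ?e)" by simp
      qed
      also have "\<dots> = ennreal (B + ?e) * (ennreal (1 / B) * ennreal ((dist (fst z) (snd z))\<^sup>2) + ennreal ?e)"
        using B by (simp add: z ennreal_mult[symmetric] ennreal_plus[symmetric] del: ennreal_plus)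
      finally show "(\<Sum>i<n. ennreal (mcost m i) * indicator (R i) z) \<le> ennreal (B + ?e) * (ennreal (1 / B) * ennreal ((dist (fst z) (snd z))\<^sup>2) + ennreal ?e)" .
    qed
    also have "\<dots> = ennreal (B + ?e) * (ennreal (1 / B) * quad_cost dist \<theta> + ennreal ?e)"
      unfolding quad_cost_eq by (simp add: nn_integral_cmult nn_integral_add \<theta>.emeasure_space_1)
    also have "\<dots> \<le> ennreal (B + ?e) * (ennreal (1 / B) * ennreal (B\<^sup>2) + ennreal ?e)"
      by (intro mult_left_mono add_mono \<theta>) auto
    also have "\<dots> = ennreal ((B + ?e)\<^sup>2)"
      using B by (simp add: ennreal_mult[symmetric] ennreal_plus[symmetric] power2_eq_square del: ennreal_plus)
    finally have "(\<Sum>i<n. q i * mcost m i) \<le> (B + ?e)\<^sup>2" by (subst (asm) ennreal_le_iff) auto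
    moreover have "(\<Sum>i<n. wt xs i * mcost m i) \<le> (\<Sum>i<n. q i * mcost m i)"
      using wt_le mcost_nonneg by (intro sum_mono mult_right_mono) auto
    ultimately show ?thesis by (simp add: len)
  qed
  ultimately show ?thesis using that by blast
qed

lemma plan_of_weights:
  fixes \<mu> \<nu> :: "'a measure"
  assumes \<mu>: "\<mu> \<in> prob2" and \<nu>: "\<nu> \<in> prob2"
    and xs: "plan_weights xs" "admissible (C m) ci xs \<mu>" "admissible (C m) cj xs \<nu>"
    and E: "(\<Sum>i<length xs. wt xs i * mcost m i) \<le> E" and \<delta>: "0 \<le> \<delta>" "real K * slack xs \<le> \<delta>"
    and t: "tail x0 K \<mu> \<le> ennreal \<delta>" "tail x0 K \<nu> \<le> ennreal \<delta>"
  shows "plan_measure (C m) xs \<mu> \<nu> \<in> couplings \<mu> \<nu>"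
    "quad_cost dist (plan_measure (C m) xs \<mu> \<nu>) \<le> ennreal (E + 8 * \<delta>)"
proof -
  have plan: "admissible_plan (C m) xs \<mu> \<nu>"
    using prob2D(2)[OF \<mu>] prob2D(2)[OF \<nu>]
    by (intro admissible_planI C_disj xs prob2D(1) \<mu> \<nu>) (auto simp: C_sets)
  show "plan_measure (C m) xs \<mu> \<nu> \<in> couplings \<mu> \<nu>"
    by (rule admissible_plan.plan_coupling[OF plan])
  show "quad_cost dist (plan_measure (C m) xs \<mu> \<nu>) \<le> ennreal (E + 8 * \<delta>)"
    by (rule plan_cost_tail[OF plan prob2D(2)[OF \<mu>] prob2D(2)[OF \<nu>] _ mcost_nonneg E \<delta> t]) (rule dist_sq_le_mcost)
qed

end

lemma ex_metric_cells:
  obtains C where "metric_cells (C :: nat \<Rightarrow> nat \<Rightarrow> 'a::{metric_space, second_countable_topology} set)"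
  using ex_small_cells by (auto simp: metric_cells_def)

lemma ex_tail_le:
  fixes \<mu> :: "'a::{metric_space, second_countable_topology} measure"
  assumes "\<mu> \<in> prob2" "\<delta> > 0"
  obtains K0 where "\<And>K. K \<ge> K0 \<Longrightarrow> tail x0 K \<mu> \<le> ennreal \<delta>"
proof -
  have "\<forall>\<^sub>F K in sequentially. tail x0 K \<mu> < ennreal \<delta>"
    using tail_tendsto[OF assms(1), of x0] assms(2) by (intro order_tendstoD) auto
  then show ?thesis using that by (auto simp: eventually_sequentially intro: less_imp_le)
qed

section \<open>The Borel structure of the Wasserstein space\<close>

text \<open>The sigma-algebra generated by evaluations on Borel sets is convenient for kernels and
  push-forwards, whereas the statement uses the Borel sets of \<open>w2\<close>. That the two agree
  is \<open>sets_prob2_borel\<close>.\<close>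

definition prob2_space :: "'a::metric_space measure measure" where
  "prob2_space = restrict_space (prob_algebra borel) prob2"

lemma space_prob2_space: "space (prob2_space :: 'a::{metric_space, second_countable_topology} measure measure) = prob2"
  using prob2D(4) by (auto simp: prob2_space_def space_restrict_space)

lemma nn_integral_measurable_prob_algebra:
  "f \<in> borel_measurable N \<Longrightarrow> (\<lambda>M. integral\<^sup>N M f) \<in> borel_measurable (prob_algebra N)"
  unfolding prob_algebra_def by (intro measurable_restrict_space1 nn_integral_measurable_subprob_algebra)

lemma prob2_in_sets: "prob2 \<in> sets (prob_algebra (borel :: 'a::{metric_space, second_countable_topology} measure))"
proof -
  let ?m = "\<lambda>\<mu>::'a measure. \<integral>\<^sup>+x. ennreal ((dist undefined x)\<^sup>2) \<partial>\<mu>"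
  have m: "?m \<in> borel_measurable (prob_algebra borel)"
    by (rule nn_integral_measurable_prob_algebra) measurable
  have "prob2 = ?m -` {..<\<infinity>} \<inter> space (prob_algebra (borel :: 'a measure))"
    using prob2D(3,4) prob2I by (auto simp: space_prob_algebra)
  also have "\<dots> \<in> sets (prob_algebra borel)" by (rule measurable_sets[OF m]) simp
  finally show ?thesis .
qed

lemma measurable_prob2_eval: "A \<in> sets borel \<Longrightarrow> (\<lambda>\<mu>. measure \<mu> A) \<in> borel_measurable (prob2_space :: 'a::metric_space measure measure)"
  unfolding prob2_space_def by (intro measurable_restrict_space1 measurable_measure_prob_algebra)

lemma measurable_admissible:
  assumes "\<And>k. A k \<in> sets (borel :: 'a::metric_space measure)"
  shows "Measurable.pred prob2_space (\<lambda>\<mu>. admissible A c xs \<mu>)"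
  unfolding admissible_def
  by (rule pred_intros_countable(1), unfold pred_def)
     (rule borel_measurable_le[OF borel_measurable_const measurable_prob2_eval[OF assms]])

lemma measurable_tail: "tail x0 K \<in> borel_measurable (prob2_space :: 'a::{metric_space, second_countable_topology} measure measure)"
  unfolding prob2_space_def tail_def
  by (intro measurable_restrict_space1 nn_integral_measurable_prob_algebra tail_integrand_measurable)

text \<open>Two measures that admit the same list \<open>xs\<close>, one for its rows and the other
  for its columns, are coupled by its plan, so a cheap list bounds their distance. The set
  \<open>S m (xs, K)\<close> collects the measures that can take both roles and whose tail at
  \<open>K\<close> is small. These sets are countably many and described by masses of cells and
  tails; the weights of the diagonal coupling of \<mu> put every \<mu> into one of them.\<close>

lemma ex_w2_cells:
  obtains D where "small_cells (prob2_space :: 'a::{metric_space, second_countable_topology} measure measure) w2 D"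
proof -
  obtain C where "metric_cells (C :: nat \<Rightarrow> nat \<Rightarrow> 'a set)" by (rule ex_metric_cells)
  then interpret C: metric_cells C .
  let ?x = "undefined :: 'a"
  \<comment> \<open>The bound 25 comes from the diagonal coupling at radius
    \<open>(1/2) ^ m\<close>, whose weights cost at most the square of
    \<open>(1 + 4) * (1/2) ^ m\<close>.\<close>
  define S where "S m p = (case p of (xs, K) \<Rightarrow>
      if plan_weights xs \<and> real K * slack xs \<le> ((1/2) ^ m)\<^sup>2 \<and> (\<Sum>i<length xs. wt xs i * C.mcost m i) \<le> 25 * ((1/2) ^ m)\<^sup>2
      then {\<mu> \<in> space prob2_space. admissible (C m) ci xs \<mu> \<and> admissible (C m) cj xs \<mu> \<and> tail ?x K \<mu> \<le> ennreal (((1/2) ^ m)\<^sup>2)}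
      else {})" for m and p :: "rat list \<times> nat"
  have S_sets: "S m p \<in> sets prob2_space" for m p
  proof -
    obtain xs K where p: "p = (xs, K)" by (cases p)
    have "{\<mu> \<in> space prob2_space. admissible (C m) ci xs \<mu> \<and> admissible (C m) cj xs \<mu> \<and> tail ?x K \<mu> \<le> ennreal (((1/2) ^ m)\<^sup>2)} \<in> sets prob2_space"
      by (intro sets.sets_Collect_conj measurable_admissible[OF C.C_sets, unfolded pred_def]
          borel_measurable_le measurable_tail borel_measurable_const)
    then show ?thesis
      unfolding S_def p prod.case by (split if_split) (intro conjI impI, assumption, rule sets.empty_sets)
  qed
  have small: "w2 \<mu> \<nu> \<le> 6 * (1/2) ^ m" if "\<mu> \<in> S m p" "\<nu> \<in> S m p" for \<mu> \<nu> m p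
  proof -
    obtain xs K where p: "p = (xs, K)" by (cases p)
    let ?e = "(1/2) ^ m :: real"
    have *: "plan_weights xs" "real K * slack xs \<le> ?e\<^sup>2" "(\<Sum>i<length xs. wt xs i * C.mcost m i) \<le> 25 * ?e\<^sup>2"
      and m: "\<mu> \<in> prob2" "admissible (C m) ci xs \<mu>" "tail ?x K \<mu> \<le> ennreal (?e\<^sup>2)"
      and n: "\<nu> \<in> prob2" "admissible (C m) cj xs \<nu>" "tail ?x K \<nu> \<le> ennreal (?e\<^sup>2)"
      using that by (auto simp: S_def p space_prob2_space split: if_splits)
    note plan = C.plan_of_weights[OF m(1) n(1) *(1) m(2) n(2) *(3) zero_le_power2 *(2) m(3) n(3)]
    \<comment> \<open>The coefficient 8 is the price of the independent rest with
      \<open>\<delta> = ?e\<^sup>2\<close>, and 33 is at most the square of 6.\<close>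
    have "25 * ?e\<^sup>2 + 8 * ?e\<^sup>2 \<le> (6 * ?e)\<^sup>2" by (simp add: power_mult_distrib)
    then have "quad_cost dist (plan_measure (C m) xs \<mu> \<nu>) \<le> ennreal ((6 * ?e)\<^sup>2)"
      by (rule order_trans[OF plan(2) ennreal_leI])
    from wasserstein2_le[OF plan(1) this] show ?thesis by simp
  qed
  have cover: "\<exists>p. \<mu> \<in> S m p" if \<mu>: "\<mu> \<in> prob2" for \<mu> m
  proof -
    let ?e = "(1/2) ^ m :: real"
    have e: "?e > 0" "?e\<^sup>2 > 0" by simp_all
    note [measurable_cong] = prob2D(2)[OF \<mu>]
    \<comment> \<open>\<open>K\<close> is fixed by the tail of \<mu>; only then is the slack chosen
      small relative to \<open>K\<close>.\<close>
    obtain K where K: "tail ?x K \<mu> \<le> ennreal (?e\<^sup>2)" using ex_tail_le[OF \<mu> e(2)] by blast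
    let ?\<theta> = "distr \<mu> (\<mu> \<Otimes>\<^sub>M \<mu>) (\<lambda>x. (x, x))"
    have "quad_cost dist ?\<theta> = 0"
    proof -
      have "(\<lambda>z. ennreal ((dist (fst z) (snd z))\<^sup>2)) \<in> borel_measurable (\<mu> \<Otimes>\<^sub>M \<mu>)"
        "(\<lambda>x. (x, x)) \<in> \<mu> \<rightarrow>\<^sub>M \<mu> \<Otimes>\<^sub>M \<mu>" by measurable
      then show ?thesis unfolding quad_cost_eq by (subst nn_integral_distr) simp_all
    qed
    then have q: "quad_cost dist ?\<theta> \<le> ennreal (?e\<^sup>2)" by simp
    have "?e\<^sup>2 / real (Suc K) > 0" using e by simp
    from C.ex_weights[OF prob2D(2)[OF \<mu>] prob2D(2)[OF \<mu>] diag_coupling[OF prob2D(1)[OF \<mu>]] q e(1) this, of m]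
    obtain xs where xs: "plan_weights xs" "admissible (C m) ci xs \<mu>" "admissible (C m) cj xs \<mu>" "slack xs < ?e\<^sup>2 / real (Suc K)"
      "(\<Sum>i<length xs. wt xs i * C.mcost m i) \<le> (?e + 4 * ?e)\<^sup>2" by blast
    have "real K * slack xs \<le> real (Suc K) * slack xs" using xs(1) by (intro mult_right_mono) (auto simp: plan_weights_def)
    also have "\<dots> = slack xs * real (Suc K)" by (rule mult.commute)
    also have "\<dots> \<le> ?e\<^sup>2"
      by (rule less_imp_le, rule pos_less_divide_eq[THEN iffD1, OF _ xs(4)]) (rule of_nat_0_less_iff[THEN iffD2, OF zero_less_Suc])
    finally have "real K * slack xs \<le> ?e\<^sup>2" .
    moreover have "(?e + 4 * ?e)\<^sup>2 = 25 * ?e\<^sup>2" by (simp add: power2_eq_square)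
    ultimately have "\<mu> \<in> S m (xs, K)"
      using xs K \<mu> by (simp add: S_def space_prob2_space)
    then show ?thesis by blast
  qed
  \<comment> \<open>At scale \<open>m + 3\<close> the diameter is at most
    \<open>6 / 8 * (1/2) ^ m\<close>, which is below the required \<open>(1/2) ^ m\<close>.\<close>
  let ?S = "\<lambda>m k. S (m + 3) (from_nat k)"
  have "small_cells prob2_space w2 (\<lambda>m. disjointed (?S m))"
  proof
    show "disjointed (?S m) k \<in> sets prob2_space" for m k
      by (rule sets.range_disjointed_sets'[THEN subsetD, of "?S m"]) (auto simp: S_sets)
    show "disjoint_family (disjointed (?S m))" for m by (rule disjoint_family_disjointed)
    have "(\<Union>k. ?S m k) = space prob2_space" for m
    proof
      show "(\<Union>k. ?S m k) \<subseteq> space prob2_space" using sets.sets_into_space[OF S_sets] by blast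
      show "space prob2_space \<subseteq> (\<Union>k. ?S m k)"
      proof
        fix \<mu> :: "'a measure" assume "\<mu> \<in> space prob2_space"
        then have "\<mu> \<in> prob2" by (simp add: space_prob2_space)
        from cover[OF this] obtain p where "\<mu> \<in> S (m + 3) p" by (rule exE)
        then have "\<mu> \<in> ?S m (to_nat p)" by simp
        then show "\<mu> \<in> (\<Union>k. ?S m k)" by blast
      qed
    qed
    then show "(\<Union>k. disjointed (?S m) k) = space prob2_space" for m by (simp add: UN_disjointed_eq)
    show "w2 \<mu> \<nu> \<le> (1/2) ^ m" if "\<mu> \<in> disjointed (?S m) k" "\<nu> \<in> disjointed (?S m) k" for \<mu> \<nu> m k
    proof -
      have "w2 \<mu> \<nu> \<le> 6 * (1/2) ^ (m + 3)"
        using that disjointed_subset[of "?S m" k] by (intro small) auto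
      also have "\<dots> = 3 / 4 * (1/2) ^ m" by (simp add: power_add power3_eq_cube)
      also have "\<dots> \<le> (1/2) ^ m" by simp
      finally show ?thesis .
    qed
    show "w2 \<mu> \<nu> = w2 \<nu> \<mu>" if "\<mu> \<in> space prob2_space" "\<nu> \<in> space prob2_space" for \<mu> \<nu> :: "'a measure"
      using that by (intro w2_commute prob2D(2)) (simp_all add: space_prob2_space)
  qed (simp_all add: space_prob2_space wasserstein2_nonneg w2_triangle)
  then show ?thesis by (rule that)
qed

text \<open>The bound \<open>a \<le> e + a\<^sup>2 / e\<close> replaces the Cauchy--Schwarz inequality.\<close>

lemma lipschitz_integral_w2:
  fixes f :: "'a::{metric_space, second_countable_topology} \<Rightarrow> real"
  assumes f [measurable]: "f \<in> borel_measurable borel" and f01: "\<And>x. 0 \<le> f x" "\<And>x. f x \<le> 1"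
    and L: "\<And>x y. f x - f y \<le> L * dist x y" "0 \<le> L"
    and \<mu>: "\<mu> \<in> prob2" and \<nu>: "\<nu> \<in> prob2" and e: "w2 \<mu> \<nu> < e"
  shows "integral\<^sup>L \<mu> f \<le> integral\<^sup>L \<nu> f + L * (2 * e)"
proof -
  have e0: "e > 0" using e wasserstein2_nonneg[of dist \<mu> \<nu>] by simp
  obtain \<theta> where \<theta>: "\<theta> \<in> couplings \<mu> \<nu>" "quad_cost dist \<theta> < ennreal (e\<^sup>2)"
    using wasserstein2_less[OF INF_quad_cost_finite[OF \<mu> \<nu>] e] by blast
  interpret \<theta>: prob_space \<theta> by (rule couplingsD(1)[OF \<theta>(1)])
  note s = prob2D(2)[OF \<mu>] prob2D(2)[OF \<nu>]
  note [measurable_cong] = s couplings_borelD(1)[OF \<theta>(1) s]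
  have i: "integrable \<theta> (\<lambda>z. f (fst z))" "integrable \<theta> (\<lambda>z. f (snd z))"
    using f01 by (auto intro!: \<theta>.integrable_const_bound[where B = 1])
  let ?d = "\<lambda>z::'a \<times> 'a. (dist (fst z) (snd z))\<^sup>2"
  have d_int: "integrable \<theta> ?d" and d_le: "integral\<^sup>L \<theta> ?d \<le> e\<^sup>2"
  proof -
    have q: "(\<integral>\<^sup>+z. ennreal (?d z) \<partial>\<theta>) < ennreal (e\<^sup>2)" using \<theta>(2) unfolding quad_cost_eq .
    have m: "?d \<in> borel_measurable \<theta>" by measurable
    show "integrable \<theta> ?d"
      using q by (intro integrableI_nonneg m) (auto intro: less_trans[OF _ ennreal_less_top])
    have "integral\<^sup>L \<theta> ?d = enn2real (\<integral>\<^sup>+z. ennreal (?d z) \<partial>\<theta>)"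
      by (rule integral_eq_nn_integral[OF m]) simp
    also have "\<dots> \<le> e\<^sup>2" using q by (intro enn2real_leI less_imp_le) auto
    finally show "integral\<^sup>L \<theta> ?d \<le> e\<^sup>2" .
  qed
  have "integral\<^sup>L \<mu> f = (\<integral>z. f (fst z) \<partial>\<theta>)"
    by (subst couplingsD(3)[OF \<theta>(1), symmetric]) (rule integral_distr; measurable)
  moreover have "integral\<^sup>L \<nu> f = (\<integral>z. f (snd z) \<partial>\<theta>)"
    by (subst couplingsD(4)[OF \<theta>(1), symmetric]) (rule integral_distr; measurable)
  ultimately have "integral\<^sup>L \<mu> f - integral\<^sup>L \<nu> f = (\<integral>z. f (fst z) - f (snd z) \<partial>\<theta>)"
    using i by simp
  also have "\<dots> \<le> (\<integral>z. L * (e + ?d z / e) \<partial>\<theta>)"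
  proof (rule integral_mono)
    show "integrable \<theta> (\<lambda>z. f (fst z) - f (snd z))" using i by simp
    show "integrable \<theta> (\<lambda>z. L * (e + ?d z / e))" using d_int by simp
    fix z :: "'a \<times> 'a"
    let ?a = "dist (fst z) (snd z)"
    have "0 \<le> (?a - e)\<^sup>2 + ?a * e" using e0 by simp
    then have "?a \<le> e + ?a\<^sup>2 / e" using e0 by (simp add: field_simps power2_eq_square)
    then have "L * ?a \<le> L * (e + ?a\<^sup>2 / e)" using L(2) by (rule mult_left_mono)
    then show "f (fst z) - f (snd z) \<le> L * (e + ?d z / e)" using L(1)[of "fst z" "snd z"] by linarith
  qed
  also have "\<dots> = L * (e + integral\<^sup>L \<theta> ?d / e)"
    using d_int by (simp add: \<theta>.prob_space)
  also have "\<dots> \<le> L * (2 * e)"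
  proof (rule mult_left_mono[OF _ L(2)])
    have "integral\<^sup>L \<theta> ?d / e \<le> e\<^sup>2 / e" using d_le e0 by (intro divide_right_mono) auto
    then show "e + integral\<^sup>L \<theta> ?d / e \<le> 2 * e" using e0 by (simp add: power2_eq_square)
  qed
  finally show ?thesis by simp
qed

section \<open>Borel sets of \<open>w2\<close> and sets generated by evaluation\<close>

abbreviation w2_open :: "'a::metric_space measure set \<Rightarrow> bool" where
  "w2_open U \<equiv> U \<subseteq> prob2 \<and> (\<forall>\<mu>\<in>U. \<exists>r>0. \<forall>\<nu>\<in>prob2. w2 \<mu> \<nu> < r \<longrightarrow> \<nu> \<in> U)"

lemma w2_open_Pow: "{U. w2_open U} \<subseteq> Pow (prob2 :: 'a::metric_space measure set)"
  by auto

lemma space_prob2_borel: "space prob2_borel = prob2"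
  unfolding metric_borel_def by (rule space_measure_of[OF w2_open_Pow])

lemma sets_prob2_borel_eq: "sets prob2_borel = sigma_sets prob2 {U. w2_open U}"
  unfolding metric_borel_def by (rule sets_measure_of[OF w2_open_Pow])

text \<open>By \<open>lipschitz_integral_w2\<close> the superlevel sets of the integral are open for
  \<open>w2\<close>.\<close>

lemma borel_measurable_prob2_integral:
  fixes f :: "'a::{metric_space, second_countable_topology} \<Rightarrow> real"
  assumes f: "f \<in> borel_measurable borel" "\<And>x. 0 \<le> f x" "\<And>x. f x \<le> 1"
    and L: "\<And>x y. f x - f y \<le> L * dist x y" "0 \<le> L"
  shows "(\<lambda>\<mu>. integral\<^sup>L \<mu> f) \<in> borel_measurable prob2_borel"
  unfolding borel_measurable_iff_greater space_prob2_borel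
proof
  fix t
  have "w2_open {\<mu> \<in> prob2. t < integral\<^sup>L \<mu> f}"
  proof (intro conjI ballI)
    fix \<mu> assume "\<mu> \<in> {\<mu> \<in> prob2. t < integral\<^sup>L \<mu> f}"
    then have \<mu>: "\<mu> \<in> prob2" and g: "0 < integral\<^sup>L \<mu> f - t" by auto
    let ?g = "integral\<^sup>L \<mu> f - t"
    \<comment> \<open>The summand 1 in the denominator covers the case \<open>L = 0\<close> and
      makes \<open>L * (2 * ?r)\<close> strictly smaller than the gap.\<close>
    let ?r = "?g / (2 * L + 1)"
    have r: "?r > 0" using g L(2) by simp
    have "L * (2 * ?r) < ?g" using g L(2) by (simp add: field_simps)
    then have "\<nu> \<in> {\<mu> \<in> prob2. t < integral\<^sup>L \<mu> f}" if "\<nu> \<in> prob2" "w2 \<mu> \<nu> < ?r" for \<nu>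
      using lipschitz_integral_w2[OF f L \<mu> that] that(1) by simp
    then show "\<exists>r>0. \<forall>\<nu>\<in>prob2. w2 \<mu> \<nu> < r \<longrightarrow> \<nu> \<in> {\<mu> \<in> prob2. t < integral\<^sup>L \<mu> f}"
      using r by blast
  qed blast
  then show "{\<mu> \<in> prob2. t < integral\<^sup>L \<mu> f} \<in> sets prob2_borel"
    unfolding sets_prob2_borel_eq by (intro sigma_sets.Basic) simp
qed

text \<open>The indicator of a nonempty closed set is the limit of the Lipschitz functions
  \<open>max 0 (1 - n * infdist x A)\<close>. The empty set is treated apart because
  \<open>infdist\<close> to it is 0 by convention.\<close>

lemma measurable_prob2_borel_closed:
  fixes A :: "'a::{metric_space, second_countable_topology} set"
  assumes A: "closed A"
  shows "(\<lambda>\<mu>. emeasure \<mu> A) \<in> borel_measurable prob2_borel"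
proof (cases "A = {}")
  case False
  define f where "f n x = max 0 (1 - real n * infdist x A)" for n x
  have fm: "f n \<in> borel_measurable borel" for n
    unfolding f_def by (intro borel_measurable_continuous_onI continuous_intros)
  have f01: "0 \<le> f n x" "f n x \<le> 1" for n x
    using infdist_nonneg[of x A] by (auto simp: f_def)
  have lip: "f n x - f n y \<le> real n * dist x y" for n x y
  proof -
    have "real n * infdist y A \<le> real n * (infdist x A + dist y x)"
      by (intro mult_left_mono infdist_triangle) simp
    then have "real n * infdist y A - real n * infdist x A \<le> real n * dist x y"
      by (simp add: distrib_left dist_commute)
    moreover have "0 \<le> real n * dist x y" by simp
    ultimately show ?thesis unfolding f_def by linarith
  qed
  have lim: "(\<lambda>n. f n x) \<longlonglongrightarrow> indicator A x" for x
  proof (cases "x \<in> A")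
    case True
    then show ?thesis by (simp add: f_def)
  next
    case False
    then have "infdist x A > 0"
      using in_closed_iff_infdist_zero[OF A \<open>A \<noteq> {}\<close>, of x] infdist_nonneg[of x A] by auto
    then obtain N :: nat where N: "1 < real N * infdist x A" using reals_Archimedean3 by blast
    have "f n x = 0" if "n \<ge> N" for n
    proof -
      have "real N * infdist x A \<le> real n * infdist x A" using that infdist_nonneg by (intro mult_right_mono) auto
      then show ?thesis using N by (simp add: f_def)
    qed
    then show ?thesis using False by (intro tendsto_eventually) (auto simp: eventually_sequentially)
  qed
  have int_lim: "(\<lambda>n. integral\<^sup>L \<mu> (f n)) \<longlonglongrightarrow> measure \<mu> A" if \<mu>: "\<mu> \<in> prob2" for \<mu>
  proof -
    interpret prob_space \<mu> by (rule prob2D(1)[OF \<mu>])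
    note [measurable_cong] = prob2D(2)[OF \<mu>]
    have A': "A \<in> sets \<mu>" using A by (simp add: prob2D(2)[OF \<mu>])
    have "(\<lambda>n. integral\<^sup>L \<mu> (f n)) \<longlonglongrightarrow> integral\<^sup>L \<mu> (indicator A :: 'a \<Rightarrow> real)"
    proof (rule integral_dominated_convergence[where w = "\<lambda>_. 1"])
      show "f n \<in> borel_measurable \<mu>" for n using fm by measurable
      show "(indicator A :: 'a \<Rightarrow> real) \<in> borel_measurable \<mu>" using A' by simp
      show "AE x in \<mu>. norm (f n x) \<le> 1" for n using f01 by simp
    qed (simp_all add: lim)
    then show ?thesis using A' by simp
  qed
  have "(\<lambda>\<mu>. measure \<mu> A) \<in> borel_measurable prob2_borel"
    by (rule borel_measurable_LIMSEQ_metric[where f = "\<lambda>n \<mu>. integral\<^sup>L \<mu> (f n)"])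
       (auto intro!: borel_measurable_prob2_integral[OF fm f01 lip] int_lim simp: space_prob2_borel)
  then have "(\<lambda>\<mu>. ennreal (measure \<mu> A)) \<in> borel_measurable prob2_borel"
    by (rule measurable_compose[OF _ measurable_ennreal])
  moreover have "emeasure \<mu> A = ennreal (measure \<mu> A)" if "\<mu> \<in> space prob2_borel" for \<mu> :: "'a measure"
  proof -
    interpret prob_space \<mu> using that by (intro prob2D(1)) (simp add: space_prob2_borel)
    show ?thesis by (rule emeasure_eq_measure)
  qed
  ultimately show ?thesis by (subst measurable_cong) auto
qed simp

text \<open>Every \<open>w2\<close>-open set is the union of the cells of all scales that it
  contains, a countable union of sets of \<open>prob2_space\<close>. Conversely, evaluation on
  closed sets is Borel for \<open>w2\<close>, and closed sets generate.\<close>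

lemma sets_prob2_borel: "sets (prob2_borel :: 'a::{metric_space, second_countable_topology} measure measure) = sets prob2_space"
proof
  obtain D where "small_cells (prob2_space :: 'a measure measure) w2 D" by (rule ex_w2_cells)
  then interpret D: small_cells "prob2_space :: 'a measure measure" w2 D .
  have "U \<in> sets prob2_space" if U: "w2_open U" for U :: "'a measure set"
  proof -
    have "U = (\<Union>m. \<Union>k. if D m k \<subseteq> U then D m k else {})"
    proof (intro equalityI subsetI)
      fix \<mu> assume \<mu>: "\<mu> \<in> U"
      then obtain r where r: "r > 0" "\<And>\<nu>. \<nu> \<in> prob2 \<Longrightarrow> w2 \<mu> \<nu> < r \<Longrightarrow> \<nu> \<in> U" using U by blast
      obtain m where m: "(1/2) ^ m < r" using real_arch_pow_inv[OF r(1), of "1/2"] by auto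
      have "\<mu> \<in> space prob2_space" using U \<mu> by (auto simp: space_prob2_space)
      then have i: "\<mu> \<in> D m (D.idx m \<mu>)" by (rule D.idx)
      have "D m (D.idx m \<mu>) \<subseteq> U"
      proof
        fix \<nu> assume \<nu>: "\<nu> \<in> D m (D.idx m \<mu>)"
        then have "\<nu> \<in> prob2" using D.C_space by (simp add: space_prob2_space)
        then show "\<nu> \<in> U" using D.C_small[OF i \<nu>] m by (intro r(2)) auto
      qed
      then show "\<mu> \<in> (\<Union>m. \<Union>k. if D m k \<subseteq> U then D m k else {})" using i by auto
    qed (auto split: if_splits)
    also have "\<dots> \<in> sets prob2_space"
      by (intro sets.countable_UN) auto
    finally show ?thesis .
  qed
  then show "sets prob2_borel \<subseteq> sets (prob2_space :: 'a measure measure)"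
    unfolding sets_prob2_borel_eq using sets.sigma_sets_subset[of "{U. w2_open U}" "prob2_space :: 'a measure measure"]
    by (auto simp: space_prob2_space)
  have "(\<lambda>\<mu>. \<mu>) \<in> prob2_borel \<rightarrow>\<^sub>M (prob2_space :: 'a measure measure)"
    unfolding prob2_space_def
  proof (rule measurable_restrict_space2)
    show "(\<lambda>\<mu>. \<mu>) \<in> prob2_borel \<rightarrow>\<^sub>M prob_algebra (borel :: 'a measure)"
    proof (rule measurable_prob_algebra_generated)
      show "sets (borel :: 'a measure) = sigma_sets UNIV {A. closed A}"
        unfolding borel_eq_closed by simp
      show "Int_stable {A :: 'a set. closed A}" by (auto simp: Int_stable_def)
    qed (auto simp: space_prob2_borel prob2D measurable_prob2_borel_closed)
  qed (simp add: space_prob2_borel)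
  then have "(\<lambda>\<mu>. \<mu>) -` X \<inter> space prob2_borel \<in> sets prob2_borel" if "X \<in> sets (prob2_space :: 'a measure measure)" for X
    using that by (rule measurable_sets)
  moreover have "(\<lambda>\<mu>. \<mu>) -` X \<inter> space prob2_borel = X" if "X \<in> sets (prob2_space :: 'a measure measure)" for X
    using sets.sets_into_space[OF that] by (auto simp: space_prob2_borel space_prob2_space)
  ultimately show "sets (prob2_space :: 'a measure measure) \<subseteq> sets prob2_borel" by (metis subsetI)
qed

lemma measurable_w2:
  "(\<lambda>w. w2 (fst w) (snd w)) \<in> borel_measurable (prob2_space \<Otimes>\<^sub>M (prob2_space :: 'a::{metric_space, second_countable_topology} measure measure))"
proof -
  obtain D where "small_cells (prob2_space :: 'a measure measure) w2 D" by (rule ex_w2_cells)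
  then interpret D: small_cells "prob2_space :: 'a measure measure" w2 D .
  show ?thesis using D.borel_measurable_d by (simp add: case_prod_unfold)
qed

section \<open>Measurable selection of optimal plans\<close>

text \<open>The factor 5 is 1 for the near-optimality of the coupling plus 4 for the error of the
  cells.\<close>

lemma ex_small_gap:
  fixes t \<eta> :: real
  assumes "0 \<le> t" "0 < \<eta>"
  obtains \<rho> where "0 < \<rho>" "(t + 5 * \<rho>)\<^sup>2 \<le> t\<^sup>2 + \<eta>"
proof -
  define \<rho> where "\<rho> = min 1 (\<eta> / (10 * t + 25))"
  have \<rho>: "0 < \<rho>" "\<rho> \<le> 1" "\<rho> \<le> \<eta> / (10 * t + 25)" using assms by (auto simp: \<rho>_def)
  have "(t + 5 * \<rho>)\<^sup>2 = t\<^sup>2 + (10 * t * \<rho> + 25 * (\<rho> * \<rho>))" by (simp add: power2_eq_square algebra_simps)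
  also have "\<rho> * \<rho> \<le> \<rho> * 1" using \<rho> by (intro mult_left_mono) auto
  then have "t\<^sup>2 + (10 * t * \<rho> + 25 * (\<rho> * \<rho>)) \<le> t\<^sup>2 + (10 * t + 25) * \<rho>" by (simp add: algebra_simps)
  also have "(10 * t + 25) * \<rho> \<le> \<eta>" using \<rho>(3) assms by (simp add: pos_le_divide_eq mult.commute)
  finally show ?thesis using \<rho>(1) that by simp
qed

lemma measurable_prob2_space_ident:
  "(\<lambda>\<mu>. \<mu>) \<in> prob2_space \<rightarrow>\<^sub>M prob_algebra (borel :: 'a::metric_space measure)"
  unfolding prob2_space_def by (rule measurable_restrict_space1) simp

context metric_cells
begin

abbreviation W :: "('a measure \<times> 'a measure) measure" where
  "W \<equiv> prob2_space \<Otimes>\<^sub>M prob2_space"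

definition feasible :: "nat \<times> rat list \<Rightarrow> 'a measure \<times> 'a measure \<Rightarrow> bool" where
  "feasible p w \<longleftrightarrow> plan_weights (snd p) \<and> admissible (C (fst p)) ci (snd p) (fst w) \<and> admissible (C (fst p)) cj (snd p) (snd w)"

text \<open>Pairs of measures for which the weights are not feasible receive the product measure, so
  that the value is a coupling for every parameter and every pair.\<close>

definition plan :: "nat \<times> rat list \<Rightarrow> 'a measure \<times> 'a measure \<Rightarrow> ('a \<times> 'a) measure" where
  "plan p w = (if feasible p w
     then density (fst w \<Otimes>\<^sub>M snd w) (\<lambda>z. ennreal (plan_density (C (fst p)) (snd p) (fst w) (snd w) z))
     else fst w \<Otimes>\<^sub>M snd w)"

lemma space_W: "w \<in> space W \<longleftrightarrow> fst w \<in> prob2 \<and> snd w \<in> prob2"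
  by (simp add: space_pair_measure space_prob2_space mem_Times_iff)

lemma plan_couplings:
  assumes "w \<in> space W"
  shows "plan p w \<in> couplings (fst w) (snd w)"
proof (cases "feasible p w")
  case True
  have w: "fst w \<in> prob2" "snd w \<in> prob2" using assms by (auto simp: space_W)
  have "admissible_plan (C (fst p)) (snd p) (fst w) (snd w)"
    using True prob2D(2)[OF w(1)] prob2D(2)[OF w(2)]
    by (intro admissible_planI C_disj prob2D(1) w) (auto simp: C_sets feasible_def)
  then show ?thesis using True by (simp add: plan_def admissible_plan.plan_coupling)
next
  case False
  then show ?thesis using assms by (simp add: plan_def pair_measure_couplings prob2D(1) space_W)
qed

lemma sets_plan:
  assumes "w \<in> space W"
  shows "sets (plan p w) = sets (borel \<Otimes>\<^sub>M borel)"
  using couplings_borelD(1)[OF plan_couplings[OF assms]] assms by (simp add: space_W prob2D(2))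

lemma measurable_feasible: "Measurable.pred W (feasible p)"
proof -
  have 1: "Measurable.pred W (\<lambda>w. admissible (C (fst p)) ci (snd p) (fst w))"
    by (rule measurable_compose[OF measurable_fst measurable_admissible[OF C_sets]])
  have 2: "Measurable.pred W (\<lambda>w. admissible (C (fst p)) cj (snd p) (snd w))"
    by (rule measurable_compose[OF measurable_snd measurable_admissible[OF C_sets]])
  have "Measurable.pred W (\<lambda>w. plan_weights (snd p) \<and> admissible (C (fst p)) ci (snd p) (fst w) \<and> admissible (C (fst p)) cj (snd p) (snd w))"
    by (rule pred_intros_logic(3)[OF _ pred_intros_logic(3)[OF 1 2]]) simp
  then show ?thesis unfolding feasible_def .
qed

lemma measurable_product: "(\<lambda>w. fst w \<Otimes>\<^sub>M snd w) \<in> W \<rightarrow>\<^sub>M prob_algebra (borel \<Otimes>\<^sub>M borel)"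
  by (rule measurable_pair_prob[OF measurable_compose[OF measurable_fst measurable_prob2_space_ident]
        measurable_compose[OF measurable_snd measurable_prob2_space_ident]])

text \<open>The measures enter the formula through the masses of finitely many cells only, and these
  are measurable functions of the measures.\<close>

lemma measurable_plan_density_joint:
  "(\<lambda>q. plan_density (C m) xs (fst (fst q)) (snd (fst q)) (snd q)) \<in> borel_measurable (W \<Otimes>\<^sub>M (borel \<Otimes>\<^sub>M borel))"
proof -
  have m1: "(\<lambda>q. measure (fst (fst q)) (C m k)) \<in> borel_measurable (W \<Otimes>\<^sub>M (borel \<Otimes>\<^sub>M borel))" for k
    by (rule measurable_compose[OF measurable_compose[OF measurable_fst measurable_fst] measurable_prob2_eval[OF C_sets]])
  have m2: "(\<lambda>q. measure (snd (fst q)) (C m k)) \<in> borel_measurable (W \<Otimes>\<^sub>M (borel \<Otimes>\<^sub>M borel))" for k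
    by (rule measurable_compose[OF measurable_compose[OF measurable_fst measurable_snd] measurable_prob2_eval[OF C_sets]])
  have i1: "(\<lambda>q. indicator (C m k) (fst (snd q)) :: real) \<in> borel_measurable (W \<Otimes>\<^sub>M (borel \<Otimes>\<^sub>M borel))" for k
    by (rule measurable_compose[OF measurable_compose[OF measurable_snd measurable_fst] borel_measurable_indicator[OF C_sets]])
  have i2: "(\<lambda>q. indicator (C m k) (snd (snd q)) :: real) \<in> borel_measurable (W \<Otimes>\<^sub>M (borel \<Otimes>\<^sub>M borel))" for k
    by (rule measurable_compose[OF measurable_compose[OF measurable_snd measurable_snd] borel_measurable_indicator[OF C_sets]])
  show ?thesis
    unfolding plan_density_def resid_def
    by (intro borel_measurable_add borel_measurable_sum borel_measurable_times borel_measurable_divide borel_measurable_diff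
        borel_measurable_const m1 m2 i1 i2)
qed

lemma measurable_plan: "plan p \<in> W \<rightarrow>\<^sub>M prob_algebra (borel \<Otimes>\<^sub>M borel)"
proof (rule measurable_prob_algebraI)
  show "prob_space (plan p w)" if "w \<in> space W" for w by (rule couplingsD(1)[OF plan_couplings[OF that]])
  show "plan p \<in> W \<rightarrow>\<^sub>M subprob_algebra (borel \<Otimes>\<^sub>M borel)"
  proof (rule measurable_subprob_algebra)
    show "subprob_space (plan p w)" if "w \<in> space W" for w
      by (rule prob_space_imp_subprob_space[OF couplingsD(1)[OF plan_couplings[OF that]]])
    show "sets (plan p w) = sets (borel \<Otimes>\<^sub>M borel)" if "w \<in> space W" for w by (rule sets_plan[OF that])
    fix D :: "('a \<times> 'a) set" assume D: "D \<in> sets (borel \<Otimes>\<^sub>M borel)"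
    let ?f = "\<lambda>w z. ennreal (plan_density (C (fst p)) (snd p) (fst w) (snd w) z) * indicator D z"
    have m: "(\<lambda>(w, z). ?f w z) \<in> borel_measurable (W \<Otimes>\<^sub>M (borel \<Otimes>\<^sub>M borel))"
      unfolding case_prod_unfold
      by (intro borel_measurable_times_ennreal measurable_compose[OF measurable_plan_density_joint measurable_ennreal]
          measurable_compose[OF measurable_snd borel_measurable_indicator[OF D]])
    have e1: "(\<lambda>w. \<integral>\<^sup>+z. ?f w z \<partial>(fst w \<Otimes>\<^sub>M snd w)) \<in> borel_measurable W"
      by (rule nn_integral_measurable_subprob_algebra2[OF m measurable_prob_algebraD[OF measurable_product]])
    have e2: "(\<lambda>w. emeasure (fst w \<Otimes>\<^sub>M snd w) D) \<in> borel_measurable W"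
      by (rule measurable_compose[OF measurable_prob_algebraD[OF measurable_product] measurable_emeasure_subprob_algebra[OF D]])
    have eq: "emeasure (plan p w) D = (if feasible p w then \<integral>\<^sup>+z. ?f w z \<partial>(fst w \<Otimes>\<^sub>M snd w) else emeasure (fst w \<Otimes>\<^sub>M snd w) D)"
      if w: "w \<in> space W" for w
    proof -
      have s: "sets (fst w \<Otimes>\<^sub>M snd w) = sets (borel \<Otimes>\<^sub>M borel)"
        using measurable_space[OF measurable_product w] by (simp add: space_prob_algebra)
      have "(\<lambda>z. ennreal (plan_density (C (fst p)) (snd p) (fst w) (snd w) z)) \<in> borel_measurable (fst w \<Otimes>\<^sub>M snd w)"
        using measurable_compose[OF measurable_Pair1'[OF w] measurable_plan_density_joint[of "fst p" "snd p"]]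
        by (simp add: measurable_cong_sets[OF s refl])
      then show ?thesis using D s by (simp add: plan_def emeasure_density)
    qed
    have "(\<lambda>w. if feasible p w then \<integral>\<^sup>+z. ?f w z \<partial>(fst w \<Otimes>\<^sub>M snd w) else emeasure (fst w \<Otimes>\<^sub>M snd w) D) \<in> borel_measurable W"
      by (rule measurable_If[OF e1 e2 measurable_feasible[unfolded pred_def]])
    then show "(\<lambda>w. emeasure (plan p w) D) \<in> borel_measurable W"
      by (subst measurable_cong[OF eq]) assumption+
  qed
qed

lemma measurable_plan_cost: "(\<lambda>w. quad_cost dist (plan p w)) \<in> borel_measurable W"
proof -
  have "(\<lambda>z::'a \<times> 'a. ennreal ((dist (fst z) (snd z))\<^sup>2)) \<in> borel_measurable (borel \<Otimes>\<^sub>M borel)" by measurable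
  from measurable_compose[OF measurable_plan nn_integral_measurable_prob_algebra[OF this]]
  show ?thesis unfolding quad_cost_eq .
qed

text \<open>Half of \<eta> goes to the choice of \<rho>, that is to near-optimality and cell size;
  the other half is \<open>8 * (\<eta> / 16)\<close>, the price of the independently coupled rest.
  As \<open>K\<close> enters the bound on the slack, it is fixed before the weights.\<close>

lemma ex_near_optimal_plan:
  assumes w: "w \<in> space W" and \<eta>: "\<eta> > 0"
  shows "\<exists>p. quad_cost dist (plan p w) \<le> ennreal ((w2 (fst w) (snd w))\<^sup>2 + \<eta>)"
proof -
  let ?\<mu> = "fst w" and ?\<nu> = "snd w" and ?x = "undefined :: 'a"
  have \<mu>: "?\<mu> \<in> prob2" and \<nu>: "?\<nu> \<in> prob2" using w by (auto simp: space_W)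
  let ?t = "w2 ?\<mu> ?\<nu>"
  have t: "0 \<le> ?t" by (rule wasserstein2_nonneg)
  obtain \<rho> where \<rho>: "0 < \<rho>" "(?t + 5 * \<rho>)\<^sup>2 \<le> ?t\<^sup>2 + \<eta> / 2"
    using ex_small_gap[OF t, of "\<eta> / 2"] \<eta> by auto
  obtain m where m: "(1/2) ^ m < \<rho>" using real_arch_pow_inv[OF \<rho>(1), of "1/2"] by auto
  obtain \<theta> where \<theta>: "\<theta> \<in> couplings ?\<mu> ?\<nu>" "quad_cost dist \<theta> < ennreal ((?t + \<rho>)\<^sup>2)"
    using wasserstein2_less[OF INF_quad_cost_finite[OF \<mu> \<nu>], of "?t + \<rho>"] \<rho>(1) by auto
  have \<delta>: "\<eta> / 16 > 0" using \<eta> by simp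
  obtain K1 where K1: "\<And>K. K \<ge> K1 \<Longrightarrow> tail ?x K ?\<mu> \<le> ennreal (\<eta> / 16)" using ex_tail_le[OF \<mu> \<delta>] by blast
  obtain K2 where K2: "\<And>K. K \<ge> K2 \<Longrightarrow> tail ?x K ?\<nu> \<le> ennreal (\<eta> / 16)" using ex_tail_le[OF \<nu> \<delta>] by blast
  define K where "K = max K1 K2"
  have t\<rho>: "?t + \<rho> > 0" using t \<rho>(1) by linarith
  have "\<eta> / 16 / real (Suc K) > 0" using \<delta> by (intro divide_pos_pos) auto
  from ex_weights[OF prob2D(2)[OF \<mu>] prob2D(2)[OF \<nu>] \<theta>(1) less_imp_le[OF \<theta>(2)] t\<rho> this, of m]
  obtain xs where xs: "plan_weights xs" "admissible (C m) ci xs ?\<mu>" "admissible (C m) cj xs ?\<nu>" "slack xs < \<eta> / 16 / real (Suc K)"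
    "(\<Sum>i<length xs. wt xs i * mcost m i) \<le> (?t + \<rho> + 4 * (1/2) ^ m)\<^sup>2" by blast
  have "real K * slack xs \<le> real (Suc K) * slack xs" using xs(1) by (intro mult_right_mono) (auto simp: plan_weights_def)
  also have "\<dots> = slack xs * real (Suc K)" by (rule mult.commute)
  also have "\<dots> \<le> \<eta> / 16"
    by (rule less_imp_le, rule pos_less_divide_eq[THEN iffD1, OF _ xs(4)]) (rule of_nat_0_less_iff[THEN iffD2, OF zero_less_Suc])
  finally have Ks: "real K * slack xs \<le> \<eta> / 16" .
  have t1: "tail ?x K ?\<mu> \<le> ennreal (\<eta> / 16)" by (rule K1) (simp add: K_def)
  have t2: "tail ?x K ?\<nu> \<le> ennreal (\<eta> / 16)" by (rule K2) (simp add: K_def)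
  have "quad_cost dist (plan (m, xs) w) \<le> ennreal ((?t + \<rho> + 4 * (1/2) ^ m)\<^sup>2 + 8 * (\<eta> / 16))"
    using plan_of_weights(2)[OF \<mu> \<nu> xs(1,2,3,5) less_imp_le[OF \<delta>] Ks t1 t2] xs(1,2,3)
    by (simp add: plan_def feasible_def)
  also have "\<dots> \<le> ennreal (?t\<^sup>2 + \<eta>)"
  proof (rule ennreal_leI)
    have "(?t + \<rho> + 4 * (1/2) ^ m)\<^sup>2 \<le> (?t + 5 * \<rho>)\<^sup>2"
      using m t \<rho>(1) by (intro power_mono add_nonneg_nonneg) auto
    then show "(?t + \<rho> + 4 * (1/2) ^ m)\<^sup>2 + 8 * (\<eta> / 16) \<le> ?t\<^sup>2 + \<eta>" using \<rho>(2) by simp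
  qed
  finally show ?thesis by blast
qed

end

text \<open>Near-optimal plans are picked measurably from a countable family; a measurable subsequence converges
  to an optimal plan.\<close>

lemma measurable_optimal_plan:
  obtains \<gamma> :: "'a::{complete_space, second_countable_topology} measure \<times> 'a measure \<Rightarrow> ('a \<times> 'a) measure"
  where "\<gamma> \<in> prob2_space \<Otimes>\<^sub>M prob2_space \<rightarrow>\<^sub>M prob_algebra (borel \<Otimes>\<^sub>M borel)"
    "\<And>\<mu> \<nu>. \<mu> \<in> prob2 \<Longrightarrow> \<nu> \<in> prob2 \<Longrightarrow> \<gamma> (\<mu>, \<nu>) \<in> couplings \<mu> \<nu>"
    "\<And>\<mu> \<nu>. \<mu> \<in> prob2 \<Longrightarrow> \<nu> \<in> prob2 \<Longrightarrow> quad_cost dist (\<gamma> (\<mu>, \<nu>)) = ennreal ((w2 \<mu> \<nu>)\<^sup>2)"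
proof -
  obtain C where "metric_cells (C :: nat \<Rightarrow> nat \<Rightarrow> 'a set)" by (rule ex_metric_cells)
  then interpret C: metric_cells C .
  obtain h0 :: "'a \<Rightarrow> nat \<Rightarrow> bool" and g0 where "bit_coded borel h0 g0" by (rule bit_coded_polish)
  from C.ex_coded_cells[OF this] obtain h g b where "coded_cells borel dist C h g b" by blast
  then interpret cc: coded_cells borel dist C h g b .
  let ?W = "(prob2_space :: 'a measure measure) \<Otimes>\<^sub>M (prob2_space :: 'a measure measure)"
  let ?w = "\<lambda>w. (w2 (fst w) (snd w))\<^sup>2 :: real"
  let ?near = "\<lambda>n k w. quad_cost dist (C.plan (from_nat k) w) \<le> ennreal (?w w + 1 / real (Suc n))"
  \<comment> \<open>The least suitable index of an enumeration is a measurable function of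
    \<open>w\<close>, since each condition \<open>?near n k\<close> is measurable.\<close>
  define i where "i n w = (LEAST k. ?near n k w)" for n w
  have near: "?near n (i n w) w" if w: "w \<in> space ?W" for n w
  proof -
    have "1 / real (Suc n) > 0" by (intro divide_pos_pos) auto
    from C.ex_near_optimal_plan[OF w this] obtain p where "quad_cost dist (C.plan p w) \<le> ennreal (?w w + 1 / real (Suc n))" ..
    then have "?near n (to_nat p) w" by simp
    then show ?thesis unfolding i_def by (rule LeastI)
  qed
  have "Measurable.pred ?W (?near n k)" for n k
    unfolding pred_def
    by (intro borel_measurable_le C.measurable_plan_cost measurable_compose[OF _ measurable_ennreal] borel_measurable_add
        borel_measurable_power measurable_w2 borel_measurable_const)
  then have i: "i n \<in> ?W \<rightarrow>\<^sub>M count_space UNIV" for n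
    unfolding i_def by (rule measurable_Least)
  define \<gamma> where "\<gamma> n w = C.plan (from_nat (i n w)) w" for n w
  have w_alg: "fst w \<in> space (prob_algebra borel)" "snd w \<in> space (prob_algebra borel)" if "w \<in> space ?W" for w
  proof -
    have "fst w \<in> prob2 \<and> snd w \<in> prob2" using that unfolding C.space_W .
    then show "fst w \<in> space (prob_algebra borel)" "snd w \<in> space (prob_algebra borel)" by (simp_all add: prob2D(4))
  qed
  have meas: "(\<lambda>w. measure (\<gamma> n w) A) \<in> borel_measurable ?W" if A: "A \<in> sets (borel \<Otimes>\<^sub>M borel)" for n A
    unfolding \<gamma>_def
    by (rule measurable_compose_countable[where f = "\<lambda>k w. measure (C.plan (from_nat k) w) A", OF _ i],
        rule measurable_compose[OF C.measurable_plan measurable_measure_prob_algebra[OF A]])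
  have lim: "(\<lambda>n. quad_cost dist (\<gamma> n w)) \<longlonglongrightarrow> ennreal (?w w)" if w: "w \<in> space ?W" for w
  proof (rule tendsto_sandwich[where f = "\<lambda>_. ennreal (?w w)" and h = "\<lambda>n. ennreal (?w w + 1 / real (Suc n))"])
    have "(\<lambda>n. 1 / real (Suc n)) \<longlonglongrightarrow> 0" by (rule LIMSEQ_Suc[OF lim_1_over_n])
    from tendsto_add[OF tendsto_const[of "?w w"] this]
    have "(\<lambda>n. ?w w + 1 / real (Suc n)) \<longlonglongrightarrow> ?w w" by simp
    then show "(\<lambda>n. ennreal (?w w + 1 / real (Suc n))) \<longlonglongrightarrow> ennreal (?w w)" by (rule tendsto_ennrealI)
    show "\<forall>\<^sub>F n in sequentially. ennreal (?w w) \<le> quad_cost dist (\<gamma> n w)"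
      using w by (intro always_eventually allI w2_sq_le) (auto simp: \<gamma>_def C.space_W C.plan_couplings)
    show "\<forall>\<^sub>F n in sequentially. quad_cost dist (\<gamma> n w) \<le> ennreal (?w w + 1 / real (Suc n))"
      unfolding \<gamma>_def by (intro always_eventually allI near[OF w])
  qed (rule tendsto_const)
  obtain \<gamma>' where \<gamma>': "\<gamma>' \<in> ?W \<rightarrow>\<^sub>M prob_algebra (borel \<Otimes>\<^sub>M borel)"
    "\<And>w. w \<in> space ?W \<Longrightarrow> \<gamma>' w \<in> couplings (fst w) (snd w)"
    "\<And>w. w \<in> space ?W \<Longrightarrow> quad_cost dist (\<gamma>' w) \<le> ennreal (?w w)"
    by (rule cc.measurable_coupling_limit[where W = ?W and \<mu> = fst and \<nu> = snd and \<gamma> = \<gamma> and c = "\<lambda>w. ennreal (?w w)",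
          OF w_alg(1) w_alg(2) _ meas lim]) (auto simp: \<gamma>_def C.plan_couplings that)
  show ?thesis
  proof (rule that[OF \<gamma>'(1)])
    fix \<mu> \<nu> :: "'a measure" assume "\<mu> \<in> prob2" "\<nu> \<in> prob2"
    then have w: "(\<mu>, \<nu>) \<in> space ?W" by (simp add: C.space_W)
    show c: "\<gamma>' (\<mu>, \<nu>) \<in> couplings \<mu> \<nu>" using \<gamma>'(2)[OF w] by simp
    show "quad_cost dist (\<gamma>' (\<mu>, \<nu>)) = ennreal ((w2 \<mu> \<nu>)\<^sup>2)"
      using \<gamma>'(3)[OF w] w2_sq_le[OF \<open>\<mu> \<in> prob2\<close> \<open>\<nu> \<in> prob2\<close> c] by (intro antisym) simp_all
  qed
qed

section \<open>Random couplings\<close>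

lemma opt_couplings_iff:
  "\<theta> \<in> opt_couplings d \<mu> \<nu> \<longleftrightarrow> \<theta> \<in> couplings \<mu> \<nu> \<and> quad_cost d \<theta> = opt_cost d \<mu> \<nu>"
proof
  assume "\<theta> \<in> opt_couplings d \<mu> \<nu>"
  then have \<theta>: "\<theta> \<in> couplings \<mu> \<nu>" "\<And>\<theta>'. \<theta>' \<in> couplings \<mu> \<nu> \<Longrightarrow> quad_cost d \<theta> \<le> quad_cost d \<theta>'"
    by (auto simp: opt_couplings_def is_arg_min_def not_less)
  then show "\<theta> \<in> couplings \<mu> \<nu> \<and> quad_cost d \<theta> = opt_cost d \<mu> \<nu>"
    by (auto intro!: antisym INF_greatest INF_lower)
next
  assume *: "\<theta> \<in> couplings \<mu> \<nu> \<and> quad_cost d \<theta> = opt_cost d \<mu> \<nu>"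
  then have "quad_cost d \<theta> \<le> quad_cost d \<theta>'" if "\<theta>' \<in> couplings \<mu> \<nu>" for \<theta>'
    using that by (simp add: INF_lower)
  then show "\<theta> \<in> opt_couplings d \<mu> \<nu>" using * by (auto simp: opt_couplings_def is_arg_min_def not_less)
qed

lemma random_cost_eq: "random_cost P = (\<integral>\<^sup>+\<gamma>. quad_cost dist \<gamma> \<partial>P)"
  by (simp add: random_cost_def quad_cost_def dist_norm)

lemma measurable_moment:
  "moment x0 \<in> borel_measurable (prob2_space :: 'a::{metric_space, second_countable_topology} measure measure)"
  by (rule measurable_compose[OF measurable_prob2_space_ident nn_integral_measurable_prob_algebra]) measurable

text \<open>The squared distance on the product is the sum of the squared distances of the
  components. Finite second moments thus pass from a coupling to its marginals and back.\<close>

lemma prob2_pair_moment: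
  fixes \<gamma> :: "('a::{metric_space, second_countable_topology} \<times> 'a) measure"
  assumes s: "sets \<gamma> = sets (borel \<Otimes>\<^sub>M borel)"
  shows "moment (x0, x0) \<gamma> = moment x0 (marg1 \<gamma>) + moment x0 (marg2 \<gamma>)"
proof -
  note [measurable_cong] = s
  have "moment (x0, x0) \<gamma> = (\<integral>\<^sup>+z. ennreal ((dist x0 (fst z))\<^sup>2) + ennreal ((dist x0 (snd z))\<^sup>2) \<partial>\<gamma>)"
    by (intro nn_integral_cong) (simp add: dist_prod_def ennreal_plus[symmetric] del: ennreal_plus)
  also have "\<dots> = (\<integral>\<^sup>+z. ennreal ((dist x0 (fst z))\<^sup>2) \<partial>\<gamma>) + (\<integral>\<^sup>+z. ennreal ((dist x0 (snd z))\<^sup>2) \<partial>\<gamma>)"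
    by (rule nn_integral_add) measurable
  also have "(\<integral>\<^sup>+z. ennreal ((dist x0 (fst z))\<^sup>2) \<partial>\<gamma>) = moment x0 (marg1 \<gamma>)"
    by (rule nn_integral_distr[symmetric]) measurable
  also have "(\<integral>\<^sup>+z. ennreal ((dist x0 (snd z))\<^sup>2) \<partial>\<gamma>) = moment x0 (marg2 \<gamma>)"
    by (rule nn_integral_distr[symmetric]) measurable
  finally show ?thesis .
qed

lemma prob2_pairD:
  fixes \<gamma> :: "('a::{metric_space, second_countable_topology} \<times> 'a) measure"
  assumes \<gamma>: "\<gamma> \<in> prob2"
  shows "sets \<gamma> = sets (borel \<Otimes>\<^sub>M borel)" "marg1 \<gamma> \<in> prob2" "marg2 \<gamma> \<in> prob2" "\<gamma> \<in> couplings (marg1 \<gamma>) (marg2 \<gamma>)"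
proof -
  show s: "sets \<gamma> = sets (borel \<Otimes>\<^sub>M borel)" using prob2D(2)[OF \<gamma>] unfolding borel_prod .
  note [measurable_cong] = s
  have m: "fst \<in> \<gamma> \<rightarrow>\<^sub>M borel" "snd \<in> \<gamma> \<rightarrow>\<^sub>M borel" by measurable
  have "moment x0 (marg1 \<gamma>) + moment x0 (marg2 \<gamma>) < \<infinity>" for x0
    using prob2D(3)[OF \<gamma>, of "(x0, x0)"] unfolding prob2_pair_moment[OF s] .
  then have f: "moment undefined (marg1 \<gamma>) < \<infinity>" "moment undefined (marg2 \<gamma>) < \<infinity>"
    by (auto simp: less_top[symmetric] ennreal_add_eq_top)
  show "marg1 \<gamma> \<in> prob2" "marg2 \<gamma> \<in> prob2"
    by (rule prob2I[OF prob_space.prob_space_distr[OF prob2D(1)[OF \<gamma>] m(1)] _ f(1)], simp)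
       (rule prob2I[OF prob_space.prob_space_distr[OF prob2D(1)[OF \<gamma>] m(2)] _ f(2)], simp)
  have "distr \<gamma> (marg1 \<gamma>) fst = marg1 \<gamma>" "distr \<gamma> (marg2 \<gamma>) snd = marg2 \<gamma>"
    by (rule distr_cong; simp)+
  moreover have "sets (marg1 \<gamma> \<Otimes>\<^sub>M marg2 \<gamma>) = sets (borel \<Otimes>\<^sub>M borel)"
    by (rule sets_pair_measure_cong) simp_all
  ultimately show "\<gamma> \<in> couplings (marg1 \<gamma>) (marg2 \<gamma>)"
    using prob2D(1)[OF \<gamma>] s by (simp add: couplings_def)
qed

lemma coupling_prob2:
  fixes \<mu> \<nu> :: "'a::{metric_space, second_countable_topology} measure"
  assumes \<mu>: "\<mu> \<in> prob2" and \<nu>: "\<nu> \<in> prob2" and \<gamma>: "\<gamma> \<in> couplings \<mu> \<nu>"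
  shows "\<gamma> \<in> prob2" "marg1 \<gamma> = \<mu>" "marg2 \<gamma> = \<nu>"
proof -
  note s = couplings_borelD[OF \<gamma> prob2D(2)[OF \<mu>] prob2D(2)[OF \<nu>]]
  have "marg1 \<gamma> = distr \<gamma> \<mu> fst" by (rule distr_cong) (simp_all add: prob2D(2)[OF \<mu>])
  then show 1: "marg1 \<gamma> = \<mu>" by (simp add: couplingsD(3)[OF \<gamma>])
  have "marg2 \<gamma> = distr \<gamma> \<nu> snd" by (rule distr_cong) (simp_all add: prob2D(2)[OF \<nu>])
  then show 2: "marg2 \<gamma> = \<nu>" by (simp add: couplingsD(4)[OF \<gamma>])
  have "moment (undefined, undefined) \<gamma> < \<infinity>"
    unfolding prob2_pair_moment[OF s(1)] 1 2 using prob2D(3)[OF \<mu>, of undefined] prob2D(3)[OF \<nu>, of undefined]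
    by (simp add: less_top[symmetric] ennreal_add_eq_top)
  then show "\<gamma> \<in> prob2" by (rule prob2I[OF couplingsD(1)[OF \<gamma>] s(2)])
qed

text \<open>Push-forward is measurable for the sigma-algebras generated by evaluation;
  \<open>sets_prob2_borel\<close>, over pairs and over points, translates this to the Borel
  sets.\<close>

lemma measurable_marg:
  "marg1 \<in> prob2_borel \<rightarrow>\<^sub>M (prob2_borel :: 'a::{metric_space, second_countable_topology} measure measure)"
  "marg2 \<in> prob2_borel \<rightarrow>\<^sub>M (prob2_borel :: 'a::{metric_space, second_countable_topology} measure measure)"
proof -
  have m: "(fst :: 'a \<times> 'a \<Rightarrow> 'a) \<in> borel \<rightarrow>\<^sub>M borel" "(snd :: 'a \<times> 'a \<Rightarrow> 'a) \<in> borel \<rightarrow>\<^sub>M borel"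
    unfolding borel_prod[symmetric] by (rule measurable_fst measurable_snd)+
  have "marg1 \<in> prob2_space \<rightarrow>\<^sub>M (prob2_space :: 'a measure measure)" "marg2 \<in> prob2_space \<rightarrow>\<^sub>M (prob2_space :: 'a measure measure)"
    unfolding prob2_space_def[where 'a = 'a]
    by (intro measurable_restrict_space2 measurable_compose[OF measurable_prob2_space_ident measurable_distr_prob_space] m;
        auto simp: space_prob2_space prob2_pairD)+
  then show "marg1 \<in> prob2_borel \<rightarrow>\<^sub>M (prob2_borel :: 'a measure measure)" "marg2 \<in> prob2_borel \<rightarrow>\<^sub>M (prob2_borel :: 'a measure measure)"
    by (simp_all only: measurable_cong_sets[OF sets_prob2_borel sets_prob2_borel])
qed

lemma measurable_quad_cost_prob2:
  "quad_cost dist \<in> borel_measurable (prob2_borel :: ('a::{metric_space, second_countable_topology} \<times> 'a) measure measure)"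
proof -
  have "(\<lambda>z::'a \<times> 'a. ennreal ((dist (fst z) (snd z))\<^sup>2)) \<in> borel_measurable borel"
    unfolding borel_prod[symmetric] by measurable
  from measurable_compose[OF measurable_prob2_space_ident nn_integral_measurable_prob_algebra[OF this]]
  show ?thesis unfolding quad_cost_eq[abs_def] measurable_cong_sets[OF sets_prob2_borel refl] .
qed

lemma measurable_w2_borel:
  "(\<lambda>w. ennreal ((w2 (fst w) (snd w))\<^sup>2)) \<in> borel_measurable (prob2_borel \<Otimes>\<^sub>M (prob2_borel :: 'a::{metric_space, second_countable_topology} measure measure))"
  unfolding measurable_cong_sets[OF sets_pair_measure_cong[OF sets_prob2_borel sets_prob2_borel] refl]
  by (intro measurable_compose[OF _ measurable_ennreal] borel_measurable_power measurable_w2)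

lemma w2_sq_le_moments:
  fixes \<mu> \<nu> :: "'a::{metric_space, second_countable_topology} measure"
  assumes "\<mu> \<in> prob2" "\<nu> \<in> prob2"
  shows "ennreal ((w2 \<mu> \<nu>)\<^sup>2) \<le> 2 * moment x0 \<mu> + 2 * moment x0 \<nu>"
proof -
  have c: "\<mu> \<Otimes>\<^sub>M \<nu> \<in> couplings \<mu> \<nu>" by (intro pair_measure_couplings prob2D assms)
  show ?thesis
    using w2_sq_le[OF assms c] quad_cost_le_moments[OF c prob2D(2)[OF assms(1)] prob2D(2)[OF assms(2)], of x0]
    by (rule order_trans)
qed

text \<open>Integrability of the squared distance to some unspecified measure is converted by
  \<open>moment_le_w2\<close> into integrability of the second moment about any point, a quantity
  that is additive over the marginals of a coupling.\<close>

lemma prob2_prob2D: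
  fixes M :: "'a::{metric_space, second_countable_topology} measure measure"
  assumes M: "M \<in> prob2_prob2"
  shows "prob_space M" "sets M = sets prob2_borel" "space M = prob2" "(\<integral>\<^sup>+\<mu>. moment x0 \<mu> \<partial>M) < \<infinity>"
    "M \<in> space (prob_algebra prob2_space)"
proof -
  show p: "prob_space M" and s: "sets M = sets prob2_borel" using M by (auto simp: P2_def)
  show sp: "space M = prob2" using sets_eq_imp_space_eq[OF s] by (simp add: space_prob2_borel)
  show "M \<in> space (prob_algebra prob2_space)" using p s by (simp add: space_prob_algebra sets_prob2_borel)
  interpret prob_space M by fact
  have s': "sets M = sets prob2_space" using s sets_prob2_borel by simp
  obtain \<mu>0 where \<mu>0: "\<mu>0 \<in> prob2" "(\<integral>\<^sup>+\<mu>. ennreal ((w2 \<mu>0 \<mu>)\<^sup>2) \<partial>M) < \<infinity>" using M by (auto simp: P2_def)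
  have m: "(\<lambda>\<mu>. ennreal ((w2 \<mu>0 \<mu>)\<^sup>2)) \<in> borel_measurable M"
  proof -
    have "(\<lambda>\<mu>. w2 \<mu>0 \<mu>) \<in> borel_measurable prob2_space"
      using measurable_compose[OF measurable_Pair1' measurable_w2, of \<mu>0] \<mu>0(1) by (simp add: space_prob2_space)
    then show ?thesis unfolding measurable_cong_sets[OF s' refl]
      by (intro measurable_compose[OF _ measurable_ennreal] borel_measurable_power)
  qed
  have "(\<integral>\<^sup>+\<mu>. moment x0 \<mu> \<partial>M) \<le> (\<integral>\<^sup>+\<mu>. 2 * moment x0 \<mu>0 + 2 * ennreal ((w2 \<mu>0 \<mu>)\<^sup>2) \<partial>M)"
    by (intro nn_integral_mono moment_le_w2 \<mu>0(1)) (simp add: sp)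
  also have "\<dots> = 2 * moment x0 \<mu>0 + 2 * (\<integral>\<^sup>+\<mu>. ennreal ((w2 \<mu>0 \<mu>)\<^sup>2) \<partial>M)"
    using m by (simp add: nn_integral_add nn_integral_cmult emeasure_space_1)
  also have "\<dots> < \<infinity>"
    using \<mu>0(2) prob2D(3)[OF \<mu>0(1), of x0] by (simp add: less_top[symmetric] ennreal_add_eq_top ennreal_mult_eq_top_iff)
  finally show "(\<integral>\<^sup>+\<mu>. moment x0 \<mu> \<partial>M) < \<infinity>" .
qed

lemma prob2_prob2I:
  fixes M :: "'a::{metric_space, second_countable_topology} measure measure"
  assumes p: "prob_space M" and s: "sets M = sets prob2_borel" and fin: "(\<integral>\<^sup>+\<mu>. moment x0 \<mu> \<partial>M) < \<infinity>"
  shows "M \<in> prob2_prob2"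
proof -
  interpret prob_space M by fact
  have s': "sets M = sets prob2_space" using s sets_prob2_borel by simp
  have sp: "space M = prob2" using sets_eq_imp_space_eq[OF s] by (simp add: space_prob2_borel)
  then obtain \<mu>0 where \<mu>0: "\<mu>0 \<in> (prob2 :: 'a measure set)" using not_empty by auto
  have m: "moment x0 \<in> borel_measurable M" unfolding measurable_cong_sets[OF s' refl] by (rule measurable_moment)
  have "(\<integral>\<^sup>+\<mu>. ennreal ((w2 \<mu>0 \<mu>)\<^sup>2) \<partial>M) \<le> (\<integral>\<^sup>+\<mu>. 2 * moment x0 \<mu>0 + 2 * moment x0 \<mu> \<partial>M)"
    by (intro nn_integral_mono w2_sq_le_moments \<mu>0(1)) (simp add: sp)
  also have "\<dots> = 2 * moment x0 \<mu>0 + 2 * (\<integral>\<^sup>+\<mu>. moment x0 \<mu> \<partial>M)"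
    using m by (simp add: nn_integral_add nn_integral_cmult emeasure_space_1)
  also have "\<dots> < \<infinity>"
    using fin prob2D(3)[OF \<mu>0(1), of x0] by (simp add: less_top[symmetric] ennreal_add_eq_top ennreal_mult_eq_top_iff)
  finally show ?thesis using p s \<mu>0 by (auto simp: P2_def)
qed

section \<open>The random cost compared with \<open>W2\<close>\<close>

context
  fixes M1 M2 :: "'h::{real_normed_vector, complete_space, second_countable_topology} measure measure"
  assumes M: "M1 \<in> prob2_prob2" "M2 \<in> prob2_prob2"
begin

lemma INF_quad_cost_w2_finite: "opt_cost w2 M1 M2 < \<infinity>"
proof -
  note 1 = prob2_prob2D[OF M(1)] and 2 = prob2_prob2D[OF M(2)]
  let ?\<Theta> = "M1 \<Otimes>\<^sub>M M2"
  have c: "?\<Theta> \<in> couplings M1 M2" by (rule pair_measure_couplings[OF 1(1) 2(1)])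
  have m1: "moment 0 \<in> borel_measurable M1" and m2: "moment 0 \<in> borel_measurable M2"
    using measurable_moment[of "0 :: 'h"] 1(2) 2(2) sets_prob2_borel[where 'a = 'h]
    by (simp_all cong: measurable_cong_sets)
  have "quad_cost w2 ?\<Theta> \<le> (\<integral>\<^sup>+w. 2 * moment 0 (fst w) + 2 * moment 0 (snd w) \<partial>?\<Theta>)"
    unfolding quad_cost_eq
    by (intro nn_integral_mono w2_sq_le_moments) (auto simp: space_pair_measure 1(3) 2(3))
  also have "\<dots> = 2 * (\<integral>\<^sup>+w. moment 0 (fst w) \<partial>?\<Theta>) + 2 * (\<integral>\<^sup>+w. moment 0 (snd w) \<partial>?\<Theta>)"
    using measurable_compose[OF measurable_fst m1, of M2] measurable_compose[OF measurable_snd m2, of M1]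
    by (simp add: nn_integral_add nn_integral_cmult)
  also have "\<dots> = 2 * (\<integral>\<^sup>+\<mu>. moment 0 \<mu> \<partial>M1) + 2 * (\<integral>\<^sup>+\<mu>. moment 0 \<mu> \<partial>M2)"
    by (simp only: coupling_nn_integral_fst[OF c m1] coupling_nn_integral_snd[OF c m2])
  also have "\<dots> < \<infinity>"
    using 1(4)[of 0] 2(4)[of 0] by (simp add: less_top[symmetric] ennreal_add_eq_top ennreal_mult_eq_top_iff)
  finally show ?thesis using c by (auto intro: INF_lower le_less_trans)
qed

lemma W2_sq: "ennreal ((W2 M1 M2)\<^sup>2) = opt_cost w2 M1 M2"
  by (rule wasserstein2_sq[OF INF_quad_cost_w2_finite])

text \<open>The Wasserstein space fits the setting of \<open>coded_cells\<close>: its code comes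
  from the coding of probability measures, restricted to the measurable set \<open>prob2\<close>,
  and its cells from \<open>ex_w2_cells\<close>.\<close>

lemma optimal_w2_coupling_exists:
  obtains \<Theta> where "\<Theta> \<in> couplings M1 M2" "quad_cost w2 \<Theta> = ennreal ((W2 M1 M2)\<^sup>2)"
proof -
  obtain h0 :: "'h \<Rightarrow> nat \<Rightarrow> bool" and g0 where "bit_coded borel h0 g0" by (rule bit_coded_polish)
  from bit_coded_prob_algebra[OF this]
  obtain h1 g1 where h1: "bit_coded (prob_algebra (borel :: 'h measure)) h1 g1" by blast
  obtain \<mu>0 where "\<mu>0 \<in> (prob2 :: 'h measure set)"
    using prob_space.not_empty[OF prob2_prob2D(1)[OF M(1)]] prob2_prob2D(3)[OF M(1)] by auto
  from bit_coded_restrict[OF h1 prob2_in_sets this]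
  have code: "bit_coded (prob2_space :: 'h measure measure) h1 (\<lambda>b. if g1 b \<in> prob2 then g1 b else \<mu>0)"
    unfolding prob2_space_def .
  obtain D where "small_cells (prob2_space :: 'h measure measure) w2 D" by (rule ex_w2_cells)
  from small_cells.ex_coded_cells[OF this code]
  obtain h g b where "coded_cells (prob2_space :: 'h measure measure) w2 D h g b" by blast
  from coded_cells.optimal_coupling_exists[OF this prob2_prob2D(5)[OF M(1)] prob2_prob2D(5)[OF M(2)]]
  show ?thesis using that unfolding W2_sq by blast
qed

lemma random_coupling_marginals:
  assumes P: "P \<in> random_couplings M1 M2"
  defines "\<Theta> \<equiv> distr P (prob2_borel \<Otimes>\<^sub>M prob2_borel) (\<lambda>\<gamma>. (marg1 \<gamma>, marg2 \<gamma>))"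
  shows "\<Theta> \<in> couplings M1 M2"
    "quad_cost w2 \<Theta> = (\<integral>\<^sup>+\<gamma>. ennreal ((w2 (marg1 \<gamma>) (marg2 \<gamma>))\<^sup>2) \<partial>P)"
    "(\<lambda>\<gamma>. ennreal ((w2 (marg1 \<gamma>) (marg2 \<gamma>))\<^sup>2)) \<in> borel_measurable P"
    "quad_cost dist \<in> borel_measurable P"
    "\<And>\<gamma>. \<gamma> \<in> space P \<Longrightarrow> ennreal ((w2 (marg1 \<gamma>) (marg2 \<gamma>))\<^sup>2) \<le> quad_cost dist \<gamma>"
    "space P = prob2"
proof -
  have P2: "P \<in> prob2_prob2" and d: "distr P prob2_borel marg1 = M1" "distr P prob2_borel marg2 = M2"
    using P by (auto simp: random_couplings_def)
  note p = prob2_prob2D[OF P2]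
  have m1: "marg1 \<in> P \<rightarrow>\<^sub>M prob2_borel" and m2: "marg2 \<in> P \<rightarrow>\<^sub>M prob2_borel"
    unfolding measurable_cong_sets[OF p(2) refl] by (rule measurable_marg)+
  have m: "(\<lambda>\<gamma>. (marg1 \<gamma>, marg2 \<gamma>)) \<in> P \<rightarrow>\<^sub>M prob2_borel \<Otimes>\<^sub>M prob2_borel"
    by (rule measurable_Pair[OF m1 m2])
  show sp: "space P = prob2" by (rule p(3))
  note s1 = prob2_prob2D(2)[OF M(1)] and s2 = prob2_prob2D(2)[OF M(2)]
  have "distr \<Theta> M1 fst = distr \<Theta> prob2_borel fst" by (rule distr_cong) (simp_all add: s1)
  also have "\<dots> = M1"
    unfolding \<Theta>_def by (subst distr_distr[OF measurable_fst m]) (simp add: o_def d)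
  finally have 1: "distr \<Theta> M1 fst = M1" .
  have "distr \<Theta> M2 snd = distr \<Theta> prob2_borel snd" by (rule distr_cong) (simp_all add: s2)
  also have "\<dots> = M2"
    unfolding \<Theta>_def by (subst distr_distr[OF measurable_snd m]) (simp add: o_def d)
  finally have 2: "distr \<Theta> M2 snd = M2" .
  have "sets \<Theta> = sets (M1 \<Otimes>\<^sub>M M2)"
    unfolding \<Theta>_def sets_distr by (rule sets_pair_measure_cong[OF s1 s2, symmetric])
  then show "\<Theta> \<in> couplings M1 M2"
    using 1 2 prob_space.prob_space_distr[OF p(1) m] by (simp add: couplings_def \<Theta>_def)
  show "quad_cost w2 \<Theta> = (\<integral>\<^sup>+\<gamma>. ennreal ((w2 (marg1 \<gamma>) (marg2 \<gamma>))\<^sup>2) \<partial>P)"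
    unfolding quad_cost_eq \<Theta>_def using nn_integral_distr[OF m, of "\<lambda>w. ennreal ((w2 (fst w) (snd w))\<^sup>2)"] measurable_w2_borel by simp
  show "(\<lambda>\<gamma>. ennreal ((w2 (marg1 \<gamma>) (marg2 \<gamma>))\<^sup>2)) \<in> borel_measurable P"
    using measurable_compose[OF m measurable_w2_borel] by simp
  show "quad_cost dist \<in> borel_measurable P"
    unfolding measurable_cong_sets[OF p(2) refl] by (rule measurable_quad_cost_prob2)
  show "ennreal ((w2 (marg1 \<gamma>) (marg2 \<gamma>))\<^sup>2) \<le> quad_cost dist \<gamma>" if "\<gamma> \<in> space P" for \<gamma>
    using that unfolding sp by (intro w2_sq_le prob2_pairD)
qed

lemma W2_sq_le_random_cost:
  assumes P: "P \<in> random_couplings M1 M2"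
  shows "ennreal ((W2 M1 M2)\<^sup>2) \<le> random_cost P"
proof -
  note r = random_coupling_marginals[OF P]
  have "ennreal ((W2 M1 M2)\<^sup>2) \<le> quad_cost w2 (distr P (prob2_borel \<Otimes>\<^sub>M prob2_borel) (\<lambda>\<gamma>. (marg1 \<gamma>, marg2 \<gamma>)))"
    unfolding W2_sq by (rule INF_lower[OF r(1)])
  also have "\<dots> \<le> random_cost P"
    unfolding r(2) random_cost_eq by (intro nn_integral_mono r(5))
  finally show ?thesis .
qed

lemma optimal_random_coupling_exists:
  obtains P where "P \<in> random_couplings M1 M2" "random_cost P = ennreal ((W2 M1 M2)\<^sup>2)"
proof -
  obtain \<Theta> where \<Theta>: "\<Theta> \<in> couplings M1 M2" "quad_cost w2 \<Theta> = ennreal ((W2 M1 M2)\<^sup>2)"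
    by (rule optimal_w2_coupling_exists)
  obtain \<gamma> :: "'h measure \<times> 'h measure \<Rightarrow> ('h \<times> 'h) measure"
    where \<gamma>m: "\<gamma> \<in> prob2_space \<Otimes>\<^sub>M prob2_space \<rightarrow>\<^sub>M prob_algebra (borel \<Otimes>\<^sub>M borel)"
    and \<gamma>c: "\<And>\<mu> \<nu>. \<mu> \<in> prob2 \<Longrightarrow> \<nu> \<in> prob2 \<Longrightarrow> \<gamma> (\<mu>, \<nu>) \<in> couplings \<mu> \<nu>"
    and \<gamma>o: "\<And>\<mu> \<nu>. \<mu> \<in> prob2 \<Longrightarrow> \<nu> \<in> prob2 \<Longrightarrow> quad_cost dist (\<gamma> (\<mu>, \<nu>)) = ennreal ((w2 \<mu> \<nu>)\<^sup>2)"
    by (rule measurable_optimal_plan) (rule that)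
  note c = couplingsD[OF \<Theta>(1)]
  note s1 = prob2_prob2D(2)[OF M(1)] and s2 = prob2_prob2D(2)[OF M(2)]
  have sp: "space \<Theta> = prob2 \<times> prob2" using c(5) prob2_prob2D(3)[OF M(1)] prob2_prob2D(3)[OF M(2)] by simp
  have s\<Theta>: "sets \<Theta> = sets (prob2_space \<Otimes>\<^sub>M prob2_space)"
    unfolding c(2) by (rule sets_pair_measure_cong) (simp_all add: s1 s2 sets_prob2_borel)
  have \<gamma>p: "\<gamma> w \<in> prob2" "marg1 (\<gamma> w) = fst w" "marg2 (\<gamma> w) = snd w" if "w \<in> space \<Theta>" for w
  proof -
    have w: "fst w \<in> prob2" "snd w \<in> prob2" "w = (fst w, snd w)"
      using that unfolding sp by (simp_all add: mem_Times_iff)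
    have "\<gamma> w \<in> couplings (fst w) (snd w)" using \<gamma>c[OF w(1,2)] by simp
    from coupling_prob2[OF w(1,2) this] show "\<gamma> w \<in> prob2" "marg1 (\<gamma> w) = fst w" "marg2 (\<gamma> w) = snd w" .
  qed
  \<comment> \<open>The selection is measurable into the evaluation sigma-algebra over pairs;
    \<open>sets_prob2_borel\<close>, applied to the product type, makes it measurable for the Borel
    sets of \<open>w2\<close> there.\<close>
  have \<gamma>: "\<gamma> \<in> \<Theta> \<rightarrow>\<^sub>M prob2_borel"
  proof -
    have "\<gamma> \<in> \<Theta> \<rightarrow>\<^sub>M prob2_space"
      unfolding prob2_space_def[where 'a = "'h \<times> 'h"]
      using \<gamma>m \<gamma>p(1) unfolding measurable_cong_sets[OF s\<Theta> refl] borel_prod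
      by (intro measurable_restrict_space2) (auto simp: sets_eq_imp_space_eq[OF s\<Theta>, symmetric])
    then show ?thesis by (simp only: measurable_cong_sets[OF refl sets_prob2_borel])
  qed
  define P where "P = distr \<Theta> prob2_borel \<gamma>"
  have d1: "distr P prob2_borel marg1 = M1"
  proof -
    have "distr P prob2_borel marg1 = distr \<Theta> prob2_borel (marg1 \<circ> \<gamma>)"
      unfolding P_def by (rule distr_distr[OF measurable_marg(1) \<gamma>])
    also have "\<dots> = distr \<Theta> M1 fst" by (rule distr_cong) (simp_all add: s1 \<gamma>p)
    finally show ?thesis using c(3) by simp
  qed
  have d2: "distr P prob2_borel marg2 = M2"
  proof -
    have "distr P prob2_borel marg2 = distr \<Theta> prob2_borel (marg2 \<circ> \<gamma>)"
      unfolding P_def by (rule distr_distr[OF measurable_marg(2) \<gamma>])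
    also have "\<dots> = distr \<Theta> M2 snd" by (rule distr_cong) (simp_all add: s2 \<gamma>p)
    finally show ?thesis using c(4) by simp
  qed
  have pP: "prob_space P" unfolding P_def by (rule prob_space.prob_space_distr[OF c(1) \<gamma>])
  \<comment> \<open>Taken about the origin, the second moment of a coupling is the sum of those of
    its marginals, so its integral under \<open>P\<close> is the sum of those under
    \<open>M1\<close> and \<open>M2\<close>.\<close>
  have P: "P \<in> prob2_prob2"
  proof (rule prob2_prob2I[of P "(0, 0)", OF pP])
    show "sets P = sets prob2_borel" by (simp add: P_def)
    have spP: "space P = prob2" by (simp add: P_def space_prob2_borel)
    have m1: "moment 0 \<in> borel_measurable (prob2_borel :: 'h measure measure)"
      unfolding measurable_cong_sets[OF sets_prob2_borel refl] by (rule measurable_moment)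
    have mm: "(\<lambda>\<gamma>. moment 0 (marg1 \<gamma>)) \<in> borel_measurable P" "(\<lambda>\<gamma>. moment 0 (marg2 \<gamma>)) \<in> borel_measurable P"
      unfolding P_def measurable_distr_eq1
      by (rule measurable_compose[OF measurable_marg(1) m1] measurable_compose[OF measurable_marg(2) m1])+
    have marg: "marg1 \<in> P \<rightarrow>\<^sub>M prob2_borel" "marg2 \<in> P \<rightarrow>\<^sub>M prob2_borel"
      unfolding P_def measurable_distr_eq1 by (rule measurable_marg)+
    have "(\<integral>\<^sup>+\<gamma>. moment (0, 0) \<gamma> \<partial>P) = (\<integral>\<^sup>+\<gamma>. moment 0 (marg1 \<gamma>) + moment 0 (marg2 \<gamma>) \<partial>P)"
      by (intro nn_integral_cong prob2_pair_moment prob2_pairD(1)) (simp add: spP)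
    also have "\<dots> = (\<integral>\<^sup>+\<gamma>. moment 0 (marg1 \<gamma>) \<partial>P) + (\<integral>\<^sup>+\<gamma>. moment 0 (marg2 \<gamma>) \<partial>P)"
      by (rule nn_integral_add[OF mm])
    also have "\<dots> = (\<integral>\<^sup>+\<mu>. moment 0 \<mu> \<partial>M1) + (\<integral>\<^sup>+\<mu>. moment 0 \<mu> \<partial>M2)"
      unfolding d1[symmetric] d2[symmetric] using nn_integral_distr[OF marg(1), of "moment 0"] nn_integral_distr[OF marg(2), of "moment 0"] m1
      by simp
    also have "\<dots> < \<infinity>"
      using prob2_prob2D(4)[OF M(1), of 0] prob2_prob2D(4)[OF M(2), of 0] by (simp add: less_top[symmetric] ennreal_add_eq_top)
    finally show "(\<integral>\<^sup>+\<gamma>. moment (0, 0) \<gamma> \<partial>P) < \<infinity>" .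
  qed
  have "random_cost P = (\<integral>\<^sup>+w. quad_cost dist (\<gamma> w) \<partial>\<Theta>)"
    unfolding random_cost_eq P_def by (rule nn_integral_distr[OF \<gamma>]) (simp add: measurable_quad_cost_prob2)
  also have "\<dots> = quad_cost w2 \<Theta>"
    unfolding quad_cost_eq[of w2] using \<gamma>o by (intro nn_integral_cong) (auto simp: sp)
  finally have "random_cost P = ennreal ((W2 M1 M2)\<^sup>2)" using \<Theta>(2) by simp
  moreover have "P \<in> random_couplings M1 M2" using P d1 d2 by (simp add: random_couplings_def)
  ultimately show ?thesis using that by blast
qed

lemma random_cost_eq_W2_iff:
  assumes P: "P \<in> random_couplings M1 M2"
  shows "random_cost P = ennreal ((W2 M1 M2)\<^sup>2) \<longleftrightarrow> (AE \<gamma> in P. \<gamma> \<in> opt_prob2) \<and>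
    distr P (prob2_borel \<Otimes>\<^sub>M prob2_borel) (\<lambda>\<gamma>. (marg1 \<gamma>, marg2 \<gamma>)) \<in> opt_couplings w2 M1 M2"
    (is "?L \<longleftrightarrow> ?A \<and> ?\<Theta> \<in> _")
proof -
  note r = random_coupling_marginals[OF P]
  let ?v = "\<lambda>\<gamma>::('h \<times> 'h) measure. ennreal ((w2 (marg1 \<gamma>) (marg2 \<gamma>))\<^sup>2)"
  have opt: "\<gamma> \<in> opt_prob2 \<longleftrightarrow> quad_cost dist \<gamma> = ?v \<gamma>" if "\<gamma> \<in> space P" for \<gamma>
    using that prob2_pairD[of \<gamma>] w2_sq[of "marg1 \<gamma>" "marg2 \<gamma>"]
    by (simp add: opt_prob2_def opt_couplings_iff r(6))
  have A: "?A \<longleftrightarrow> (AE \<gamma> in P. quad_cost dist \<gamma> = ?v \<gamma>)"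
    by (rule AE_cong) (rule opt)
  have \<Theta>: "?\<Theta> \<in> opt_couplings w2 M1 M2 \<longleftrightarrow> (\<integral>\<^sup>+\<gamma>. ?v \<gamma> \<partial>P) = ennreal ((W2 M1 M2)\<^sup>2)"
    unfolding opt_couplings_iff W2_sq r(2) using r(1) by simp
  have lower: "ennreal ((W2 M1 M2)\<^sup>2) \<le> (\<integral>\<^sup>+\<gamma>. ?v \<gamma> \<partial>P)"
    unfolding W2_sq r(2)[symmetric] by (rule INF_lower[OF r(1)])
  have upper: "(\<integral>\<^sup>+\<gamma>. ?v \<gamma> \<partial>P) \<le> random_cost P"
    unfolding random_cost_eq by (intro nn_integral_mono r(5))
  show ?thesis
    unfolding A \<Theta>
  proof
    assume L: ?L
    then have eq: "(\<integral>\<^sup>+\<gamma>. ?v \<gamma> \<partial>P) = ennreal ((W2 M1 M2)\<^sup>2)" using lower upper by simp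
    \<comment> \<open>A strict inequality on a set of positive measure would make the integrals
      differ; this requires the smaller integral to be finite, which \<open>eq\<close>
      provides.\<close>
    have "AE \<gamma> in P. quad_cost dist \<gamma> \<le> ?v \<gamma>"
    proof (rule ccontr)
      assume "\<not> ?thesis"
      then have "(\<integral>\<^sup>+\<gamma>. ?v \<gamma> \<partial>P) < (\<integral>\<^sup>+\<gamma>. quad_cost dist \<gamma> \<partial>P)"
        using r(5) by (intro nn_integral_less r(3,4) AE_I2) (simp_all add: eq)
      then show False using L eq by (simp add: random_cost_eq)
    qed
    then have "AE \<gamma> in P. quad_cost dist \<gamma> = ?v \<gamma>"
      using AE_I2[of P "\<lambda>\<gamma>. ?v \<gamma> \<le> quad_cost dist \<gamma>"] r(5) by (auto intro: antisym)
    then show "(AE \<gamma> in P. quad_cost dist \<gamma> = ?v \<gamma>) \<and> (\<integral>\<^sup>+\<gamma>. ?v \<gamma> \<partial>P) = ennreal ((W2 M1 M2)\<^sup>2)"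
      using eq by simp
  next
    assume R: "(AE \<gamma> in P. quad_cost dist \<gamma> = ?v \<gamma>) \<and> (\<integral>\<^sup>+\<gamma>. ?v \<gamma> \<partial>P) = ennreal ((W2 M1 M2)\<^sup>2)"
    then have "random_cost P = (\<integral>\<^sup>+\<gamma>. ?v \<gamma> \<partial>P)" unfolding random_cost_eq by (intro nn_integral_cong_AE) simp
    then show ?L using R by simp
  qed
qed

end

theorem proposition5p1:
  fixes M\<^sub>1 M\<^sub>2 :: "'h::{real_inner, polish_space} measure measure"
  assumes "M\<^sub>1 \<in> prob2_prob2" and "M\<^sub>2 \<in> prob2_prob2"
  shows "((\<exists>P \<in> random_couplings M\<^sub>1 M\<^sub>2. ennreal ((W2 M\<^sub>1 M\<^sub>2)\<^sup>2) = random_cost P) \<and>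
          (\<forall>P \<in> random_couplings M\<^sub>1 M\<^sub>2. ennreal ((W2 M\<^sub>1 M\<^sub>2)\<^sup>2) \<le> random_cost P)) \<and>
         (\<forall>P \<in> random_couplings M\<^sub>1 M\<^sub>2.
            is_arg_min random_cost (\<lambda>Q. Q \<in> random_couplings M\<^sub>1 M\<^sub>2) P \<longleftrightarrow>
            (AE \<gamma> in P. \<gamma> \<in> opt_prob2) \<and>
            distr P (prob2_borel \<Otimes>\<^sub>M prob2_borel) (\<lambda>\<gamma>. (marg1 \<gamma>, marg2 \<gamma>)) \<in> opt_couplings w2 M\<^sub>1 M\<^sub>2)"
proof -
  obtain P\<^sub>0 where P\<^sub>0: "P\<^sub>0 \<in> random_couplings M\<^sub>1 M\<^sub>2" "random_cost P\<^sub>0 = ennreal ((W2 M\<^sub>1 M\<^sub>2)\<^sup>2)"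
    by (rule optimal_random_coupling_exists[OF assms])
  note lower = W2_sq_le_random_cost[OF assms]
  have "is_arg_min random_cost (\<lambda>Q. Q \<in> random_couplings M\<^sub>1 M\<^sub>2) P \<longleftrightarrow> random_cost P = ennreal ((W2 M\<^sub>1 M\<^sub>2)\<^sup>2)"
    if P: "P \<in> random_couplings M\<^sub>1 M\<^sub>2" for P
  proof
    assume "is_arg_min random_cost (\<lambda>Q. Q \<in> random_couplings M\<^sub>1 M\<^sub>2) P"
    then have "random_cost P \<le> random_cost P\<^sub>0" using P\<^sub>0(1) by (auto simp: is_arg_min_def not_less)
    then show "random_cost P = ennreal ((W2 M\<^sub>1 M\<^sub>2)\<^sup>2)" using lower[OF P] P\<^sub>0(2) by simp
  next
    assume eq: "random_cost P = ennreal ((W2 M\<^sub>1 M\<^sub>2)\<^sup>2)"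
    show "is_arg_min random_cost (\<lambda>Q. Q \<in> random_couplings M\<^sub>1 M\<^sub>2) P"
      unfolding is_arg_min_def eq using P lower by (auto simp: not_less)
  qed
  then have "is_arg_min random_cost (\<lambda>Q. Q \<in> random_couplings M\<^sub>1 M\<^sub>2) P \<longleftrightarrow>
      (AE \<gamma> in P. \<gamma> \<in> opt_prob2) \<and>
      distr P (prob2_borel \<Otimes>\<^sub>M prob2_borel) (\<lambda>\<gamma>. (marg1 \<gamma>, marg2 \<gamma>)) \<in> opt_couplings w2 M\<^sub>1 M\<^sub>2"
    if "P \<in> random_couplings M\<^sub>1 M\<^sub>2" for P
    using that random_cost_eq_W2_iff[OF assms that] by simp
  moreover have "\<exists>P \<in> random_couplings M\<^sub>1 M\<^sub>2. ennreal ((W2 M\<^sub>1 M\<^sub>2)\<^sup>2) = random_cost P"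
    by (rule bexI) (rule P\<^sub>0(2)[symmetric], rule P\<^sub>0(1))
  ultimately show ?thesis using lower by blast
qed

end
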